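(* Let $\Sigma_0,\Sigma_1\in\mathbb S_\succ^d$, $q_1>(d-1)/2$, $2q_2>d+3$, let $\mu_i=\mathcal{MB}_d^{\mathrm{II}}(q_1,q_2,\Sigma_i)$ be matrix beta type II distributions, $i=0,1$, and let $c(X,Y)=\|X-Y\|_{\mathrm F}^2$. Set $q=2q_2-d$ and $C=(\Sigma_0^{1/2}\Sigma_1\Sigma_0^{1/2})^{1/2}$. Then: (a) the unique optimal Monge map from $\mu_0$ to $\mu_1$ is $T^\star(X)=A^\star XA^\star$, where $A^\star=\Sigma_0^{-1/2}(\Sigma_0^{1/2}\Sigma_1\Sigma_0^{1/2})^{1/2}\Sigma_0^{-1/2}$; (b) $(\mathrm{id}_{\mathbb S_\succ^d},T^\star)_\#\mu_0$ is the unique optimal Kantorovich plan; (c) $$\mathds K_c(\mu_0,\mu_1)=\frac{2q_1(2q_1q-2q_1+q+1)}{q(q-1)(q-3)}\|\Sigma_0-\Sigma_1\|_{\mathrm F}^2+\frac{2q_1(2q_1+q-1)}{q(q-1)(q-3)}\bigl((\mathrm{Tr}\,\Sigma_0)^2+(\mathrm{Tr}\,\Sigma_1)^2-2(\mathrm{Tr}\,C)^2\bigr);$$ (d) $\mathds M_c(\mu_0,\mu_1)=\mathds K_c(\mu_0,\mu_1)$.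
   Context: $\mathbb S_\succ^d$ is the cone of real symmetric positive definite $d\times d$ matrices ($d\ge1$); $\|\cdot\|_{\mathrm F}$ is the Frobenius norm; square roots are the positive definite ones; $T_\#\mu(B)=\mu(T^{-1}(B))$. For $\Sigma\in\mathbb S_\succ^d$ and $q_1,q_2>(d-1)/2$, the matrix beta type II distribution $\mathcal{MB}_d^{\mathrm{II}}(q_1,q_2,\Sigma)$ is the probability law on $\mathbb S_\succ^d$ with density $$X\mapsto\frac{\det(\Sigma)^{q_2}}{\mathsf B_d(q_1,q_2)}\det(X)^{q_1-(d+1)/2}\det(\Sigma+X)^{-(q_1+q_2)}$$ with respect to $\prod_{1\le i\le j\le d}dX_{ij}$, where $\mathsf B_d(a,b)=\mathsf\Gamma_d(a)\mathsf\Gamma_d(b)/\mathsf\Gamma_d(a+b)$ and $\mathsf\Gamma_d(a)=\pi^{d(d-1)/4}\prod_{j=1}^d\Gamma(a-\frac{j-1}2)$. With $\mathcal X=\mathbb S_\succ^d$: $\mathds M_c(\mu_0,\mu_1)=\inf_T\int c(X,T(X))\,d\mu_0(X)$ over Borel $T:\mathcal X\to\mathcal X$ with $T_\#\mu_0=\mu_1$ (a minimizer is an optimal Monge map; uniqueness is up to $\mu_0$-a.e. equality); $\mathds K_c(\mu_0,\mu_1)=\inf_\Gamma\int c\,d\Gamma$ over probability measures $\Gamma$ on $\mathcal X\times\mathcal X$ with marginals $\mu_0,\mu_1$ (a minimizer is an optimal Kantorovich plan). *)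

theory Defs
  imports "HOL-Probability.Probability"
begin

section \<open>Symmetric positive definite matrices\<close>

definition spd :: "(real ^ 'n ^ 'n) set" where
  "spd = {A. transpose A = A \<and> (\<forall>x. x \<noteq> 0 \<longrightarrow> x \<bullet> (A *v x) > 0)}"

text \<open>Only meaningful on \<^const>\<open>spd\<close>, where the positive definite square root exists and is unique.\<close>

definition spd_sqrt :: "real ^ 'n ^ 'n \<Rightarrow> real ^ 'n ^ 'n" where
  "spd_sqrt A = (THE B. B \<in> spd \<and> B ** B = A)"

text \<open>The library norm on \<^typ>\<open>real ^ 'n ^ 'n\<close> is the Frobenius norm.\<close>

lemma norm_matrix_eq_frobenius:
  fixes A :: "real ^ 'n ^ 'm"
  shows "norm A = sqrt (\<Sum>i\<in>UNIV. \<Sum>j\<in>UNIV. (A $ i $ j)\<^sup>2)"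
  by (simp add: norm_vec_def L2_set_def sum_nonneg)

section \<open>Matrix beta type II distribution\<close>

text \<open>
  The index type is linearly ordered so that the on-or-above-diagonal entries, which serve as
  coordinates of a symmetric matrix, can be singled out.
\<close>

definition sym_of_upper :: "('n::{finite,linorder} \<times> 'n \<Rightarrow> real) \<Rightarrow> real ^ 'n::{finite,linorder} ^ 'n::{finite,linorder}" where
  "sym_of_upper x = (\<chi> i j. x (min i j, max i j))"

definition sym_lborel :: "(real ^ 'n::{finite,linorder} ^ 'n::{finite,linorder}) measure" where
  "sym_lborel = distr (\<Pi>\<^sub>M p\<in>{(i, j). i \<le> j}. lborel) borel sym_of_upper"

definition mv_Gamma :: "nat \<Rightarrow> real \<Rightarrow> real" where
  "mv_Gamma d a = pi powr (real d * (real d - 1) / 4) * (\<Prod>j=1..d. Gamma (a - (real j - 1) / 2))"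

definition mv_Beta :: "nat \<Rightarrow> real \<Rightarrow> real \<Rightarrow> real" where
  "mv_Beta d a b = mv_Gamma d a * mv_Gamma d b / mv_Gamma d (a + b)"

definition mat_beta_II_density ::
    "real \<Rightarrow> real \<Rightarrow> real ^ 'n ^ 'n \<Rightarrow> real ^ 'n ^ 'n \<Rightarrow> real" where
  "mat_beta_II_density q1 q2 S X =
     det S powr q2 / mv_Beta CARD('n) q1 q2
       * det X powr (q1 - (real CARD('n) + 1) / 2) * det (S + X) powr (- (q1 + q2))"

definition mat_beta_II ::
    "real \<Rightarrow> real \<Rightarrow> real ^ 'n::{finite,linorder} ^ 'n::{finite,linorder} \<Rightarrow> (real ^ 'n::{finite,linorder} ^ 'n::{finite,linorder}) measure" where
  "mat_beta_II q1 q2 S =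
     density (restrict_space sym_lborel spd) (\<lambda>X. ennreal (mat_beta_II_density q1 q2 S X))"

lemma space_mat_beta_II [simp]: "space (mat_beta_II q1 q2 S) = spd"
  by (simp add: mat_beta_II_def sym_lborel_def space_restrict_space)

lemma sets_mat_beta_II [simp]: "sets (mat_beta_II q1 q2 S) = sets (restrict_space borel spd)"
  by (simp add: mat_beta_II_def sym_lborel_def sets_restrict_space)

section \<open>Optimal transport\<close>

text \<open>Costs are nonnegative; an infimum over the empty set is \<open>\<infinity>\<close>.\<close>

definition transport_maps :: "'a measure \<Rightarrow> 'b measure \<Rightarrow> ('a \<Rightarrow> 'b) set" where
  "transport_maps M N = {T \<in> measurable M N. distr M N T = N}"

definition monge :: "('a \<Rightarrow> 'b \<Rightarrow> ennreal) \<Rightarrow> 'a measure \<Rightarrow> 'b measure \<Rightarrow> ennreal" where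
  "monge c M N = (INF T\<in>transport_maps M N. \<integral>\<^sup>+x. c x (T x) \<partial>M)"

definition optimal_map ::
    "('a \<Rightarrow> 'b \<Rightarrow> ennreal) \<Rightarrow> 'a measure \<Rightarrow> 'b measure \<Rightarrow> ('a \<Rightarrow> 'b) \<Rightarrow> bool" where
  "optimal_map c M N T \<longleftrightarrow>
     T \<in> transport_maps M N \<and> (\<integral>\<^sup>+x. c x (T x) \<partial>M) = monge c M N"

definition transport_plans :: "'a measure \<Rightarrow> 'b measure \<Rightarrow> ('a \<times> 'b) measure set" where
  "transport_plans M N =
     {G. prob_space G \<and> sets G = sets (M \<Otimes>\<^sub>M N) \<and> distr G M fst = M \<and> distr G N snd = N}"

definition kantorovich :: "('a \<Rightarrow> 'b \<Rightarrow> ennreal) \<Rightarrow> 'a measure \<Rightarrow> 'b measure \<Rightarrow> ennreal" where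
  "kantorovich c M N = (INF G\<in>transport_plans M N. \<integral>\<^sup>+(x, y). c x y \<partial>G)"

definition optimal_plan ::
    "('a \<Rightarrow> 'b \<Rightarrow> ennreal) \<Rightarrow> 'a measure \<Rightarrow> 'b measure \<Rightarrow> ('a \<times> 'b) measure \<Rightarrow> bool" where
  "optimal_plan c M N G \<longleftrightarrow>
     G \<in> transport_plans M N \<and> (\<integral>\<^sup>+(x, y). c x y \<partial>G) = kantorovich c M N"

end

theory Submission
  imports Defs
begin

text \<open>
  The cost splits. Let \<open>B\<close> be the square root of the matrix \<open>A\<close> of the theorem. On the Euclidean space
  of matrices, \<open>K X = B X B\<close> is self-adjoint and invertible, and \<open>K (K X) = A X A\<close>. Expanding squares,
  \<open>|X - Y|\<^sup>2\<close> is a function of \<open>X\<close>, plus a function of \<open>Y\<close>, plus the square of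
  \<open>K X - K\<^sup>-\<^sup>1 Y\<close> (\<open>cost_decomposition\<close>). The first two parts have the same mean under every plan, and
  the last one vanishes exactly when \<open>Y = A X A\<close>. So a plan is optimal if and only if it is carried by the
  graph of \<open>X \<mapsto> A X A\<close>. This gives optimality, uniqueness and the equality of the Monge and
  Kantorovich values, as soon as that map transports one law to the other and second moments are finite.

  The map transports the laws because \<open>A S0 A = S1\<close> and a congruence \<open>X \<mapsto> G X G\<close> acts on a
  type II law through its scale only (\<open>nn_integral_mat_beta_II_congruence\<close>). This rests on the factor
  \<open>det G\<close> to the power \<open>d + 1\<close> by which the congruence scales Lebesgue measure on symmetric matrices. For
  diagonal \<open>G\<close> this is a computation in coordinates. For orthogonal congruences the factor is 1: a
  Fubini argument shows that some constant exists (\<open>nn_integral_sym_congruence_exchange\<close>), and the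
  orthogonally invariant, integrable beta weight shows that it is 1. The spectral theorem combines both.

  Integrability of the weight, the normalising constant and the laws of principal minors all come from one
  recursion (\<open>beta_kernel_recursion\<close>). When an index is added to a principal block, the determinants of
  the block and of its shift by the identity are multiplied by their Schur complements \<open>s\<close> and
  \<open>1 + s + b \<bullet> R b\<close>, where \<open>b\<close> is the new column and \<open>R\<close> is a positive definite matrix depending on
  the old block only, with explicit determinant. Integrating over \<open>b\<close> and \<open>s\<close> gives Gamma factors and
  the same integral for the old block with a shifted parameter.

  For the value of the cost, let the scale be the identity. By orthogonal invariance the mean of
  \<open>tr (X M X M)\<close> is a combination of \<open>tr (M\<^sup>2)\<close> and \<open>(tr M)\<^sup>2\<close> (\<open>trace_sandwich_moment\<close>), and the two weights
  follow from the means of \<open>X\<^sub>i\<^sub>i\<^sup>2\<close> and of the principal minors of size two, that is, from ratios of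
  multivariate beta functions. The general scale is reached by congruence with its square root, which turns
  \<open>|X|\<^sup>2\<close> and the mixed term \<open>tr (X A X A)\<close> into this form.
\<close>

type_synonym 'n sqmat = "real ^ 'n ^ 'n"


section \<open>Spectral theorem and positive definite square roots\<close>

lemma symmetric_inner:
  fixes A :: "real^'n^'n"
  assumes "transpose A = A"
  shows "x \<bullet> (A *v y) = (A *v x) \<bullet> y"
  by (metis assms dot_lmul_matrix transpose_matrix_vector)

text \<open>On an invariant subspace, a maximiser of the Rayleigh quotient is an eigenvector, because a nonnegative quadratic form vanishing at a point has vanishing
  gradient there.\<close>

lemma symmetric_eigenvector_exists:
  fixes A :: "real^'n^'n"
  assumes sym: "transpose A = A" and V: "subspace V" and inv: "\<And>x. x \<in> V \<Longrightarrow> A *v x \<in> V"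
    and nontriv: "V \<noteq> {0}"
  shows "\<exists>v\<in>V. norm v = 1 \<and> (\<exists>l. A *v v = l *\<^sub>R v)"
proof -
  let ?K = "V \<inter> sphere 0 1"
  have cpt: "compact ?K"
    using compact_Int_closed[OF compact_sphere closed_subspace[OF V]] by (simp add: Int_commute)
  obtain w where w: "w \<in> V" "w \<noteq> 0" using nontriv V subspace_0 by blast
  have "w /\<^sub>R norm w \<in> ?K" using w V by (auto simp: subspace_def)
  then have ne: "?K \<noteq> {}" by blast
  have "continuous_on ?K (\<lambda>x. x \<bullet> (A *v x))"
    by (intro continuous_on_inner continuous_on_id linear_continuous_on matrix_vector_mul_bounded_linear)
  from continuous_attains_sup[OF cpt ne this]
  obtain v where v: "v \<in> ?K" and max: "\<And>x. x \<in> ?K \<Longrightarrow> x \<bullet> (A *v x) \<le> v \<bullet> (A *v v)"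
    by blast
  define l where "l = v \<bullet> (A *v v)"
  define f where "f x = l * (x \<bullet> x) - x \<bullet> (A *v x)" for x
  have v1: "v \<in> V" "norm v = 1" using v by auto
  have vv: "v \<bullet> v = 1" using v1 by (simp add: norm_eq_1)
  have f_nonneg: "f x \<ge> 0" if x: "x \<in> V" for x
  proof (cases "x = 0")
    case False
    let ?y = "x /\<^sub>R norm x"
    have "?y \<in> ?K" using x V False by (auto simp: subspace_def)
    then have "?y \<bullet> (A *v ?y) \<le> l" using max l_def by blast
    then have "(x \<bullet> (A *v x)) / (norm x)^2 \<le> l"
      by (simp add: matrix_vector_mult_scaleR power2_eq_square field_simps)
    then have "x \<bullet> (A *v x) \<le> l * (norm x)^2"
      using False by (simp add: field_simps)
    then show ?thesis by (simp add: f_def power2_norm_eq_inner)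
  qed (simp add: f_def)
  have fv: "f v = 0" by (simp add: f_def l_def vv)
  have crit: "w \<bullet> (l *\<^sub>R v - A *v v) = 0" if w: "w \<in> V" for w
  proof (rule ccontr)
    assume ne: "w \<bullet> (l *\<^sub>R v - A *v v) \<noteq> 0"
    define g where "g = w \<bullet> (l *\<^sub>R v - A *v v)"
    have expand: "f (v + t *\<^sub>R w) = 2 * t * g + t^2 * f w" for t
    proof -
      have "v \<bullet> (A *v w) = w \<bullet> (A *v v)" using symmetric_inner[OF sym, of v w] by (simp add: inner_commute)
      then have "f (v + t *\<^sub>R w) = f v + 2 * t * g + t^2 * f w"
        unfolding f_def g_def
        by (simp add: algebra_simps inner_commute power2_eq_square
            matrix_vector_right_distrib matrix_vector_mult_scaleR)
      then show ?thesis using fv by simp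
    qed
    \<comment> \<open>Any sufficiently small step against the gradient would do; the summand 1 keeps the denominator positive
      when \<open>f w = 0\<close>.\<close>
    define t where "t = - g / (f w + 1)"
    have fw: "f w \<ge> 0" using f_nonneg w by blast
    have "f (v + t *\<^sub>R w) \<ge> 0" using V v1 w by (intro f_nonneg) (auto simp: subspace_def)
    then have "2 * t * g + t^2 * f w \<ge> 0" using expand by simp
    moreover have "g = - t * (f w + 1)" using fw by (simp add: t_def)
    then have "2 * t * g + t^2 * f w = 2 * t * (- t * (f w + 1)) + t^2 * f w" by simp
    then have "2 * t * g + t^2 * f w = - (t^2 * (f w + 2))"
      by (simp add: algebra_simps power2_eq_square)
    moreover have "t^2 * (f w + 2) > 0"
      using fw ne g_def by (intro mult_pos_pos) (auto simp: t_def)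
    ultimately show False by simp
  qed
  have "l *\<^sub>R v - A *v v \<in> V" using v1 V inv by (simp add: subspace_diff subspace_mul)
  then have "l *\<^sub>R v - A *v v = 0" using crit by (metis inner_eq_zero_iff)
  then have "A *v v = l *\<^sub>R v" by simp
  then show ?thesis using v1 by blast
qed

definition diag_mat :: "('n \<Rightarrow> real) \<Rightarrow> real^'n^'n" where
  "diag_mat d = (\<chi> i j. if i = j then d i else 0)"

lemma diag_mat_mult_vec: "(diag_mat d *v x) $ i = d i * x $ i"
  by (simp add: diag_mat_def matrix_vector_mult_def if_distrib[of "\<lambda>u. u * _"] cong: if_cong)

lemma diag_mat_transpose [simp]: "transpose (diag_mat d) = diag_mat d"
  by (auto simp: diag_mat_def transpose_def vec_eq_iff)

lemma diag_mat_mult: "diag_mat d ** diag_mat e = diag_mat (\<lambda>i. d i * e i)"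
  by (rule matrix_eq[THEN iffD2]) (simp add: matrix_vector_mul_assoc[symmetric] vec_eq_iff diag_mat_mult_vec)

lemma det_diag_mat: "det (diag_mat d) = (\<Prod>i\<in>UNIV. d i)"
  by (subst det_diagonal) (auto simp: diag_mat_def)

text \<open>A maximal orthonormal set of eigenvectors spans, since its orthogonal
  complement is invariant and would otherwise contain a further eigenvector.\<close>

theorem spectral_theorem:
  fixes A :: "real^'n^'n"
  assumes sym: "transpose A = A"
  obtains Q d where "orthogonal_matrix Q" "A = Q ** diag_mat d ** transpose Q"
proof -
  define ON where "ON B \<longleftrightarrow> pairwise orthogonal B \<and> (\<forall>v\<in>B. norm v = 1 \<and> (\<exists>l. A *v v = l *\<^sub>R v))"
    for B :: "(real^'n) set"
  have ind: "independent B" if "ON B" for B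
    using that by (intro pairwise_orthogonal_independent) (auto simp: ON_def)
  have card: "card B \<le> CARD('n)" if "ON B" for B
    using independent_bound[OF ind[OF that]] by simp
  have "ON {}" by (simp add: ON_def)
  then have "\<exists>B. ON B \<and> (\<forall>B'. ON B' \<longrightarrow> card B' \<le> card B)"
    using card by (intro ex_has_greatest_nat[where b = "Suc CARD('n)"]) (auto simp: less_Suc_eq_le)
  then obtain B where B: "ON B" and max: "\<And>B'. ON B' \<Longrightarrow> card B' \<le> card B"
    by blast
  have finB: "finite B" using independent_bound[OF ind[OF B]] by simp
  define W where "W = {w. \<forall>b\<in>B. w \<bullet> b = 0}"
  have "subspace W" by (auto simp: subspace_def W_def inner_left_distrib)
  moreover have "A *v x \<in> W" if "x \<in> W" for x
  proof -
    have "(A *v x) \<bullet> b = 0" if "b \<in> B" for b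
    proof -
      have "\<exists>l. A *v b = l *\<^sub>R b" using B that by (simp add: ON_def)
      then obtain l where "A *v b = l *\<^sub>R b" ..
      then have "(A *v x) \<bullet> b = l * (x \<bullet> b)"
        unfolding symmetric_inner[OF sym, symmetric] by simp
      then show ?thesis using \<open>x \<in> W\<close> that by (simp add: W_def)
    qed
    then show ?thesis by (simp add: W_def)
  qed
  moreover have False if W: "W \<noteq> {0}" "subspace W" "\<And>x. x \<in> W \<Longrightarrow> A *v x \<in> W"
  proof -
    obtain v where v: "v \<in> W" "norm v = 1" "\<exists>l. A *v v = l *\<^sub>R v"
      using symmetric_eigenvector_exists[OF sym W(2) W(3) W(1)] by blast
    have "v \<notin> B" using v by (auto simp: W_def)
    moreover have "ON (insert v B)"
      using B v by (auto simp: ON_def pairwise_insert W_def orthogonal_def inner_commute)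
    ultimately show False using max[of "insert v B"] finB by simp
  qed
  ultimately have W0: "W = {0}" by blast
  have "span B = UNIV"
  proof -
    have "x \<in> span B" for x
    proof -
      obtain y z where "y \<in> span B" "\<And>w. w \<in> span B \<Longrightarrow> orthogonal z w" "x = y + z"
        using orthogonal_subspace_decomp_exists[of B x] by metis
      moreover have "z \<in> W" using calculation(2) by (auto simp: W_def orthogonal_def span_base)
      ultimately show ?thesis using W0 by simp
    qed
    then show ?thesis by blast
  qed
  then have "card B = CARD('n)"
    using ind[OF B] dim_eq_card[of B UNIV] by (simp add: dim_UNIV)
  then obtain f where f: "bij_betw f (UNIV::'n set) B"
    using finite_same_card_bij[of "UNIV::'n set" B] finB by auto
  have fB: "f i \<in> B" for i using f by (auto simp: bij_betw_def)
  define Q where "Q = (\<chi> i j. f j $ i)"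
  have col: "column j Q = f j" for j by (simp add: Q_def column_def)
  have "orthogonal_matrix Q"
  proof (subst orthogonal_matrix_orthonormal_columns, safe)
    fix i show "norm (column i Q) = 1" using fB B by (simp add: col ON_def)
  next
    fix i j :: 'n assume "i \<noteq> j"
    then have "f i \<noteq> f j" using f by (auto simp: bij_betw_def inj_on_def)
    then show "orthogonal (column i Q) (column j Q)"
      using B fB[of i] fB[of j] by (auto simp: col ON_def pairwise_def)
  qed
  moreover have "\<forall>i. \<exists>l. A *v f i = l *\<^sub>R f i" using B fB unfolding ON_def by blast
  then obtain d where d: "\<And>i. A *v f i = d i *\<^sub>R f i" by metis
  have "A ** Q = Q ** diag_mat d"
  proof (rule vec_eq_iff[THEN iffD2], rule allI, rule vec_eq_iff[THEN iffD2], rule allI)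
    fix i j
    have "(A ** Q) $ i $ j = (A *v f j) $ i"
      by (simp add: matrix_matrix_mult_def matrix_vector_mult_def Q_def)
    also have "\<dots> = (Q ** diag_mat d) $ i $ j"
      by (simp add: d matrix_matrix_mult_def Q_def diag_mat_def if_distrib[of "\<lambda>u. _ * u"] cong: if_cong)
    finally show "(A ** Q) $ i $ j = (Q ** diag_mat d) $ i $ j" .
  qed
  then have "A ** Q ** transpose Q = Q ** diag_mat d ** transpose Q" by simp
  moreover have "A ** Q ** transpose Q = A ** (Q ** transpose Q)" by (simp add: matrix_mul_assoc)
  ultimately have "A = Q ** diag_mat d ** transpose Q"
    using \<open>orthogonal_matrix Q\<close> by (simp add: orthogonal_matrix_def)
  then show thesis using that \<open>orthogonal_matrix Q\<close> by blast
qed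

subsection \<open>Algebra of positive definite matrices\<close>

lemma spd_symmetric: "A \<in> spd \<Longrightarrow> transpose A = A"
  by (simp add: spd_def)

lemma spd_pos: "A \<in> spd \<Longrightarrow> x \<noteq> 0 \<Longrightarrow> x \<bullet> (A *v x) > 0"
  by (simp add: spd_def)

lemma spd_nonneg: "A \<in> spd \<Longrightarrow> x \<bullet> (A *v x) \<ge> 0"
  by (cases "x = 0") (auto dest: spd_pos[of A x])

lemma spd_I: "transpose A = A \<Longrightarrow> (\<And>x. x \<noteq> 0 \<Longrightarrow> x \<bullet> (A *v x) > 0) \<Longrightarrow> A \<in> spd"
  by (simp add: spd_def)

lemma spd_mat_1 [simp]: "mat 1 \<in> (spd :: (real^'n^'n) set)"
  by (rule spd_I) auto

lemma transpose_add: "transpose (A + B) = transpose A + transpose (B :: real^'n^'m)"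
  by (simp add: transpose_def vec_eq_iff)

lemma transpose_diff: "transpose (A - B) = transpose A - transpose (B :: real^'n^'m)"
  by (simp add: transpose_def vec_eq_iff)

lemma matrix_diff_ldistrib: "A ** (B - C) = A ** B - A ** (C :: real^'n^'m)"
  by (simp add: matrix_matrix_mult_def vec_eq_iff sum_subtractf algebra_simps)

lemma matrix_diff_rdistrib: "(B - C) ** A = B ** A - C ** (A :: real^'n^'m)"
  by (simp add: matrix_matrix_mult_def vec_eq_iff sum_subtractf algebra_simps)

lemma spd_add:
  assumes "A \<in> spd" "B \<in> spd"
  shows "A + B \<in> spd"
proof (rule spd_I)
  show "transpose (A + B) = A + B" using assms by (simp add: transpose_add spd_symmetric)
  fix x :: "real^'a" assume "x \<noteq> 0"
  then have "x \<bullet> (A *v x) > 0" "x \<bullet> (B *v x) > 0" using assms by (simp_all add: spd_pos)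
  then show "x \<bullet> ((A + B) *v x) > 0"
    by (simp only: matrix_vector_mult_add_rdistrib inner_add_right add_pos_pos)
qed

lemma spd_invertible:
  fixes A :: "real^'n^'n"
  assumes "A \<in> spd" shows "invertible A"
proof -
  have "x = 0" if "A *v x = 0" for x using spd_pos[OF assms, of x] that by auto
  then show ?thesis using matrix_left_invertible_ker[of A] invertible_left_inverse by blast
qed

lemma inner_congruence: "x \<bullet> ((transpose G ** A ** G) *v x) = (G *v x) \<bullet> (A *v (G *v x))"
  for A G :: "real^'n^'n"
proof -
  have "x \<bullet> ((transpose G ** A ** G) *v x) = x \<bullet> (transpose G *v (A *v (G *v x)))"
    by (simp only: matrix_vector_mul_assoc matrix_mul_assoc)
  also have "\<dots> = (x v* transpose G) \<bullet> (A *v (G *v x))"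
    by (simp only: dot_lmul_matrix)
  finally show ?thesis by (simp only: vector_transpose_matrix)
qed

lemma spd_congruence:
  fixes G A :: "real^'n^'n"
  assumes "invertible G" "A \<in> spd"
  shows "transpose G ** A ** G \<in> spd"
proof (rule spd_I)
  show "transpose (transpose G ** A ** G) = transpose G ** A ** G"
    using assms by (simp add: matrix_transpose_mul spd_symmetric matrix_mul_assoc)
  fix x :: "real^'n" assume "x \<noteq> 0"
  then have "G *v x \<noteq> 0" using assms(1)
    using invertible_left_inverse matrix_left_invertible_ker by blast
  then show "0 < x \<bullet> ((transpose G ** A ** G) *v x)"
    unfolding inner_congruence using assms(2) by (rule spd_pos[rotated])
qed

lemma matrix_inv_left: "invertible A \<Longrightarrow> matrix_inv A ** A = mat 1"
  and matrix_inv_right: "invertible A \<Longrightarrow> A ** matrix_inv A = mat 1"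
  for A :: "real^'n^'n"
  unfolding invertible_def matrix_inv_def by (metis (mono_tags, lifting) someI_ex)+

lemma matrix_inv_unique: "A ** B = mat 1 \<Longrightarrow> matrix_inv A = B" for A B :: "real^'n^'n"
  by (metis invertible_left_inverse matrix_inv_left matrix_left_right_inverse matrix_mul_assoc
      matrix_mul_lid matrix_mul_rid)

lemma matrix_inv_invertible: "invertible A \<Longrightarrow> invertible (matrix_inv A)" for A :: "real^'n^'n"
  by (metis invertible_def matrix_inv_left matrix_inv_right)

lemma matrix_inv_symmetric:
  fixes A :: "real^'n^'n"
  assumes "invertible A" "transpose A = A"
  shows "transpose (matrix_inv A) = matrix_inv A"
  by (metis assms matrix_inv_left matrix_inv_unique matrix_transpose_mul transpose_mat)

lemma spd_matrix_inv:
  fixes A :: "real^'n^'n"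
  assumes "A \<in> spd" shows "matrix_inv A \<in> spd"
proof -
  let ?B = "matrix_inv A"
  have inv: "invertible A" using assms by (rule spd_invertible)
  have "transpose ?B ** A ** ?B \<in> spd"
    using assms inv by (intro spd_congruence matrix_inv_invertible)
  moreover have "transpose ?B ** A ** ?B = ?B"
    using matrix_inv_left[OF inv] matrix_inv_symmetric[OF inv spd_symmetric[OF assms]] by simp
  ultimately show ?thesis by simp
qed

lemma orthogonal_matrix_invertible: "orthogonal_matrix Q \<Longrightarrow> invertible Q" for Q :: "real^'n^'n"
  by (auto simp: orthogonal_matrix_def invertible_def)

lemma spd_diag_mat: "(\<And>i. d i > 0) \<Longrightarrow> diag_mat d \<in> spd"
proof (rule spd_I)
  fix x :: "real^'a" assume d: "\<And>i. d i > 0" and "x \<noteq> 0"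
  then obtain i where "x $ i \<noteq> 0" by (auto simp: vec_eq_iff)
  moreover have "x \<bullet> (diag_mat d *v x) = (\<Sum>i\<in>UNIV. d i * (x $ i)\<^sup>2)"
    by (simp add: inner_vec_def diag_mat_mult_vec power2_eq_square algebra_simps)
  ultimately show "x \<bullet> (diag_mat d *v x) > 0"
    using d by (auto intro!: sum_pos2[of _ i] simp: less_imp_le)
qed simp

lemma spectral_form:
  fixes Q :: "real^'n^'n"
  assumes Q: "orthogonal_matrix Q"
  shows "(Q *v axis i 1) \<bullet> ((Q ** diag_mat d ** transpose Q) *v (Q *v axis i 1)) = d i"
proof -
  have "transpose Q ** (Q ** diag_mat d ** transpose Q) ** Q = diag_mat d"
    using Q unfolding orthogonal_matrix_def by (metis matrix_mul_assoc matrix_mul_lid matrix_mul_rid)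
  then show ?thesis
    unfolding inner_congruence[symmetric] by (simp add: inner_axis' diag_mat_mult_vec)
qed

lemma spd_spectral:
  fixes A :: "real^'n^'n"
  assumes "A \<in> spd"
  obtains Q d where "orthogonal_matrix Q" "\<And>i. d i > 0" "A = Q ** diag_mat d ** transpose Q"
proof -
  obtain Q d where Q: "orthogonal_matrix Q" and A: "A = Q ** diag_mat d ** transpose Q"
    using spectral_theorem spd_symmetric[OF assms] by metis
  have "d i > 0" for i
  proof -
    have "transpose Q *v (Q *v axis i 1) = axis i 1"
      using Q by (simp only: orthogonal_matrix_def matrix_vector_mul_assoc matrix_vector_mul_lid)
    then have "Q *v axis i 1 \<noteq> 0" by (metis axis_eq_0_iff matrix_vector_mult_0_right zero_neq_one)
    from spd_pos[OF assms this] show ?thesis unfolding A spectral_form[OF Q] .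
  qed
  then show thesis using that Q A by blast
qed

lemma det_orthogonal_congruence:
  "orthogonal_matrix Q \<Longrightarrow> det (Q ** A ** transpose Q) = det A" for Q A :: "real^'n^'n"
  using det_orthogonal_matrix[of Q] by (auto simp: det_mul)

lemma spd_det_pos: "A \<in> spd \<Longrightarrow> det A > 0" for A :: "real^'n^'n"
  by (erule spd_spectral) (simp add: det_orthogonal_congruence det_diag_mat prod_pos)

lemma spd_sqrt_unique:
  fixes A B :: "real^'n^'n"
  assumes A: "A \<in> spd" and B: "B \<in> spd" and eq: "A ** A = B ** B"
  shows "A = B"
proof -
  \<comment> \<open>\<open>A D + D B = 0\<close>; evaluated at an eigenvector of \<open>D\<close>, this says that the
    eigenvalue times a positive number vanishes.\<close>
  define D where "D = A - B"
  have symD: "transpose D = D" using A B by (simp add: D_def transpose_diff spd_symmetric)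
  obtain Q d where Q: "orthogonal_matrix Q" and D: "D = Q ** diag_mat d ** transpose Q"
    using spectral_theorem[OF symD] by metis
  have ADB: "A ** D + D ** B = 0"
    by (simp add: D_def matrix_diff_ldistrib matrix_diff_rdistrib eq)
  have d0: "d i = 0" for i
  proof -
    define v where "v = Q *v axis i 1"
    have QTv: "transpose Q *v v = axis i 1"
      using Q by (simp only: v_def orthogonal_matrix_def matrix_vector_mul_assoc matrix_vector_mul_lid)
    have v0: "v \<noteq> 0" using QTv by (metis axis_eq_0_iff matrix_vector_mult_0_right zero_neq_one)
    have "D *v v = Q *v (diag_mat d *v (transpose Q *v v))"
      by (simp only: D matrix_vector_mul_assoc matrix_mul_assoc)
    also have "diag_mat d *v (transpose Q *v v) = d i *\<^sub>R axis i 1"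
      unfolding QTv by (simp add: vec_eq_iff diag_mat_mult_vec axis_def)
    finally have Dv: "D *v v = d i *\<^sub>R v" by (simp add: matrix_vector_mult_scaleR v_def)
    have "0 = v \<bullet> ((A ** D + D ** B) *v v)" by (simp add: ADB)
    also have "\<dots> = v \<bullet> (A *v (D *v v)) + (D *v v) \<bullet> (B *v v)"
      by (simp add: matrix_vector_mult_add_rdistrib inner_add_right matrix_vector_mul_assoc[symmetric]
          symmetric_inner[OF symD])
    also have "\<dots> = d i * (v \<bullet> (A *v v) + v \<bullet> (B *v v))"
      by (simp add: Dv matrix_vector_mult_scaleR algebra_simps)
    finally show ?thesis using spd_pos[OF A v0] spd_pos[OF B v0] by simp
  qed
  have "diag_mat d = 0" using d0 by (simp add: diag_mat_def vec_eq_iff)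
  then have "D = 0" unfolding D
    by (simp add: vec_eq_iff matrix_matrix_mult_def)
  then show ?thesis by (simp add: D_def)
qed

lemma spd_sqrt:
  fixes A :: "real^'n^'n"
  assumes "A \<in> spd"
  shows spd_sqrt_spd: "spd_sqrt A \<in> spd" and spd_sqrt_square: "spd_sqrt A ** spd_sqrt A = A"
proof -
  obtain Q d where Q: "orthogonal_matrix Q" and d: "\<And>i. d i > 0" and A: "A = Q ** diag_mat d ** transpose Q"
    using spd_spectral assms by metis
  define R where "R = Q ** diag_mat (\<lambda>i. sqrt (d i)) ** transpose Q"
  have "R \<in> spd"
    using spd_congruence[of "transpose Q" "diag_mat (\<lambda>i. sqrt (d i))"] Q d
    by (simp add: R_def spd_diag_mat orthogonal_matrix_invertible)
  moreover have "R ** R = A"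
  proof -
    have "R ** R = Q ** diag_mat (\<lambda>i. sqrt (d i)) ** (transpose Q ** Q) ** diag_mat (\<lambda>i. sqrt (d i)) ** transpose Q"
      by (simp add: R_def matrix_mul_assoc)
    also have "\<dots> = Q ** (diag_mat (\<lambda>i. sqrt (d i)) ** diag_mat (\<lambda>i. sqrt (d i))) ** transpose Q"
      using Q by (simp add: orthogonal_matrix_def matrix_mul_assoc)
    also have "\<dots> = A" using d by (simp add: A diag_mat_mult less_imp_le)
    finally show ?thesis .
  qed
  ultimately have "\<exists>!B. B \<in> spd \<and> B ** B = A" using spd_sqrt_unique by metis
  from theI'[OF this] show "spd_sqrt A \<in> spd" "spd_sqrt A ** spd_sqrt A = A"
    unfolding spd_sqrt_def by auto
qed

lemma matrix_add_rdistrib: "(B + C) ** A = B ** A + C ** (A :: real^'n^'m)"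
  by (simp add: matrix_matrix_mult_def vec_eq_iff sum.distrib algebra_simps)

section \<open>Principal blocks and Schur complements\<close>

text \<open>A principal block, padded by the identity to keep the ambient size: determinants and positive
  definiteness of the padded matrix are those of the block, and all blocks live in one type.\<close>

definition emb :: "'n set \<Rightarrow> real^'n^'n \<Rightarrow> real^'n^'n" where
  "emb I M = (\<chi> i j. if i \<in> I \<and> j \<in> I then M $ i $ j else if i = j then 1 else 0)"

lemma emb_UNIV [simp]: "emb UNIV M = M"
  by (simp add: emb_def vec_eq_iff)

lemma emb_empty [simp]: "emb {} M = mat 1"
  by (simp add: emb_def vec_eq_iff mat_def)

lemma emb_symmetric: "transpose M = M \<Longrightarrow> transpose (emb I M) = emb I M"
  by (simp add: emb_def transpose_def vec_eq_iff)

lemma emb_mult_vec_outside: "i \<notin> I \<Longrightarrow> (emb I M *v x) $ i = x $ i"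
  by (simp add: emb_def matrix_vector_mult_def if_distrib[of "\<lambda>u. u * _"] cong: if_cong)

definition coord_proj :: "'n set \<Rightarrow> real^'n^'n" where
  "coord_proj I = diag_mat (\<lambda>i. if i \<in> I then 1 else 0)"

lemma coord_proj_mult_vec [simp]: "(coord_proj I *v x) $ i = (if i \<in> I then x $ i else 0)"
  by (simp add: coord_proj_def diag_mat_mult_vec)

lemma coord_proj_transpose [simp]: "transpose (coord_proj I) = coord_proj I"
  by (simp add: coord_proj_def)

lemma emb_inner:
  "x \<bullet> (emb I M *v x) = (coord_proj I *v x) \<bullet> (M *v (coord_proj I *v x)) + (\<Sum>i\<in>- I. (x $ i)\<^sup>2)"
proof -
  have 1: "(emb I M *v x) $ i = (if i \<in> I then (M *v (coord_proj I *v x)) $ i else x $ i)" for i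
    by (auto simp: emb_mult_vec_outside) (auto simp: emb_def matrix_vector_mult_def
      coord_proj_def diag_mat_def if_distrib[of "\<lambda>u. u * _"] intro!: sum.cong cong: if_cong)
  have "x \<bullet> (emb I M *v x) = (\<Sum>i\<in>UNIV. if i \<in> I then x $ i * (M *v (coord_proj I *v x)) $ i else (x $ i)\<^sup>2)"
    by (auto simp: inner_vec_def 1 power2_eq_square intro!: sum.cong)
  also have "\<dots> = (\<Sum>i\<in>I. x $ i * (M *v (coord_proj I *v x)) $ i) + (\<Sum>i\<in>- I. (x $ i)\<^sup>2)"
    by (subst sum.If_cases) (auto simp: Compl_eq)
  also have "(\<Sum>i\<in>I. x $ i * (M *v (coord_proj I *v x)) $ i)
      = (coord_proj I *v x) \<bullet> (M *v (coord_proj I *v x))"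
    unfolding inner_vec_def
    by (rule sum.mono_neutral_cong_left) auto
  finally show ?thesis .
qed

lemma emb_emb: "I \<subseteq> J \<Longrightarrow> emb I (emb J M) = emb I M"
  by (auto simp: emb_def vec_eq_iff)

lemma spd_emb:
  assumes "M \<in> spd" shows "emb I M \<in> spd"
proof (rule spd_I)
  show "transpose (emb I M) = emb I M" using assms by (intro emb_symmetric spd_symmetric)
  fix x :: "real^'a" assume x: "x \<noteq> 0"
  show "x \<bullet> (emb I M *v x) > 0"
  proof (cases "coord_proj I *v x = 0")
    case True
    obtain i where i: "x $ i \<noteq> 0" using x by (auto simp: vec_eq_iff)
    with True have "i \<notin> I" by (auto simp: vec_eq_iff split: if_splits)
    then have "(\<Sum>i\<in>- I. (x $ i)\<^sup>2) > 0" using i by (intro sum_pos2[of _ i]) auto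
    then show ?thesis by (simp add: emb_inner True)
  next
    case False
    then have "(coord_proj I *v x) \<bullet> (M *v (coord_proj I *v x)) > 0" by (rule spd_pos[OF assms])
    then show ?thesis by (simp add: emb_inner add_pos_nonneg sum_nonneg)
  qed
qed

lemma spd_emb_mono: "emb J M \<in> spd \<Longrightarrow> I \<subseteq> J \<Longrightarrow> emb I M \<in> spd"
  using spd_emb[of "emb J M" I] by (simp add: emb_emb)

definition border :: "'n set \<Rightarrow> 'n \<Rightarrow> real^'n^'n \<Rightarrow> real^'n" where
  "border I k M = (\<chi> i. if i \<in> I then M $ i $ k else 0)"

definition schur :: "'n set \<Rightarrow> 'n \<Rightarrow> real^'n^'n \<Rightarrow> real" where
  "schur I k M = M $ k $ k - border I k M \<bullet> (matrix_inv (emb I M) *v border I k M)"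

definition shear :: "'n \<Rightarrow> real^'n \<Rightarrow> real^'n^'n" where
  "shear k u = mat 1 + (\<chi> i j. if j = k then u $ i else 0)"

lemma shear_mult_vec: "shear k u *v x = x + x $ k *\<^sub>R u"
  by (simp add: shear_def matrix_vector_mult_add_rdistrib vec_eq_iff)
     (simp add: matrix_vector_mult_def if_distrib[of "\<lambda>u. u * _"] cong: if_cong)

lemma transpose_shear_mult_vec: "transpose (shear k u) *v x = x + (u \<bullet> x) *\<^sub>R axis k 1"
proof -
  have "transpose (shear k u) = mat 1 + (\<chi> i j. if i = k then u $ j else 0)"
    by (auto simp: shear_def transpose_def vec_eq_iff mat_def)
  moreover have "(\<chi> i j. if i = k then u $ j else 0) *v x = (u \<bullet> x) *\<^sub>R axis k 1"
    by (auto simp: vec_eq_iff matrix_vector_mult_def inner_vec_def axis_def)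
  ultimately show ?thesis by (simp only: matrix_vector_mult_add_rdistrib matrix_vector_mul_lid)
qed

lemma det_shear:
  fixes u :: "real^'n"
  assumes "u $ k = 0" shows "det (shear k u) = 1"
proof -
  have rows: "row j (mat 1 :: real^'n^'n) = axis j 1" for j
    by (simp add: row_def mat_def axis_def vec_eq_iff)
  have "u = (\<Sum>j\<in>UNIV - {k}. (u $ j) *s axis j 1)"
    using assms by (auto simp: vec_eq_iff axis_def if_distrib[of "\<lambda>z. _ * z"] cong: if_cong)
  also have "\<dots> \<in> vec.span {row j (mat 1 :: real^'n^'n) |j. j \<noteq> k}"
    by (intro vec.span_sum vec.span_scale vec.span_base) (auto simp: rows)
  finally have "det (\<chi> i. if i = k then row k (mat 1) + u else row i (mat 1)) = det (mat 1 :: real^'n^'n)"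
    by (rule det_row_span)
  moreover have "(\<chi> i. if i = k then row k (mat 1) + u else row i (mat 1)) = transpose (shear k u)"
    by (auto simp: row_def shear_def transpose_def mat_def axis_def vec_eq_iff)
  ultimately show ?thesis by (metis det_I det_transpose)
qed

text \<open>Adding the index \<open>k\<close> to a block is a block \<open>LDL\<^sup>T\<close> step: the larger block is congruent,
  by the unipotent shear along \<open>u\<close>, to the smaller block with the Schur complement as the \<open>k\<close>-th
  pivot. Determinants, positive definiteness and the completion of the square in the quadratic form
  are all read off from this one factorisation.\<close>

context
  fixes I :: "'n::finite set" and k :: 'n and M P :: "real^'n^'n" and b u :: "real^'n" and s :: real
    and D :: "real^'n^'n"
  assumes k: "k \<notin> I" and sym: "transpose M = M" and P_spd: "emb I M \<in> spd"
  defines "P \<equiv> emb I M" and "b \<equiv> border I k M" and "u \<equiv> matrix_inv P *v b" and "s \<equiv> schur I k M"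
    and "D \<equiv> (\<chi> i j. if i = k then s * P $ i $ j else P $ i $ j)"
begin

lemma block_self_adjoint: "x \<bullet> (P *v y) = (P *v x) \<bullet> y"
  unfolding P_def by (rule symmetric_inner[OF spd_symmetric[OF P_spd]])

lemma block_mult_u: "P *v u = b"
  using matrix_inv_right[OF spd_invertible[OF P_spd]] by (simp add: u_def P_def matrix_vector_mul_assoc)

lemma u_at_k: "u $ k = 0"
proof -
  have "u $ k = (P *v u) $ k" unfolding P_def by (rule emb_mult_vec_outside[OF k, symmetric])
  also have "\<dots> = 0" unfolding block_mult_u by (simp add: b_def border_def k)
  finally show ?thesis .
qed

lemma pivot_eq: "s = M $ k $ k - b \<bullet> u"
  by (simp add: s_def schur_def b_def u_def P_def)

lemma pivot_mult_vec: "D *v x = P *v x + ((s - 1) * x $ k) *\<^sub>R axis k 1"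
proof -
  have "(D *v x) $ i = (if i = k then s * (P *v x) $ k else (P *v x) $ i)" for i
    by (simp add: D_def matrix_vector_mult_def sum_distrib_left mult.assoc)
  moreover have "(P *v x) $ k = x $ k" unfolding P_def by (rule emb_mult_vec_outside[OF k])
  ultimately show ?thesis by (auto simp: vec_eq_iff axis_def algebra_simps)
qed

lemma emb_insert_mult_vec:
  "emb (insert k I) M *v x = P *v x + x $ k *\<^sub>R b + (b \<bullet> x + (M $ k $ k - 1) * x $ k) *\<^sub>R axis k 1"
proof -
  have Msym: "M $ k $ j = M $ j $ k" if "j \<noteq> k" for j
    using arg_cong[OF sym, of "\<lambda>M. M $ j $ k"] by (simp add: transpose_def)
  have "emb (insert k I) M $ i $ j = (P + (\<chi> i j. if j = k then b $ i else 0) + (\<chi> i j. if i = k then b $ j else 0)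
       + (\<chi> i j. if i = k \<and> j = k then M $ k $ k - 1 else 0)) $ i $ j" for i j
    using k by (cases "i = k"; cases "j = k") (simp_all add: emb_def P_def b_def border_def Msym)
  then have "emb (insert k I) M = P + (\<chi> i j. if j = k then b $ i else 0) + (\<chi> i j. if i = k then b $ j else 0)
       + (\<chi> i j. if i = k \<and> j = k then M $ k $ k - 1 else 0)"
    unfolding vec_eq_iff by blast
  moreover have "(\<chi> i j. if j = k then b $ i else 0) *v x = x $ k *\<^sub>R b"
    by (simp add: vec_eq_iff matrix_vector_mult_def if_distrib[of "\<lambda>u. u * _"] cong: if_cong)
  moreover have "(\<chi> i j. if i = k then b $ j else 0) *v x = (b \<bullet> x) *\<^sub>R axis k 1"
    by (auto simp: vec_eq_iff matrix_vector_mult_def inner_vec_def axis_def)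
  moreover have "(\<chi> i j. if i = k \<and> j = k then M $ k $ k - 1 else 0) *v x = ((M $ k $ k - 1) * x $ k) *\<^sub>R axis k 1"
    by (auto simp: vec_eq_iff matrix_vector_mult_def axis_def if_distrib[of "\<lambda>u. u * _"] cong: if_cong)
  ultimately show ?thesis by (simp only: matrix_vector_mult_add_rdistrib scaleR_add_left add.assoc)
qed

lemma emb_insert_factor: "emb (insert k I) M = transpose (shear k u) ** D ** shear k u"
proof (rule matrix_eq[THEN iffD2], rule allI)
  fix x
  define z where "z = D *v (x + x $ k *\<^sub>R u)"
  have z: "z = P *v x + x $ k *\<^sub>R b + ((s - 1) * x $ k) *\<^sub>R axis k 1"
    by (simp add: z_def pivot_mult_vec matrix_vector_right_distrib matrix_vector_mult_scaleR block_mult_u u_at_k)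
  have "u \<bullet> z = u \<bullet> (P *v x) + x $ k * (u \<bullet> b)"
    by (simp add: z inner_add_right inner_axis u_at_k)
  then have uz: "u \<bullet> z = b \<bullet> x + x $ k * (b \<bullet> u)"
    by (simp add: block_self_adjoint block_mult_u inner_commute)
  have "(transpose (shear k u) ** D ** shear k u) *v x = transpose (shear k u) *v z"
    by (simp only: z_def shear_mult_vec matrix_vector_mul_assoc[symmetric])
  also have "\<dots> = emb (insert k I) M *v x"
    unfolding transpose_shear_mult_vec uz emb_insert_mult_vec
    by (simp add: z pivot_eq algebra_simps vec_eq_iff)
  finally show "emb (insert k I) M *v x = (transpose (shear k u) ** D ** shear k u) *v x" by simp
qed

lemma det_emb_insert: "det (emb (insert k I) M) = schur I k M * det (emb I M)"
proof -
  have "D = (\<chi> i. if i = k then s *s P $ i else P $ i)"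
    by (auto simp: D_def vec_eq_iff)
  then have "det D = s * det (\<chi> i. if i = k then P $ i else P $ i)" by (simp only: det_row_mul)
  then have "det D = s * det P" by simp
  then show ?thesis
    by (simp add: emb_insert_factor det_mul det_shear[OF u_at_k] s_def P_def)
qed

lemma pivot_inner: "v $ k = 0 \<Longrightarrow> (v + t *\<^sub>R axis k 1) \<bullet> (D *v (v + t *\<^sub>R axis k 1)) = v \<bullet> (P *v v) + s * t\<^sup>2"
proof -
  assume v: "v $ k = 0"
  have Pk: "P *v axis k 1 = axis k 1"
    unfolding P_def matrix_vector_mult_basis using k by (simp add: emb_def vec_eq_iff column_def axis_def)
  have "v \<bullet> (P *v axis k 1) = 0" "axis k 1 \<bullet> (P *v v) = 0"
    using v by (simp_all add: Pk block_self_adjoint inner_axis inner_axis')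
  then show ?thesis
    using v by (simp add: pivot_mult_vec matrix_vector_right_distrib matrix_vector_mult_scaleR Pk
        inner_add_left inner_add_right inner_axis inner_axis' algebra_simps power2_eq_square)
qed

lemma emb_insert_inner:
  assumes v: "v $ k = 0"
  shows "(v + t *\<^sub>R axis k 1) \<bullet> (emb (insert k I) M *v (v + t *\<^sub>R axis k 1))
     = (v + t *\<^sub>R u) \<bullet> (P *v (v + t *\<^sub>R u)) + s * t\<^sup>2"
proof -
  have "shear k u *v (v + t *\<^sub>R axis k 1) = (v + t *\<^sub>R u) + t *\<^sub>R axis k 1"
    using v by (simp add: shear_mult_vec)
  then show ?thesis
    unfolding emb_insert_factor inner_congruence using pivot_inner[of "v + t *\<^sub>R u" t] v u_at_k by simp
qed

lemma spd_emb_insert_iff: "emb (insert k I) M \<in> spd \<longleftrightarrow> schur I k M > 0"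
proof
  assume S: "emb (insert k I) M \<in> spd"
  let ?x = "- u + 1 *\<^sub>R axis k 1"
  have "?x $ k = 1" by (simp add: u_at_k)
  then have "?x \<noteq> 0" by (metis zero_index zero_neq_one)
  then have "?x \<bullet> (emb (insert k I) M *v ?x) > 0" by (rule spd_pos[OF S])
  then show "schur I k M > 0" by (subst (asm) emb_insert_inner) (simp_all add: u_at_k s_def)
next
  assume s: "schur I k M > 0"
  show "emb (insert k I) M \<in> spd"
  proof (rule spd_I)
    show "transpose (emb (insert k I) M) = emb (insert k I) M" by (rule emb_symmetric[OF sym])
    fix x :: "real^'n" assume x: "x \<noteq> 0"
    define v where "v = x - x $ k *\<^sub>R axis k 1"
    have v: "v $ k = 0" by (simp add: v_def)
    have xv: "x = v + x $ k *\<^sub>R axis k 1" by (simp add: v_def)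
    have eq: "x \<bullet> (emb (insert k I) M *v x) = (v + x $ k *\<^sub>R u) \<bullet> (P *v (v + x $ k *\<^sub>R u)) + s * (x $ k)\<^sup>2"
      using emb_insert_inner[OF v, of "x $ k"] xv by simp
    show "0 < x \<bullet> (emb (insert k I) M *v x)"
    proof (cases "x $ k = 0")
      case True
      then have "x = v" using xv by simp
      then have "v \<bullet> (P *v v) > 0" unfolding P_def using spd_pos[OF P_spd] x by blast
      then show ?thesis by (simp add: eq True)
    next
      case False
      then have "s * (x $ k)\<^sup>2 > 0" using s by (simp add: s_def)
      then show ?thesis unfolding eq P_def by (intro add_nonneg_pos spd_nonneg[OF P_spd])
    qed
  qed
qed

end

text \<open>With \<open>P\<close> the block, \<open>P (P\<^sup>-\<^sup>1 - (P+1)\<^sup>-\<^sup>1) (P+1) = 1\<close>. Hence the gap between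
  the two inverses is the inverse of \<open>(P+1) P\<close>, which gives its positivity and its determinant. The
  outer padding in the definition makes the gap, which is zero outside the block, invertible.\<close>

definition inverse_gap :: "'n set \<Rightarrow> real^'n^'n \<Rightarrow> real^'n^'n" where
  "inverse_gap I M = emb I (matrix_inv (emb I M) - matrix_inv (emb I (mat 1 + M)))"

context
  fixes I :: "'n::finite set" and M P P1 E :: "real^'n^'n"
  assumes P_spd: "emb I M \<in> spd"
  defines "P \<equiv> emb I M" and "P1 \<equiv> emb I (mat 1 + M)" and "E \<equiv> coord_proj I"
begin

lemma shifted_eq_add_proj: "P1 = P + E"
  by (auto simp: P1_def P_def E_def emb_def coord_proj_def diag_mat_def vec_eq_iff mat_def)

lemma emb_mult_complement: "emb I X ** (mat 1 - E) = mat 1 - E" "(mat 1 - E) ** emb I X = mat 1 - E"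
proof -
  have C: "mat 1 - E = diag_mat (\<lambda>i. if i \<in> I then 0 else 1)"
    by (auto simp: E_def coord_proj_def diag_mat_def vec_eq_iff mat_def)
  show "emb I X ** (mat 1 - E) = mat 1 - E" "(mat 1 - E) ** emb I X = mat 1 - E"
    unfolding C by (auto simp: matrix_matrix_mult_def diag_mat_def vec_eq_iff emb_def
      if_distrib[of "\<lambda>u. u * _"] if_distrib[of "\<lambda>u. _ * u"] cong: if_cong)
qed

lemma proj_idem: "E ** E = E"
  by (auto simp: E_def coord_proj_def diag_mat_mult intro!: arg_cong[where f = diag_mat])

text \<open>The padded block is block diagonal, so projecting on one side already projects on both.\<close>

lemma proj_mult_emb: "E ** P = E ** P ** E"
proof -
  have "E ** P ** (mat 1 - E) = E ** (mat 1 - E)"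
    by (simp only: P_def emb_mult_complement matrix_mul_assoc[symmetric])
  then show ?thesis by (simp add: matrix_diff_ldistrib proj_idem)
qed

lemma spd_emb_shift: "P1 \<in> spd"
proof (rule spd_I)
  show "transpose P1 = P1"
    using spd_symmetric[OF P_spd] by (simp add: shifted_eq_add_proj P_def E_def transpose_add)
  fix x :: "real^'n" assume "x \<noteq> 0"
  then have "x \<bullet> (P *v x) > 0" using spd_pos[OF P_spd] by (simp add: P_def)
  moreover have "x \<bullet> (E *v x) \<ge> 0" unfolding inner_vec_def E_def by (intro sum_nonneg) auto
  ultimately show "x \<bullet> (P1 *v x) > 0"
    by (simp add: shifted_eq_add_proj matrix_vector_mult_add_rdistrib inner_add_right)
qed

lemma spd_shifted_mult_emb: "P1 ** P \<in> spd"
proof (rule spd_I)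
  have tP: "transpose P = P" using spd_symmetric[OF P_spd] by (simp add: P_def)
  have eq: "P1 ** P = P ** P + E ** P ** E"
    by (simp add: shifted_eq_add_proj matrix_add_rdistrib proj_mult_emb[symmetric])
  show "transpose (P1 ** P) = P1 ** P"
    unfolding eq by (simp add: transpose_add matrix_transpose_mul tP matrix_mul_assoc E_def)
  fix x :: "real^'n" assume "x \<noteq> 0"
  have "x \<bullet> ((P ** P) *v x) = (P *v x) \<bullet> (P *v x)"
    by (simp only: matrix_vector_mul_assoc[symmetric] symmetric_inner[OF tP])
  moreover have "P *v x \<noteq> 0" using \<open>x \<noteq> 0\<close> spd_pos[OF P_spd, of x] by (auto simp: P_def)
  moreover have "x \<bullet> ((E ** P ** E) *v x) = (E *v x) \<bullet> (P *v (E *v x))"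
    using inner_congruence[of x E P] by (simp add: E_def)
  moreover have "(E *v x) \<bullet> (P *v (E *v x)) \<ge> 0" unfolding P_def by (rule spd_nonneg[OF P_spd])
  ultimately show "x \<bullet> ((P1 ** P) *v x) > 0"
    unfolding eq by (simp add: matrix_vector_mult_add_rdistrib inner_add_right add_pos_nonneg)
qed

lemma inverse_gap_eq: "inverse_gap I M = (matrix_inv P - matrix_inv P1) + (mat 1 - E)"
proof -
  let ?Q = "matrix_inv P - matrix_inv P1"
  have inv_compl: "matrix_inv (emb I X) ** (mat 1 - E) = mat 1 - E"
      "(mat 1 - E) ** matrix_inv (emb I X) = mat 1 - E" if "invertible (emb I X)" for X
    using emb_mult_complement[of X] matrix_inv_left[OF that] matrix_inv_right[OF that]
    by (metis matrix_mul_assoc matrix_mul_lid, metis matrix_mul_assoc matrix_mul_rid)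
  have i: "invertible (emb I M)" "invertible (emb I (mat 1 + M))"
    using spd_invertible[OF P_spd] spd_invertible[OF spd_emb_shift] by (simp_all add: P1_def)
  have "?Q ** (mat 1 - E) = 0" "(mat 1 - E) ** ?Q = 0"
    unfolding P_def P1_def matrix_diff_ldistrib[of "mat 1 - E"] matrix_diff_rdistrib[of _ _ "mat 1 - E"]
    by (simp_all only: inv_compl i diff_self)
  moreover have C: "mat 1 - E = diag_mat (\<lambda>i. if i \<in> I then 0 else 1)"
    by (auto simp: E_def coord_proj_def diag_mat_def vec_eq_iff mat_def)
  ultimately have "?Q $ i $ j = 0" if "i \<notin> I \<or> j \<notin> I" for i j
  proof -
    assume "?Q ** (mat 1 - E) = 0" "(mat 1 - E) ** ?Q = 0"
    then have "(?Q ** (mat 1 - E)) $ i $ j = 0" "((mat 1 - E) ** ?Q) $ i $ j = 0" by simp_all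
    then show ?thesis using that unfolding C
      by (auto simp: matrix_matrix_mult_def diag_mat_def
        if_distrib[of "\<lambda>u. u * _"] if_distrib[of "\<lambda>u. _ * u"] cong: if_cong split: if_splits)
  qed
  then show ?thesis
    unfolding inverse_gap_def C by (auto simp: emb_def vec_eq_iff diag_mat_def P_def P1_def)
qed

lemma inverse_gap_factor: "P ** inverse_gap I M ** P1 = mat 1"
proof -
  have inv: "P ** matrix_inv P = mat 1" "matrix_inv P1 ** P1 = mat 1"
    using matrix_inv_right[OF spd_invertible[OF P_spd]] matrix_inv_left[OF spd_invertible[OF spd_emb_shift]]
    by (simp_all add: P_def)
  have "P ** (matrix_inv P - matrix_inv P1) ** P1 = P1 - P"
    by (simp add: matrix_diff_ldistrib matrix_diff_rdistrib inv matrix_mul_assoc[symmetric, of P])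
  moreover have "P ** (mat 1 - E) ** P1 = mat 1 - E"
    by (simp only: P_def P1_def emb_mult_complement)
  ultimately show ?thesis
    by (simp only: inverse_gap_eq matrix_add_ldistrib matrix_add_rdistrib) (simp add: shifted_eq_add_proj)
qed

lemma spd_inverse_gap: "inverse_gap I M \<in> spd"
proof -
  have "inverse_gap I M ** (P1 ** P) = mat 1"
    using inverse_gap_factor by (metis matrix_left_right_inverse matrix_mul_assoc)
  then have "matrix_inv (P1 ** P) = inverse_gap I M"
    by (metis matrix_inv_unique matrix_left_right_inverse)
  then show ?thesis using spd_matrix_inv[OF spd_shifted_mult_emb] by simp
qed

lemma det_inverse_gap: "det (inverse_gap I M) = 1 / (det (emb I M) * det (emb I (mat 1 + M)))"
proof -
  have "det P * det (inverse_gap I M) * det P1 = 1"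
    using arg_cong[OF inverse_gap_factor, of det] by (simp add: det_mul)
  moreover have "det P > 0" "det P1 > 0" using spd_det_pos[OF P_spd] spd_det_pos[OF spd_emb_shift]
    by (simp_all add: P_def)
  ultimately show ?thesis by (simp add: P_def P1_def field_simps)
qed

text \<open>Shifting by the identity changes the Schur complement by 1 and by the gap of the two inverse forms
  at the border: this is what separates the new diagonal entry from the rest of the new row.\<close>

lemma schur_shift:
  "schur I k (mat 1 + M) = 1 + schur I k M + border I k M \<bullet> (inverse_gap I M *v border I k M)" if "k \<notin> I"
proof -
  let ?b = "border I k M"
  have "border I k (mat 1 + M) = ?b" using that by (auto simp: border_def vec_eq_iff mat_def)
  moreover have "(mat 1 - E) *v ?b = 0"
    by (auto simp: matrix_vector_mult_diff_rdistrib vec_eq_iff E_def border_def)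
  ultimately show ?thesis
    by (simp add: schur_def inverse_gap_eq matrix_vector_mult_add_rdistrib matrix_vector_mult_diff_rdistrib
        inner_add_right inner_diff_right P_def P1_def mat_def)
qed

end

section \<open>One-dimensional beta integrals\<close>

lemma nn_integral_substitution_set:
  fixes f g g' :: "real \<Rightarrow> real"
  assumes S: "S \<in> sets borel"
    and deriv: "\<And>x. x \<in> S \<Longrightarrow> (g has_field_derivative g' x) (at x)"
    and inj: "inj_on g S" and f: "\<And>x. x \<in> g ` S \<Longrightarrow> f x \<ge> 0"
    and I: "(f has_integral c) (g ` S)"
  shows "(\<integral>\<^sup>+x. ennreal (\<bar>g' x\<bar> * f (g x)) * indicator S x \<partial>lborel) = ennreal c"
proof -
  have abs: "f absolutely_integrable_on g ` S"
    by (rule nonnegative_absolutely_integrable_1) (use I f in auto)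
  have "(\<lambda>x. \<bar>g' x\<bar> * f (g x)) absolutely_integrable_on S \<and> integral S (\<lambda>x. \<bar>g' x\<bar> * f (g x)) = c"
    by (subst has_absolute_integral_change_of_variables_1')
       (use S deriv inj abs I in \<open>auto intro: has_field_derivative_at_within\<close>)
  then have "((\<lambda>x. \<bar>g' x\<bar> * f (g x)) has_integral c) S"
    by (auto simp: absolutely_integrable_on_def has_integral_iff)
  then show ?thesis by (intro nn_integral_has_integral_lebesgue') (auto intro!: mult_nonneg_nonneg f)
qed

text \<open>Euler's beta integral on the half line, by \<open>t = s / (1 + s)\<close>.\<close>

lemma nn_integral_Beta_halfline:
  assumes a: "a > 0" and b: "b > (0::real)"
  shows "(\<integral>\<^sup>+s. ennreal (s powr (a - 1) * (1 + s) powr (- (a + b))) * indicator {0<..} s \<partial>lborel) = ennreal (Beta a b)"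
proof -
  let ?g = "\<lambda>s::real. s / (1 + s)"
  let ?f = "\<lambda>t::real. t powr (a - 1) * (1 - t) powr (b - 1)"
  have img: "?g ` {0<..} = {0<..<1}"
  proof safe
    fix t :: real assume "t \<in> {0<..<1}"
    then show "t \<in> ?g ` {0<..}"
      by (intro image_eqI[of _ _ "t / (1 - t)"]) (auto simp: field_simps)
  qed (auto simp: field_simps)
  have "(\<integral>\<^sup>+s. ennreal (\<bar>1 / (1 + s)\<^sup>2\<bar> * ?f (?g s)) * indicator {0<..} s \<partial>lborel) = ennreal (Beta a b)"
  proof (rule nn_integral_substitution_set[where g = ?g and f = ?f and g' = "\<lambda>s. 1 / (1 + s)\<^sup>2"])
    show "(?g has_real_derivative 1 / (1 + x)\<^sup>2) (at x)" if "x \<in> {0<..}" for x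
      using that by (auto intro!: derivative_eq_intros simp: power2_eq_square field_simps)
    show "inj_on ?g {0<..}" by (auto simp: inj_on_def field_simps)
    show "(?f has_integral Beta a b) (?g ` {0<..})"
      unfolding img using has_integral_Beta_real[OF a b] by (simp add: has_integral_Icc_iff_Ioo)
  qed auto
  moreover have "\<bar>1 / (1 + s)\<^sup>2\<bar> * ?f (?g s) = s powr (a - 1) * (1 + s) powr (- (a + b))" if "s > 0" for s
  proof -
    have "(1 + s) powr (1 - r) = 1 / (1 + s) powr (r - 1)" for r
      using powr_minus_divide[of "1 + s" "r - 1"] by simp
    moreover have "1 - ?g s = 1 / (1 + s)" using that by (simp add: field_simps)
    ultimately have "\<bar>1 / (1 + s)\<^sup>2\<bar> * ?f (?g s)
        = (1 + s) powr (- 2) * (s powr (a - 1) * (1 + s) powr (- (a - 1)) * (1 + s) powr (- (b - 1)))"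
      using that by (simp add: powr_divide powr_minus_divide)
    also have "\<dots> = s powr (a - 1) * (1 + s) powr (- 2 + (- (a - 1)) + (- (b - 1)))"
      by (simp only: powr_add mult_ac)
    also have "- 2 + (- (a - 1)) + (- (b - 1)) = - (a + b)" by simp
    finally show ?thesis .
  qed
  ultimately show ?thesis
    by (subst nn_integral_cong[where v = "\<lambda>s. ennreal (\<bar>1 / (1 + s)\<^sup>2\<bar> * ?f (?g s)) * indicator {0<..} s"])
       (auto simp: indicator_def)
qed

lemma nn_integral_even:
  assumes [measurable]: "f \<in> borel_measurable borel" and even: "\<And>x. f (- x) = (f x :: ennreal)"
  shows "(\<integral>\<^sup>+x. f (x::real) \<partial>lborel) = 2 * (\<integral>\<^sup>+x. f x * indicator {0<..} x \<partial>lborel)"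
proof -
  have "(\<integral>\<^sup>+x. f x * indicator {..<0} x \<partial>lborel) = (\<integral>\<^sup>+x. f x * indicator {0<..} x \<partial>lborel)"
    by (subst nn_integral_real_affine[where c = "- 1" and t = 0])
       (auto intro!: nn_integral_cong simp: even indicator_def)
  moreover have "(\<integral>\<^sup>+x. f x \<partial>lborel) = (\<integral>\<^sup>+x. f x * indicator {0<..} x + f x * indicator {..<0} x \<partial>lborel)"
  proof (rule nn_integral_cong_AE)
    show "AE x in lborel. f x = f x * indicator {0<..} x + f x * indicator {..<0} x"
      using AE_lborel_singleton[of "0::real"] by eventually_elim (auto simp: indicator_def)
  qed
  ultimately show ?thesis by (simp add: nn_integral_add mult_2)
qed

text \<open>The substitution \<open>t = x\<^sup>2 / (1 + x\<^sup>2)\<close> turns this into a beta integral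
  with first parameter one half.\<close>

lemma nn_integral_inverse_quadratic_powr_1:
  assumes a: "a > 1 / 2"
  shows "(\<integral>\<^sup>+x. ennreal ((1 + x\<^sup>2) powr (- a)) \<partial>lborel) = ennreal (sqrt pi * Gamma (a - 1 / 2) / Gamma a)"
proof -
  let ?g = "\<lambda>x::real. x\<^sup>2 / (1 + x\<^sup>2)"
  let ?f = "\<lambda>t::real. t powr (1 / 2 - 1) * (1 - t) powr (a - 1 / 2 - 1)"
  have p: "1 + x\<^sup>2 > 0" for x :: real by (simp add: add_pos_nonneg)
  have img: "?g ` {0<..} = {0<..<1}"
  proof safe
    fix t :: real assume "t \<in> {0<..<1}"
    then show "t \<in> ?g ` {0<..}"
      by (intro image_eqI[of _ _ "sqrt (t / (1 - t))"]) (auto simp: field_simps)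
  qed (use p in \<open>auto simp: field_simps\<close>)
  have "(\<integral>\<^sup>+x. ennreal (\<bar>2 * x / (1 + x\<^sup>2)\<^sup>2\<bar> * ?f (?g x)) * indicator {0<..} x \<partial>lborel)
      = ennreal (Beta (1 / 2) (a - 1 / 2))"
  proof (rule nn_integral_substitution_set[where g = ?g and f = ?f and g' = "\<lambda>x. 2 * x / (1 + x\<^sup>2)\<^sup>2"])
    show "(?g has_real_derivative 2 * x / (1 + x\<^sup>2)\<^sup>2) (at x)" for x
      using p[of x] by (auto intro!: derivative_eq_intros simp: power2_eq_square field_simps)
    show "inj_on ?g {0<..}"
    proof (rule inj_onI)
      fix x y :: real assume xy: "x \<in> {0<..}" "y \<in> {0<..}" "?g x = ?g y"
      then have "x\<^sup>2 = y\<^sup>2" using p[of x] p[of y] by (simp add: field_simps)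
      then show "x = y" using xy by simp
    qed
    show "(?f has_integral Beta (1 / 2) (a - 1 / 2)) (?g ` {0<..})"
      unfolding img using has_integral_Beta_real[of "1 / 2" "a - 1 / 2"] a
      by (simp add: has_integral_Icc_iff_Ioo)
  qed auto
  moreover have "\<bar>2 * x / (1 + x\<^sup>2)\<^sup>2\<bar> * ?f (?g x) = 2 * (1 + x\<^sup>2) powr (- a)" if x: "x > 0" for x
  proof -
    have "(1 + x\<^sup>2) powr (3 / 2 - a) = 1 / (1 + x\<^sup>2) powr (a - 3 / 2)"
      using powr_minus_divide[of "1 + x\<^sup>2" "a - 3 / 2"] by simp
    moreover have "1 - ?g x = 1 / (1 + x\<^sup>2)" using p[of x] by (simp add: field_simps)
    ultimately have "\<bar>2 * x / (1 + x\<^sup>2)\<^sup>2\<bar> * ?f (?g x)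
        = 2 * x * (1 + x\<^sup>2) powr (- 2) * ((x\<^sup>2) powr (- 1 / 2) * (1 + x\<^sup>2) powr (1 / 2) * (1 + x\<^sup>2) powr (- (a - 1 / 2 - 1)))"
      using x p[of x] by (simp add: powr_divide powr_minus_divide)
    also have "(x\<^sup>2) powr (- 1 / 2) = 1 / x"
      using x by (simp add: powr_minus_divide powr_half_sqrt)
    also have "2 * x * (1 + x\<^sup>2) powr (- 2) * (1 / x * (1 + x\<^sup>2) powr (1 / 2) * (1 + x\<^sup>2) powr (- (a - 1 / 2 - 1)))
       = 2 * ((1 + x\<^sup>2) powr (- 2) * (1 + x\<^sup>2) powr (1 / 2) * (1 + x\<^sup>2) powr (- (a - 1 / 2 - 1)))"
      using x by simp
    also have "\<dots> = 2 * (1 + x\<^sup>2) powr (- a)" by (simp add: powr_add[symmetric])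
    finally show ?thesis .
  qed
  ultimately have half: "(\<integral>\<^sup>+x. ennreal (2 * (1 + x\<^sup>2) powr (- a)) * indicator {0<..} x \<partial>lborel)
      = ennreal (Beta (1 / 2) (a - 1 / 2))"
    by (subst nn_integral_cong[where v = "\<lambda>x. ennreal (\<bar>2 * x / (1 + x\<^sup>2)\<^sup>2\<bar> * ?f (?g x)) * indicator {0<..} x"])
       (auto simp: indicator_def)
  have "(\<integral>\<^sup>+x. ennreal ((1 + x\<^sup>2) powr (- a)) \<partial>lborel)
      = 2 * (\<integral>\<^sup>+x. ennreal ((1 + x\<^sup>2) powr (- a)) * indicator {0<..} x \<partial>lborel)"
    by (rule nn_integral_even) auto
  also have "\<dots> = (\<integral>\<^sup>+x. ennreal (2 * (1 + x\<^sup>2) powr (- a)) * indicator {0<..} x \<partial>lborel)"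
    by (subst nn_integral_cmult[symmetric]) (auto simp: ennreal_mult' mult.assoc)
  also have "\<dots> = ennreal (sqrt pi * Gamma (a - 1 / 2) / Gamma a)"
    unfolding half by (simp add: Beta_def Gamma_one_half_real)
  finally show ?thesis .
qed

lemma nn_integral_inverse_quadratic_powr:
  assumes a: "a > 1 / 2" and c: "c > 0" and s: "s > 0"
  shows "(\<integral>\<^sup>+x. ennreal ((c + s * x\<^sup>2) powr (- a)) \<partial>lborel)
     = ennreal (s powr (- 1 / 2) * c powr (1 / 2 - a) * (sqrt pi * Gamma (a - 1 / 2) / Gamma a))"
proof -
  let ?r = "sqrt (c / s)"
  let ?C = "sqrt pi * Gamma (a - 1 / 2) / Gamma a"
  have r: "?r > 0" using c s by simp
  have eq: "(c + s * (0 + ?r * x)\<^sup>2) powr (- a) = c powr (- a) * (1 + x\<^sup>2) powr (- a)" for x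
  proof -
    have "c + s * (0 + ?r * x)\<^sup>2 = c * (1 + x\<^sup>2)"
      using c s by (simp add: power_mult_distrib algebra_simps)
    moreover have "1 + x\<^sup>2 \<ge> 0" by simp
    ultimately show ?thesis using c by (simp only: powr_mult)
  qed
  have "(\<integral>\<^sup>+x. ennreal ((c + s * x\<^sup>2) powr (- a)) \<partial>lborel)
     = \<bar>?r\<bar> * (\<integral>\<^sup>+x. ennreal ((c + s * (0 + ?r * x)\<^sup>2) powr (- a)) \<partial>lborel)"
    by (rule nn_integral_real_affine) (use r in auto)
  also have "\<dots> = ennreal ?r * (ennreal (c powr (- a)) * ennreal ?C)"
    unfolding eq using r
    by (simp add: ennreal_mult nn_integral_cmult nn_integral_inverse_quadratic_powr_1[OF a])
  also have "\<dots> = ennreal (?r * c powr (- a) * ?C)"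
    using r a by (simp add: ennreal_mult[symmetric] Gamma_real_pos less_imp_le mult.assoc)
  also have "?r * c powr (- a) = s powr (- 1 / 2) * c powr (1 / 2 - a)"
  proof -
    have "?r = c powr (1 / 2) * s powr (- 1 / 2)"
      using c s by (simp add: powr_half_sqrt powr_minus_divide real_sqrt_divide)
    then show ?thesis by (simp add: powr_diff powr_minus_divide)
  qed
  finally show ?thesis .
qed

section \<open>Integration over blocks of coordinates\<close>

abbreviation lborel_on :: "'i set \<Rightarrow> ('i \<Rightarrow> real) measure" where
  "lborel_on U \<equiv> PiM U (\<lambda>_. lborel)"

interpretation lborel_PiM: product_sigma_finite "\<lambda>_. lborel :: real measure"
  by standard

lemma borel_measurable_vecI:
  fixes f :: "'x \<Rightarrow> 'a::euclidean_space ^ 'n"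
  assumes "\<And>i. (\<lambda>x. f x $ i) \<in> borel_measurable M"
  shows "f \<in> borel_measurable M"
  using assms by (subst borel_measurable_euclidean_space) (auto simp: Basis_vec_def inner_axis)

lemma borel_measurable_vec_nth [measurable]:
  "(\<lambda>x::'a::euclidean_space ^ 'n. x $ i) \<in> borel_measurable borel"
  by (intro borel_measurable_continuous_onI continuous_intros)

lemma borel_measurable_det [measurable]: "(det :: real^'n^'n \<Rightarrow> real) \<in> borel_measurable borel"
  unfolding det_def[abs_def] by measurable

lemma borel_measurable_matrix_vector [measurable]:
  fixes A :: "real^'n^'m"
  shows "(*v) A \<in> borel_measurable borel"
  by (intro borel_measurable_continuous_onI linear_continuous_on matrix_vector_mul_bounded_linear)

text \<open>Coordinatewise affine maps cover translations, the reflection, and congruence by diagonal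
  matrices.\<close>

lemma nn_integral_PiM_affine:
  fixes c t :: "'i \<Rightarrow> real"
  assumes "finite U" "\<And>p. p \<in> U \<Longrightarrow> c p \<noteq> 0"
    and "f \<in> borel_measurable (lborel_on U)"
  shows "(\<integral>\<^sup>+x. f x \<partial>lborel_on U) =
     ennreal (\<Prod>p\<in>U. \<bar>c p\<bar>) * (\<integral>\<^sup>+x. f (\<lambda>p\<in>U. t p + c p * x p) \<partial>lborel_on U)"
  using assms
proof (induction U arbitrary: f rule: finite_induct)
  case empty
  show ?case by (simp add: PiM_empty nn_integral_count_space_finite restrict_def)
next
  case (insert q U)
  let ?\<mu> = "lborel_on U" and ?\<mu>' = "lborel_on (insert q U)"
  let ?A = "\<lambda>x. \<lambda>p\<in>U. t p + c p * x p" and ?A' = "\<lambda>x. \<lambda>p\<in>insert q U. t p + c p * x p"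
  let ?G = "\<lambda>x. \<integral>\<^sup>+y. f (x(q := t q + c q * y)) \<partial>lborel"
  note [measurable] = insert.prems(2)
  have upd: "?A' (x(q := y)) = (?A x)(q := t q + c q * y)"
    for x y using insert.hyps by (auto simp: fun_eq_iff)
  have [measurable]: "(\<lambda>x. f (?A' x)) \<in> borel_measurable ?\<mu>'"
    by measurable
  have [measurable]: "(\<lambda>(x, y). f (x(q := y))) \<in> borel_measurable (?\<mu> \<Otimes>\<^sub>M lborel)"
    by measurable
  have "(\<lambda>(x, y). f (x(q := t q + c q * y))) \<in> borel_measurable (?\<mu> \<Otimes>\<^sub>M lborel)"
    using measurable_compose[of "\<lambda>(x, y). (x, t q + c q * y)" "?\<mu> \<Otimes>\<^sub>M lborel"
        "?\<mu> \<Otimes>\<^sub>M lborel" "\<lambda>(x, y). f (x(q := y))"]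
    by (simp add: case_prod_unfold)
  then have m2: "(\<lambda>x. ennreal \<bar>c q\<bar> * ?G x) \<in> borel_measurable ?\<mu>"
    by measurable
  have "(\<integral>\<^sup>+x. f x \<partial>?\<mu>') = (\<integral>\<^sup>+x. \<integral>\<^sup>+y. f (x(q := y)) \<partial>lborel \<partial>?\<mu>)"
    using insert by (intro lborel_PiM.product_nn_integral_insert) auto
  also have "\<dots> = (\<integral>\<^sup>+x. ennreal \<bar>c q\<bar> * ?G x \<partial>?\<mu>)"
  proof (rule nn_integral_cong)
    fix x assume "x \<in> space ?\<mu>"
    then have "(\<lambda>y. f (x(q := y))) \<in> borel_measurable lborel" by measurable
    then show "(\<integral>\<^sup>+y. f (x(q := y)) \<partial>lborel) = ennreal \<bar>c q\<bar> * ?G x"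
      using insert.prems by (intro nn_integral_real_affine) auto
  qed
  also have "\<dots> = ennreal (\<Prod>p\<in>U. \<bar>c p\<bar>) * (\<integral>\<^sup>+x. ennreal \<bar>c q\<bar> *
      ?G (?A x) \<partial>?\<mu>)"
    using insert.prems(1) by (intro insert.IH m2) auto
  also have "\<dots> = ennreal (\<Prod>p\<in>U. \<bar>c p\<bar>) * (ennreal \<bar>c q\<bar> * (\<integral>\<^sup>+x.
      ?G (?A x) \<partial>?\<mu>))"
    by (subst nn_integral_cmult) (simp_all, measurable)
  also have "\<dots> = ennreal (\<Prod>p\<in>insert q U. \<bar>c p\<bar>) * (\<integral>\<^sup>+x.
      ?G (?A x) \<partial>?\<mu>)"
    using insert.hyps by (simp add: ennreal_mult' mult.assoc[symmetric] prod_nonneg mult.commute)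
  also have "(\<integral>\<^sup>+x. ?G (?A x) \<partial>?\<mu>)
      = (\<integral>\<^sup>+x. f (?A' x) \<partial>?\<mu>')"
    using insert.hyps by (subst lborel_PiM.product_nn_integral_insert) (simp_all only: upd, measurable)
  finally show ?case .
qed

text \<open>The coordinates named by \<open>\<phi>\<close>, arranged as a vector supported on \<open>I\<close>; the map \<open>\<phi>\<close> will
  send \<open>i\<close> to the position where the \<open>i\<close>-th entry of a new row is stored.\<close>

definition block_vec :: "'n set \<Rightarrow> ('n \<Rightarrow> 'p) \<Rightarrow> ('p \<Rightarrow> real) \<Rightarrow> real^'n" where
  "block_vec I \<phi> y = (\<chi> i. if i \<in> I then y (\<phi> i) else 0)"

lemma block_vec_measurable [measurable]:
  assumes "\<phi> ` I \<subseteq> U"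
  shows "block_vec I \<phi> \<in> borel_measurable (lborel_on U)"
proof (rule borel_measurable_vecI)
  fix i show "(\<lambda>x. block_vec I \<phi> x $ i) \<in> borel_measurable (lborel_on U)"
    using assms by (cases "i \<in> I") (auto simp: block_vec_def intro!: measurable_component_singleton)
qed

abbreviation block_form :: "'n set \<Rightarrow> ('n \<Rightarrow> 'p) \<Rightarrow> real^'n^'n \<Rightarrow> ('p \<Rightarrow> real) \<Rightarrow> real" where
  "block_form I \<phi> Q y \<equiv> block_vec I \<phi> y \<bullet> (Q *v block_vec I \<phi> y)"

lemma quadratic_powr_measurable:
  fixes Q :: "real^'n^'n"
  assumes "\<phi> ` I \<subseteq> U"
  shows "(\<lambda>y. block_form I \<phi> Q y) \<in> borel_measurable (lborel_on U)"
    and "(\<lambda>y. ennreal ((c + block_form I \<phi> Q y) powr r)) \<in> borel_measurable (lborel_on U)"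
  using assms by measurable

text \<open>Integrating a power of a quadratic form over a block of coordinates: peel off one coordinate,
  complete the square by the Schur complement, and use translation invariance.\<close>

lemma nn_integral_quadratic_form_powr:
  fixes Q :: "real^'n^'n" and \<phi> :: "'n \<Rightarrow> 'p"
  assumes "inj_on \<phi> I" "emb I Q \<in> spd" and sym: "transpose Q = Q" and "c > 0" "r > card I / 2"
  shows "(\<integral>\<^sup>+y. ennreal ((c + block_form I \<phi> (emb I Q) y) powr (- r)) \<partial>lborel_on (\<phi> ` I))
     = ennreal (det (emb I Q) powr (- 1 / 2) * c powr (card I / 2 - r) *
         (pi powr (card I / 2) * Gamma (r - card I / 2) / Gamma r))"
proof -
  have "finite I" by simp
  then show ?thesis using assms(1,2,4,5)
  proof (induction I arbitrary: c rule: finite_induct)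
    case empty
    then have "Gamma r > 0" by (simp add: Gamma_real_pos)
    then show ?case
      by (simp add: PiM_empty nn_integral_count_space_finite block_vec_def zero_vec_def[symmetric])
  next
    case (insert k I)
    let ?J = "insert k I" and ?m = "real (card I)"
    let ?K = "ennreal (det (emb I Q) powr (- 1 / 2) * (pi powr (?m / 2) * Gamma (r - ?m / 2) / Gamma r))"
    have P: "emb I Q \<in> spd" using spd_emb_mono[OF insert.prems(2)] by blast
    define s where "s = schur I k Q"
    have s: "s > 0" unfolding s_def
      using spd_emb_insert_iff[OF insert.hyps(2) sym P] insert.prems(2) by blast
    define u where "u = matrix_inv (emb I Q) *v border I k Q"
    have u0: "u $ i = 0" if "i \<notin> I" for i
    proof -
      have "u $ i = (emb I Q *v u) $ i" using emb_mult_vec_outside[OF that] by simp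
      also have "\<dots> = border I k Q $ i"
        using matrix_inv_right[OF spd_invertible[OF P]] by (simp add: u_def matrix_vector_mul_assoc)
      finally show ?thesis using that by (simp add: border_def)
    qed
    have inj: "inj_on \<phi> I" and kI: "\<phi> k \<notin> \<phi> ` I" using insert by auto
    have fin: "finite (\<phi> ` I)" by simp
    let ?v = "block_vec I \<phi>"
    let ?F = "\<lambda>t y. (c + s * t\<^sup>2 + ?v y \<bullet> (emb I Q *v ?v y)) powr (- r)"
    have step: "c + block_form ?J \<phi> (emb ?J Q) (y(\<phi> k := t))
        = c + s * t\<^sup>2 + (?v (\<lambda>p\<in>\<phi> ` I. t * u $ (inv_into I \<phi> p) + 1 * y p) \<bullet>
            (emb I Q *v ?v (\<lambda>p\<in>\<phi> ` I. t * u $ (inv_into I \<phi> p) + 1 * y p)))" for y t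
    proof -
      have 1: "block_vec ?J \<phi> (y(\<phi> k := t)) = ?v y + t *\<^sub>R axis k 1"
        using insert.hyps(2) kI by (auto simp: block_vec_def vec_eq_iff axis_def image_iff)
      have 2: "?v (\<lambda>p\<in>\<phi> ` I. t * u $ (inv_into I \<phi> p) + 1 * y p) = ?v y + t *\<^sub>R u"
        using inj u0 by (auto simp: block_vec_def vec_eq_iff)
      have "?v y $ k = 0" using insert.hyps(2) by (simp add: block_vec_def)
      from emb_insert_inner[OF insert.hyps(2) sym P this, of t] show ?thesis
        unfolding 1 2 by (simp add: s_def u_def)
    qed
    have "(\<integral>\<^sup>+y. ennreal ((c + block_form ?J \<phi> (emb ?J Q) y) powr (- r)) \<partial>lborel_on (\<phi> ` ?J))
      = (\<integral>\<^sup>+t. \<integral>\<^sup>+y. ennreal ((c + block_form ?J \<phi> (emb ?J Q) (y(\<phi> k := t))) powr (- r))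
            \<partial>lborel_on (\<phi> ` I) \<partial>lborel)"
      unfolding image_insert using kI
      by (intro lborel_PiM.product_nn_integral_insert_rev) (auto intro!: quadratic_powr_measurable)
    also have "\<dots> = (\<integral>\<^sup>+t. \<integral>\<^sup>+y. ennreal (?F t y) \<partial>lborel_on (\<phi> ` I) \<partial>lborel)"
    proof (rule nn_integral_cong)
      fix t :: real
      have "(\<integral>\<^sup>+y. ennreal (?F t y) \<partial>lborel_on (\<phi> ` I))
        = ennreal (\<Prod>p\<in>\<phi> ` I. \<bar>1\<bar>) * (\<integral>\<^sup>+y. ennreal (?F t (\<lambda>p\<in>\<phi> ` I. t * u $ (inv_into I \<phi> p) + 1 * y p)) \<partial>lborel_on (\<phi> ` I))"
        by (rule nn_integral_PiM_affine) (auto intro!: quadratic_powr_measurable)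
      then show "(\<integral>\<^sup>+y. ennreal ((c + block_form ?J \<phi> (emb ?J Q) (y(\<phi> k := t))) powr (- r))
            \<partial>lborel_on (\<phi> ` I)) = (\<integral>\<^sup>+y. ennreal (?F t y) \<partial>lborel_on (\<phi> ` I))"
        unfolding step by simp
    qed
    also have "\<dots> = (\<integral>\<^sup>+t. ?K *
         ennreal ((c + s * t\<^sup>2) powr (- (r - ?m / 2))) \<partial>lborel)"
    proof (rule nn_integral_cong)
      fix t :: real
      have pos: "c + s * t\<^sup>2 > 0" using insert.prems(3) s by (simp add: add_pos_nonneg)
      have r: "r > ?m / 2" using insert.prems(4) insert.hyps by simp
      show "(\<integral>\<^sup>+y. ennreal (?F t y) \<partial>lborel_on (\<phi> ` I)) =
          ?K *
           ennreal ((c + s * t\<^sup>2) powr (- (r - ?m / 2)))"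
        unfolding insert.IH[OF inj P pos r]
        by (subst ennreal_mult''[symmetric]) (auto intro!: arg_cong[where f = ennreal])
    qed
    also have "\<dots> = ?K *
        ennreal (s powr (- 1 / 2) * c powr (1 / 2 - (r - ?m / 2)) * (sqrt pi * Gamma (r - ?m / 2 - 1 / 2) / Gamma (r - ?m / 2)))"
    proof -
      have "r - ?m / 2 > 1 / 2" using insert.prems(4) insert.hyps by simp
      from nn_integral_inverse_quadratic_powr[OF this insert.prems(3) s] show ?thesis
        by (subst nn_integral_cmult) simp_all
    qed
    also have "\<dots> = ennreal (det (emb ?J Q) powr (- 1 / 2) * c powr (card ?J / 2 - r) *
         (pi powr (card ?J / 2) * Gamma (r - card ?J / 2) / Gamma r))"
    proof -
      have det: "det (emb ?J Q) powr (- 1 / 2) = s powr (- 1 / 2) * det (emb I Q) powr (- 1 / 2)"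
        using det_emb_insert[OF insert.hyps(2) sym P] s spd_det_pos[OF P] by (simp add: s_def powr_mult)
      have cJ: "real (card ?J) / 2 = ?m / 2 + 1 / 2" using insert.hyps by (simp add: field_simps)
      have G: "Gamma (r - ?m / 2) > 0" "Gamma r > 0" "Gamma (r - ?m / 2 - 1 / 2) > 0"
        using insert.prems(4) insert.hyps by (auto intro!: Gamma_real_pos)
      have pp: "pi powr (?m / 2 + 1 / 2) = pi powr (?m / 2) * sqrt pi"
        by (simp add: powr_add powr_half_sqrt)
      have e: "1 / 2 - (r - ?m / 2) = ?m / 2 + 1 / 2 - r" "r - ?m / 2 - 1 / 2 = r - (?m / 2 + 1 / 2)"
        by simp_all
      have cancel: "D * (pm * g1 / gr) * (s' * c' * (sp * g2 / g1)) = s' * D * c' * (pm * sp * g2 / gr)"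
        if "g1 > 0" "gr > 0" for D pm g1 gr s' c' sp g2 :: real
        using that by (simp add: field_simps)
      have nn: "0 \<le> s powr (- 1 / 2) * c powr (1 / 2 - (r - ?m / 2)) *
          (sqrt pi * Gamma (r - ?m / 2 - 1 / 2) / Gamma (r - ?m / 2))"
        using G by (simp only: powr_ge_zero mult_nonneg_nonneg divide_nonneg_pos real_sqrt_ge_zero pi_ge_zero less_imp_le)
      show ?thesis
        unfolding ennreal_mult''[OF nn, symmetric] cancel[OF G(1) G(2)]
        unfolding det cJ pp e ..
    qed
    finally show ?case .
  qed
qed

section \<open>The beta integral by Schur recursion\<close>

definition pairs :: "'n::linorder set \<Rightarrow> ('n \<times> 'n) set" where
  "pairs I = {(i, j). i \<le> j \<and> i \<in> I \<and> j \<in> I}"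

abbreviation block_lborel :: "'n::linorder set \<Rightarrow> ('n \<times> 'n \<Rightarrow> real) measure" where
  "block_lborel I \<equiv> lborel_on (pairs I)"

text \<open>The position at which the entry \<open>(i, k)\<close> of a symmetric matrix is stored.\<close>

definition pair_of :: "'n::linorder \<Rightarrow> 'n \<Rightarrow> 'n \<times> 'n" where
  "pair_of k i = (min i k, max i k)"

lemma finite_pairs [simp]: "finite (pairs (I :: 'n::{finite,linorder} set))"
  by simp

lemma pairs_insert: "pairs (insert k I) = pairs I \<union> insert (k, k) (pair_of k ` I)"
proof -
  have "(k, j) = pair_of k j" if "k \<le> j" for j using that by (auto simp: pair_of_def)
  moreover have "(i, k) = pair_of k i" if "i \<le> k" for i using that by (auto simp: pair_of_def)
  moreover have "pair_of k i \<in> pairs (insert k I)" if "i \<in> I" for i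
    using that by (auto simp: pairs_def pair_of_def min_def max_def)
  ultimately show ?thesis by (fastforce simp: pairs_def)
qed

lemma pairs_disjoint: "k \<notin> I \<Longrightarrow> pairs I \<inter> insert (k, k) (pair_of k ` I) = {}"
  by (auto simp: pairs_def pair_of_def min_def max_def split: if_splits)

lemma diagonal_notin_pair_of: "k \<notin> I \<Longrightarrow> (k, k) \<notin> pair_of k ` I"
  by (auto simp: pair_of_def min_def max_def split: if_splits)

lemma inj_pair_of: "inj_on (pair_of k) I"
  by (auto simp: inj_on_def pair_of_def min_def max_def split: if_splits)

definition block :: "'n::{finite,linorder} set \<Rightarrow> ('n \<times> 'n \<Rightarrow> real) \<Rightarrow> 'n::{finite,linorder} sqmat" where
  "block I x = emb I (sym_of_upper x)"

definition shifted_block :: "'n::{finite,linorder} set \<Rightarrow> ('n \<times> 'n \<Rightarrow> real) \<Rightarrow> 'n::{finite,linorder} sqmat" where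
  "shifted_block I x = emb I (mat 1 + sym_of_upper x)"

lemma sym_of_upper_symmetric [simp]: "transpose (sym_of_upper x) = sym_of_upper x"
  by (simp add: transpose_def sym_of_upper_def vec_eq_iff min.commute max.commute)

lemma min_max_in_pairs: "i \<in> I \<Longrightarrow> j \<in> I \<Longrightarrow> (min i j, max i j) \<in> pairs I"
  by (auto simp: pairs_def min_def max_def)

lemma block_cong: "(\<And>p. p \<in> pairs I \<Longrightarrow> x p = y p) \<Longrightarrow> block I x = block I y"
  by (auto simp: block_def emb_def sym_of_upper_def vec_eq_iff min_max_in_pairs)

lemma shifted_block_cong: "(\<And>p. p \<in> pairs I \<Longrightarrow> x p = y p) \<Longrightarrow> shifted_block I x = shifted_block I y"
  by (auto simp: shifted_block_def emb_def sym_of_upper_def vec_eq_iff min_max_in_pairs)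

lemma block_measurable [measurable]:
  assumes "pairs I \<subseteq> U"
  shows "block I \<in> borel_measurable (lborel_on U)"
    and "shifted_block I \<in> borel_measurable (lborel_on U)"
proof -
  have 1: "(\<lambda>x. x (min i j, max i j)) \<in> borel_measurable (lborel_on U)"
    if "i \<in> I \<and> j \<in> I" for i j
    using measurable_component_singleton[of "(min i j, max i j)" U "\<lambda>_. lborel"] min_max_in_pairs[of i I j] that assms
    by auto
  show "block I \<in> borel_measurable (lborel_on U)"
  proof (intro borel_measurable_vecI)
    fix i j show "(\<lambda>x. block I x $ i $ j) \<in> borel_measurable (lborel_on U)"
      using 1[of i j] by (cases "i \<in> I \<and> j \<in> I") (auto simp: block_def emb_def sym_of_upper_def)
  qed
  show "shifted_block I \<in> borel_measurable (lborel_on U)"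
  proof (intro borel_measurable_vecI)
    fix i j show "(\<lambda>x. shifted_block I x $ i $ j) \<in> borel_measurable (lborel_on U)"
      using 1[of i j] by (cases "i \<in> I \<and> j \<in> I") (auto simp: shifted_block_def emb_def sym_of_upper_def mat_def)
  qed
qed

text \<open>Positive definite means positive semidefinite, which is a closed condition, with nonzero determinant,
  which is an open one.\<close>

lemma spd_borel [measurable]: "(spd :: (real^'n^'n) set) \<in> sets borel"
proof -
  define C where "C = {A :: real^'n^'n. transpose A = A} \<inter> (\<Inter>x. {A. x \<bullet> (A *v x) \<ge> 0})"
  have "closed {A :: real^'n^'n. transpose A = A}"
    unfolding transpose_def vec_eq_iff
    by (simp, intro closed_Collect_all closed_Collect_eq continuous_intros)
  moreover have "closed {A :: real^'n^'n. x \<bullet> (A *v x) \<ge> 0}" for x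
    unfolding inner_vec_def matrix_vector_mult_def
    by (simp, intro closed_Collect_le continuous_intros)
  ultimately have C: "closed C" unfolding C_def by (intro closed_Int closed_INT ballI)
  have "spd = C \<inter> {A. det A \<noteq> 0}"
  proof (intro set_eqI iffI)
    fix A :: "real^'n^'n" assume A: "A \<in> spd"
    show "A \<in> C \<inter> {A. det A \<noteq> 0}"
      using spd_symmetric[OF A] spd_nonneg[OF A] spd_det_pos[OF A] by (simp add: C_def)
  next
    fix A :: "real^'n^'n" assume A: "A \<in> C \<inter> {A. det A \<noteq> 0}"
    then have sym: "transpose A = A" and nonneg: "\<And>x. x \<bullet> (A *v x) \<ge> 0" and det: "det A \<noteq> 0"
      unfolding C_def by blast+
    obtain Q d where Q: "orthogonal_matrix Q" and AQ: "A = Q ** diag_mat d ** transpose Q"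
      using spectral_theorem[OF sym] by metis
    have "d i \<ge> 0" for i
      using nonneg[of "Q *v axis i 1"] unfolding AQ spectral_form[OF Q] .
    moreover have "d i \<noteq> 0" for i
      using det unfolding AQ by (simp add: det_orthogonal_congruence[OF Q] det_diag_mat)
    ultimately have "diag_mat d \<in> spd" by (intro spd_diag_mat) (metis less_eq_real_def)
    then show "A \<in> spd"
      using spd_congruence[of "transpose Q" "diag_mat d"] Q by (simp add: AQ orthogonal_matrix_invertible)
  qed
  moreover have "C \<inter> {A. det A \<noteq> 0} \<in> sets borel" using borel_closed[OF C] by measurable
  ultimately show ?thesis by simp
qed

text \<open>The unnormalised type II density with unit scale on the block \<open>I\<close>, as a function of the stored
  coordinates. Its exponents depend on the size of the block in such a way that deleting an index is a
  change of \<open>b\<close> alone.\<close>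

definition beta_kernel :: "'n::{finite,linorder} set \<Rightarrow> real \<Rightarrow> real \<Rightarrow> ('n \<times> 'n \<Rightarrow> real) \<Rightarrow> ennreal" where
  "beta_kernel I a b x = indicator spd (block I x) *
     ennreal (det (block I x) powr (a - (real (card I) + 1) / 2) * det (shifted_block I x) powr (- (a + b)))"

lemma beta_kernel_measurable [measurable]:
  "pairs I \<subseteq> U \<Longrightarrow> beta_kernel I a b \<in> borel_measurable (lborel_on U)"
  unfolding beta_kernel_def[abs_def] by measurable

text \<open>What the stored coordinates of the block, of the new row and of the new diagonal entry mean for the
  enlarged matrix.\<close>

lemma block_merge:
  assumes "k \<notin> I"
  defines "z x w t \<equiv> merge (pairs I) (insert (k, k) (pair_of k ` I)) (x, w((k, k) := t))"
  shows "block I (z x w t) = block I x" "shifted_block I (z x w t) = shifted_block I x"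
    "border I k (sym_of_upper (z x w t)) = block_vec I (pair_of k) w"
    "sym_of_upper (z x w t) $ k $ k = t" "restrict (z x w t) (pairs I) = restrict x (pairs I)"
proof -
  have 1: "z x w t p = x p" if "p \<in> pairs I" for p using that by (simp add: z_def merge_def)
  show "block I (z x w t) = block I x" "shifted_block I (z x w t) = shifted_block I x"
    by (auto intro!: block_cong shifted_block_cong simp: 1)
  show "restrict (z x w t) (pairs I) = restrict x (pairs I)" by (auto simp: 1 fun_eq_iff)
  have d: "p \<notin> pairs I" if "p \<in> insert (k, k) (pair_of k ` I)" for p using pairs_disjoint[OF assms(1)] that by blast
  have "z x w t (pair_of k i) = w (pair_of k i)" if "i \<in> I" for i
    using d that diagonal_notin_pair_of[OF assms(1)] by (auto simp: z_def merge_def image_iff)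
  then show "border I k (sym_of_upper (z x w t)) = block_vec I (pair_of k) w"
    by (auto simp: border_def block_vec_def sym_of_upper_def vec_eq_iff pair_of_def)
  show "sym_of_upper (z x w t) $ k $ k = t" using d by (auto simp: sym_of_upper_def z_def merge_def)
qed

lemma nn_integral_shift: "f \<in> borel_measurable borel \<Longrightarrow> (\<integral>\<^sup>+x. f (x - t) \<partial>lborel) = (\<integral>\<^sup>+x. f (x::real) \<partial>lborel)"
  using nn_integral_real_affine[of f 1 "- t"] by simp

text \<open>Integrating out the last row of a block: the diagonal entry contributes a beta integral in the Schur
  complement, the remaining entries a power of the quadratic form of the inverse gap.\<close>

lemma nn_integral_last_row:
  fixes M :: "'n::{finite,linorder} sqmat"
  assumes k: "k \<notin> I" and P: "emb I M \<in> spd" and sym: "transpose M = M"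
    and a: "a > card I / 2" and b: "b > 0"
  defines "m \<equiv> real (card I)" and "p \<equiv> a - (real (card I) + 2) / 2"
  shows "(\<integral>\<^sup>+w. \<integral>\<^sup>+s. indicator {0<..} s * ennreal (s powr p *
       (1 + s + block_form I (pair_of k) (inverse_gap I M) w) powr (- (a + b)))
       \<partial>lborel \<partial>lborel_on (pair_of k ` I))
    = ennreal (pi powr (m / 2) * Gamma (a - m / 2) * Gamma b / Gamma (a + b) *
       (det (emb I M) powr (1 / 2) * det (emb I (mat 1 + M)) powr (1 / 2)))"
proof -
  let ?R = "inverse_gap I M" and ?v = "block_vec I (pair_of k)" and ?J = "pair_of k ` I"
  let ?K = "ennreal (det ?R powr (- 1 / 2) * (pi powr (m / 2) * Gamma (a + b - m / 2) / Gamma (a + b)))"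
  let ?w = "\<lambda>s. ennreal (s powr ((a - m / 2) - 1) * (1 + s) powr (- ((a - m / 2) + b))) * indicator {0<..} s"
  let ?h = "\<lambda>z. indicator {0<..} (z (k, k)) * ennreal (z (k, k) powr p *
       (1 + z (k, k) + ?v z \<bullet> (?R *v ?v z)) powr (- (a + b)))"
  have R: "?R \<in> spd" by (rule spd_inverse_gap[OF P])
  have embR: "emb I ?R = ?R" by (simp add: inverse_gap_def emb_emb)
  have kJ: "(k, k) \<notin> ?J" by (rule diagonal_notin_pair_of[OF k])
  have v: "?v (w((k, k) := s)) = ?v w" for w s using kJ by (auto simp: block_vec_def vec_eq_iff image_iff)
  have [measurable]: "(\<lambda>z. ?v z \<bullet> (?R *v ?v z)) \<in> borel_measurable (lborel_on (insert (k, k) ?J))"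
      "(\<lambda>z. ?v z \<bullet> (?R *v ?v z)) \<in> borel_measurable (lborel_on ?J)"
    by (rule quadratic_powr_measurable(1); blast)+
  have h: "?h \<in> borel_measurable (lborel_on (insert (k, k) ?J))" by measurable
  have detR: "det ?R powr (- 1 / 2) = det (emb I M) powr (1 / 2) * det (emb I (mat 1 + M)) powr (1 / 2)"
    using spd_det_pos[OF P] spd_det_pos[OF spd_emb_shift[OF P]]
    by (simp add: det_inverse_gap[OF P] powr_divide powr_mult powr_minus_divide)
  have "(\<integral>\<^sup>+w. \<integral>\<^sup>+s. indicator {0<..} s * ennreal (s powr p *
       (1 + s + ?v w \<bullet> (?R *v ?v w)) powr (- (a + b))) \<partial>lborel \<partial>lborel_on ?J)
     = (\<integral>\<^sup>+w. \<integral>\<^sup>+s. ?h (w((k, k) := s)) \<partial>lborel \<partial>lborel_on ?J)"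
    by (simp add: v)
  also have "\<dots> = (\<integral>\<^sup>+s. \<integral>\<^sup>+w. ?h (w((k, k) := s)) \<partial>lborel_on ?J \<partial>lborel)"
    using lborel_PiM.product_nn_integral_insert[OF _ kJ h] lborel_PiM.product_nn_integral_insert_rev[OF _ kJ h] by simp
  also have "\<dots> = (\<integral>\<^sup>+s. ?K *
      ?w s \<partial>lborel)"
  proof (rule nn_integral_cong)
    fix s :: real
    show "(\<integral>\<^sup>+w. ?h (w((k, k) := s)) \<partial>lborel_on ?J) =
      ?K *
      ?w s"
    proof (cases "s > 0")
      case True
      have G: "Gamma (a + b - m / 2) > 0" "Gamma (a + b) > 0"
        using a b by (auto intro!: Gamma_real_pos simp: m_def) 
      have "(\<integral>\<^sup>+w. ?h (w((k, k) := s)) \<partial>lborel_on ?J)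
         = (\<integral>\<^sup>+w. ennreal (s powr p) * ennreal ((1 + s + ?v w \<bullet> (emb I ?R *v ?v w)) powr (- (a + b))) \<partial>lborel_on ?J)"
        using True by (simp add: v ennreal_mult embR)
      also have "\<dots> = ennreal (s powr p) * (\<integral>\<^sup>+w. ennreal ((1 + s + ?v w \<bullet> (emb I ?R *v ?v w)) powr (- (a + b))) \<partial>lborel_on ?J)"
        unfolding embR by (rule nn_integral_cmult) measurable
      also have "(\<integral>\<^sup>+w. ennreal ((1 + s + ?v w \<bullet> (emb I ?R *v ?v w)) powr (- (a + b))) \<partial>lborel_on ?J)
        = ennreal (det (emb I ?R) powr (- 1 / 2) * (1 + s) powr (m / 2 - (a + b)) *
         (pi powr (m / 2) * Gamma (a + b - m / 2) / Gamma (a + b)))"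
        unfolding m_def using R True a b
        by (intro nn_integral_quadratic_form_powr) (auto simp: embR inj_pair_of spd_symmetric)
      also have "ennreal (s powr p) * \<dots> =
        ?K *
        (ennreal (s powr ((a - m / 2) - 1) * (1 + s) powr (- ((a - m / 2) + b))))"
      proof -
        have e: "p = (a - m / 2) - 1" "m / 2 - (a + b) = - ((a - m / 2) + b)"
          by (simp_all add: p_def m_def field_simps)
        show ?thesis unfolding e embR using G
          by (simp add: ennreal_mult[symmetric] less_imp_le mult_ac)
      qed
      moreover have "indicator {0<..} s = (1 :: ennreal)" using True by simp
      ultimately show ?thesis by (simp only: mult_1_right)
    qed (simp add: v)
  qed
  also have "\<dots> = ?K *
      (\<integral>\<^sup>+s. ?w s \<partial>lborel)"
    by (rule nn_integral_cmult) measurable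
  also have "(\<integral>\<^sup>+s. ?w s \<partial>lborel)
      = ennreal (Beta (a - m / 2) b)"
    using a b by (intro nn_integral_Beta_halfline) (simp_all add: m_def)
  also have "?K *
      ennreal (Beta (a - m / 2) b) = ennreal (pi powr (m / 2) * Gamma (a - m / 2) * Gamma b / Gamma (a + b) *
       (det (emb I M) powr (1 / 2) * det (emb I (mat 1 + M)) powr (1 / 2)))"
  proof -
    have G: "Gamma (a - m / 2 + b) > 0" "Gamma (a + b) > 0" "Gamma (a - m / 2) > 0" "Gamma b > 0"
      using a b by (auto intro!: Gamma_real_pos simp: m_def)
    have "a + b - m / 2 = a - m / 2 + b" by simp
    then show ?thesis using G unfolding detR Beta_def
      by (subst ennreal_mult[symmetric]) (auto intro!: arg_cong[where f = ennreal] simp: field_simps less_imp_le)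
  qed
  finally show ?thesis .
qed


text \<open>The recursion behind all normalising constants and marginals: deleting one index lowers the second
  parameter by one half.\<close>

lemma beta_kernel_recursion:
  fixes f :: "('n::{finite,linorder} \<times> 'n \<Rightarrow> real) \<Rightarrow> ennreal"
  assumes k: "k \<notin> I" and a: "a > card I / 2" and b: "b > 0"
    and f[measurable]: "f \<in> borel_measurable (block_lborel I)"
  defines "m \<equiv> real (card I)"
  shows "(\<integral>\<^sup>+x. f (restrict x (pairs I)) * beta_kernel (insert k I) a b x \<partial>block_lborel (insert k I))
    = ennreal (pi powr (m / 2) * Gamma (a - m / 2) * Gamma b / Gamma (a + b)) *
      (\<integral>\<^sup>+x. f x * beta_kernel I a (b - 1 / 2) x \<partial>block_lborel I)"
proof -
  let ?R = "insert (k, k) (pair_of k ` I)" and ?J = "pair_of k ` I"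
  let ?v = "block_vec I (pair_of k)"
  let ?F = "\<lambda>x. f (restrict x (pairs I)) * beta_kernel (insert k I) a b x"
  let ?G = "\<lambda>x. inverse_gap I (sym_of_upper x)"
  let ?K = "pi powr (m / 2) * Gamma (a - m / 2) * Gamma b / Gamma (a + b)"
  define p where "p = a - (real (card I) + 2) / 2"
  have cJ: "real (card (insert k I)) = m + 1" using k by (simp add: m_def)
  have K: "?K > 0" using a b by (auto intro!: mult_pos_pos divide_pos_pos Gamma_real_pos simp: m_def)
  have kJ: "(k, k) \<notin> ?J" by (rule diagonal_notin_pair_of[OF k])
  have [measurable]: "(\<lambda>x. restrict x (pairs I)) \<in> measurable (block_lborel (insert k I)) (block_lborel I)"
    by (rule measurable_restrict_subset) (auto simp: pairs_def)
  have F: "?F \<in> borel_measurable (lborel_on (pairs I \<union> ?R))"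
    unfolding pairs_insert[symmetric] by measurable
  have "(\<integral>\<^sup>+x. ?F x \<partial>block_lborel (insert k I))
     = (\<integral>\<^sup>+x. \<integral>\<^sup>+y. ?F (merge (pairs I) ?R (x, y)) \<partial>lborel_on ?R \<partial>block_lborel I)"
    unfolding pairs_insert
    by (rule lborel_PiM.product_nn_integral_fold[OF pairs_disjoint[OF k] _ _ F]) auto
  also have "\<dots> = (\<integral>\<^sup>+x. ennreal ?K * (f x * beta_kernel I a (b - 1 / 2) x) \<partial>block_lborel I)"
  proof (rule nn_integral_cong)
    fix x assume x: "x \<in> space (block_lborel I)"
    have restr: "restrict x (pairs I) = x"
      using x by (simp add: space_PiM PiE_def extensional_restrict)
    have [measurable]: "(\<lambda>y. merge (pairs I) ?R (x, y)) \<in> measurable (lborel_on ?R) (lborel_on (pairs I \<union> ?R))"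
      using x by measurable
    have Fx: "(\<lambda>y. ?F (merge (pairs I) ?R (x, y))) \<in> borel_measurable (lborel_on ?R)"
      using F by measurable
    show "(\<integral>\<^sup>+y. ?F (merge (pairs I) ?R (x, y)) \<partial>lborel_on ?R) = ennreal ?K * (f x * beta_kernel I a (b - 1 / 2) x)"
    proof (cases "block I x \<in> spd")
      case False
      have "block (insert k I) (merge (pairs I) ?R (x, y)) \<notin> spd" for y
      proof
        assume "block (insert k I) (merge (pairs I) ?R (x, y)) \<in> spd"
        then have "block I (merge (pairs I) ?R (x, y((k, k) := y (k, k)))) \<in> spd"
          unfolding block_def by (simp add: spd_emb_mono[of "insert k I"] subset_insertI)
        then show False using False unfolding block_merge(1)[OF k] by simp
      qed
      then show ?thesis using False by (simp add: beta_kernel_def)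
    next
      case True
      define P P1 where "P = emb I (sym_of_upper x)" and "P1 = emb I (mat 1 + sym_of_upper x)"
      have P: "P \<in> spd" "P1 \<in> spd" using True spd_emb_shift[of I "sym_of_upper x"] by (simp_all add: block_def P_def P1_def)
      have detP: "det P > 0" "det P1 > 0" using P by (auto intro: spd_det_pos)
      define B where "B = det P powr p * det P1 powr (- (a + b))"
      let ?h = "\<lambda>w s. indicator {0<..} s * ennreal (s powr p * (1 + s + ?v w \<bullet> (?G x *v ?v w)) powr (- (a + b)))"
      let ?H = "\<lambda>w. \<integral>\<^sup>+s. ?h w s \<partial>lborel"
      let ?t = "\<lambda>w. ?v w \<bullet> (matrix_inv P *v ?v w)"
      have inner: "?F (merge (pairs I) ?R (x, w((k, k) := t))) = f x * ennreal B * ?h w (t - ?t w)" for w t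
      proof -
        let ?z = "merge (pairs I) ?R (x, w((k, k) := t))"
        note z = block_merge[OF k, of x w t]
        have embz: "emb I (sym_of_upper ?z) = P" "emb I (mat 1 + sym_of_upper ?z) = P1"
          using z(1,2) by (simp_all add: block_def shifted_block_def P_def P1_def)
        have gap: "inverse_gap I (sym_of_upper ?z) = ?G x"
          unfolding inverse_gap_def embz by (simp add: P_def P1_def)
        have zP: "emb I (sym_of_upper ?z) \<in> spd" "emb I (mat 1 + sym_of_upper ?z) \<in> spd" using P embz by simp_all
        have schur: "schur I k (sym_of_upper ?z) = t - ?t w"
          unfolding schur_def z(3,4) embz ..
        have schur1: "schur I k (mat 1 + sym_of_upper ?z) = 1 + (t - ?t w) + ?v w \<bullet> (?G x *v ?v w)"
          unfolding schur_shift[OF zP(1) k] schur z(3) gap ..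
        have spd_iff: "block (insert k I) ?z \<in> spd \<longleftrightarrow> 0 < t - ?t w"
          unfolding block_def spd_emb_insert_iff[OF k sym_of_upper_symmetric zP(1)] schur ..
        have d: "det (block (insert k I) ?z) = (t - ?t w) * det P"
          unfolding block_def det_emb_insert[OF k sym_of_upper_symmetric zP(1)] schur embz ..
        have "transpose (mat 1 + sym_of_upper ?z) = mat 1 + sym_of_upper ?z" by (simp add: transpose_add)
        then have d1: "det (shifted_block (insert k I) ?z) = (1 + (t - ?t w) + ?v w \<bullet> (?G x *v ?v w)) * det P1"
          unfolding shifted_block_def by (subst det_emb_insert[OF k _ zP(2)]) (simp_all only: schur1 embz)
        have gap_nonneg: "0 \<le> ?v w \<bullet> (?G x *v ?v w)"
          using P(1) unfolding P_def by (intro spd_nonneg spd_inverse_gap)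
        have pe: "a - (m + 1 + 1) / 2 = p" by (simp add: p_def m_def)
        show ?thesis
        proof (cases "0 < t - ?t w")
          case True
          have split: "(\<sigma> * det P) powr p * (\<tau> * det P1) powr (- (a + b)) = B * (\<sigma> powr p * \<tau> powr (- (a + b)))"
            if "\<sigma> > 0" "\<tau> > 0" for \<sigma> \<tau>
            using that detP by (simp add: B_def powr_mult mult_ac)
          have "1 + (t - ?t w) + ?v w \<bullet> (?G x *v ?v w) > 0" using True gap_nonneg by linarith
          note split = split[OF True this]
          have ind: "indicator spd (block (insert k I) ?z) = (1 :: ennreal)"
              "indicator {0<..} (t - ?t w) = (1 :: ennreal)"
            using spd_iff True by simp_all
          have "ennreal (B * y) = ennreal B * ennreal y" for y by (intro ennreal_mult') (simp add: B_def)
          then show ?thesis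
            unfolding beta_kernel_def z(5) restr d d1 cJ pe ind split mult_1 by (simp only: mult.assoc)
        next
          case False
          then show ?thesis using spd_iff by (simp add: beta_kernel_def)
        qed
      qed
      have hm: "(\<lambda>s. ?h w s) \<in> borel_measurable borel" for w by measurable
      have hJ: "(\<lambda>w. ?H w) \<in> borel_measurable (lborel_on ?J)"
      proof -
        have [measurable]: "(\<lambda>w. ?v w \<bullet> (?G x *v ?v w)) \<in> borel_measurable (lborel_on ?J)"
          by (rule quadratic_powr_measurable(1)) blast
        show ?thesis by measurable
      qed
      have "(\<integral>\<^sup>+y. ?F (merge (pairs I) ?R (x, y)) \<partial>lborel_on ?R)
        = (\<integral>\<^sup>+w. \<integral>\<^sup>+t. ?F (merge (pairs I) ?R (x, w((k, k) := t))) \<partial>lborel \<partial>lborel_on ?J)"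
        by (rule lborel_PiM.product_nn_integral_insert[OF _ kJ Fx]) simp
      also have "\<dots> = (\<integral>\<^sup>+w. f x * ennreal B * ?H w \<partial>lborel_on ?J)"
      proof (rule nn_integral_cong)
        fix w
        have "(\<integral>\<^sup>+t. f x * ennreal B * ?h w (t - ?t w) \<partial>lborel) = f x * ennreal B * (\<integral>\<^sup>+t. ?h w (t - ?t w) \<partial>lborel)"
          by (rule nn_integral_cmult) measurable
        also have "(\<integral>\<^sup>+t. ?h w (t - ?t w) \<partial>lborel) = ?H w"
          by (rule nn_integral_shift[OF hm])
        finally show "(\<integral>\<^sup>+t. ?F (merge (pairs I) ?R (x, w((k, k) := t))) \<partial>lborel) = f x * ennreal B * ?H w"
          unfolding inner .
      qed
      also have "\<dots> = f x * ennreal B * (\<integral>\<^sup>+w. ?H w \<partial>lborel_on ?J)"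
        by (rule nn_integral_cmult[OF hJ])
      also have "(\<integral>\<^sup>+w. ?H w \<partial>lborel_on ?J) = ennreal (?K * (det P powr (1 / 2) * det P1 powr (1 / 2)))"
        unfolding p_def P_def P1_def m_def
        by (rule nn_integral_last_row[OF k _ sym_of_upper_symmetric a b]) (use P in \<open>simp add: P_def\<close>)
      also have "f x * ennreal B * \<dots> = ennreal ?K * (f x * ennreal (B * (det P powr (1 / 2) * det P1 powr (1 / 2))))"
      proof -
        define X where "X = det P powr (1 / 2) * det P1 powr (1 / 2)"
        have "ennreal (?K * X) = ennreal ?K * ennreal X" using K by (intro ennreal_mult') simp
        moreover have "ennreal (B * X) = ennreal B * ennreal X" by (intro ennreal_mult') (simp add: B_def)
        ultimately show ?thesis unfolding X_def[symmetric] by (simp only: mult_ac)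
      qed
      also have "B * (det P powr (1 / 2) * det P1 powr (1 / 2)) = det P powr (p + 1 / 2) * det P1 powr (- (a + b) + 1 / 2)"
        by (simp add: B_def powr_add)
      also have "p + 1 / 2 = a - (m + 1) / 2" by (simp add: p_def m_def field_simps)
      also have "- (a + b) + 1 / 2 = - (a + (b - 1 / 2))" by simp
      also have "ennreal (det P powr (a - (m + 1) / 2) * det P1 powr (- (a + (b - 1 / 2)))) = beta_kernel I a (b - 1 / 2) x"
        using True by (simp add: beta_kernel_def block_def shifted_block_def P_def P1_def m_def)
      finally show ?thesis .
    qed
  qed
  also have "\<dots> = ennreal ?K * (\<integral>\<^sup>+x. f x * beta_kernel I a (b - 1 / 2) x \<partial>block_lborel I)"
    by (rule nn_integral_cmult) measurable
  finally show ?thesis .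
qed

lemma mv_Gamma_Suc: "mv_Gamma (Suc m) a = pi powr (real m / 2) * mv_Gamma m a * Gamma (a - real m / 2)"
proof -
  have "real (Suc m) * (real (Suc m) - 1) / 4 = real m / 2 + real m * (real m - 1) / 4"
    by (simp add: field_simps)
  then have "pi powr (real (Suc m) * (real (Suc m) - 1) / 4) = pi powr (real m / 2) * pi powr (real m * (real m - 1) / 4)"
    by (simp only: powr_add)
  then show ?thesis unfolding mv_Gamma_def by (simp only:) simp
qed

text \<open>The factors may be split off at either end of the product. Splitting off the first one is what
  matches the shift of \<open>b\<close> in the recursion.\<close>

lemma mv_Gamma_shift: "mv_Gamma (Suc m) a = pi powr (real m / 2) * Gamma a * mv_Gamma m (a - 1 / 2)"
proof (induction m)
  case 0
  then show ?case by (simp add: mv_Gamma_def)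
next
  case (Suc m)
  have "pi powr (real (Suc m) / 2) * Gamma a * mv_Gamma (Suc m) (a - 1 / 2)
      = pi powr (real (Suc m) / 2) * (pi powr (real m / 2) * Gamma a * mv_Gamma m (a - 1 / 2)) * Gamma (a - 1 / 2 - real m / 2)"
    by (simp add: mv_Gamma_Suc)
  also have "\<dots> = mv_Gamma (Suc (Suc m)) a"
  proof -
    have e: "a - 1 / 2 - real m / 2 = a - real (Suc m) / 2" by (simp add: field_simps)
    show ?thesis unfolding Suc[symmetric] mv_Gamma_Suc[of "Suc m"] e ..
  qed
  finally show ?case by simp
qed

lemma mv_Gamma_pos: "a > (real m - 1) / 2 \<Longrightarrow> mv_Gamma m a > 0"
  unfolding mv_Gamma_def by (intro mult_pos_pos prod_pos Gamma_real_pos) (auto simp: field_simps)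

lemma mv_Beta_pos: "a > (real m - 1) / 2 \<Longrightarrow> b > (real m - 1) / 2 \<Longrightarrow> m > 0 \<Longrightarrow> mv_Beta m a b > 0"
  unfolding mv_Beta_def by (intro mult_pos_pos divide_pos_pos mv_Gamma_pos) (auto simp: field_simps)

lemma mv_Beta_Suc:
  "mv_Beta (Suc m) a b = pi powr (real m / 2) * Gamma (a - real m / 2) * Gamma b / Gamma (a + b) * mv_Beta m a (b - 1 / 2)"
  unfolding mv_Beta_def mv_Gamma_Suc[of m a] mv_Gamma_shift[of m b] mv_Gamma_shift[of m "a + b"]
  by (simp add: add_diff_eq)

lemma beta_kernel_integral:
  fixes I :: "'n::{finite,linorder} set"
  assumes "a > (real (card I) - 1) / 2" "b > (real (card I) - 1) / 2"
  shows "(\<integral>\<^sup>+x. beta_kernel I a b x \<partial>block_lborel I) = ennreal (mv_Beta (card I) a b)"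
proof -
  have "finite I" by simp
  then show ?thesis using assms
  proof (induction I arbitrary: b rule: finite_induct)
    case empty
    have "pairs ({} :: 'n set) = {}" by (auto simp: pairs_def)
    then show ?case
      by (simp add: PiM_empty nn_integral_count_space_finite beta_kernel_def block_def shifted_block_def
          mv_Beta_def mv_Gamma_def)
  next
    case (insert k I)
    have c: "card (insert k I) = Suc (card I)" using insert.hyps by simp
    have a: "a > real (card I) / 2" "b > 0" using insert.prems unfolding c by auto
    have IH: "(\<integral>\<^sup>+x. beta_kernel I a (b - 1 / 2) x \<partial>block_lborel I) = ennreal (mv_Beta (card I) a (b - 1 / 2))"
      using insert.prems unfolding c by (intro insert.IH) (auto simp: field_simps)
    have G: "Gamma (a - real (card I) / 2) > 0" "Gamma b > 0" "Gamma (a + b) > 0"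
      using a by (auto intro!: Gamma_real_pos)
    have "(\<integral>\<^sup>+x. beta_kernel (insert k I) a b x \<partial>block_lborel (insert k I))
      = ennreal (pi powr (real (card I) / 2) * Gamma (a - real (card I) / 2) * Gamma b / Gamma (a + b)) *
        ennreal (mv_Beta (card I) a (b - 1 / 2))"
      using beta_kernel_recursion[OF insert.hyps(2) a, of "\<lambda>_. 1"] IH by simp
    also have "\<dots> = ennreal (mv_Beta (card (insert k I)) a b)"
      unfolding c mv_Beta_Suc using G by (intro ennreal_mult'[symmetric]) simp
    finally show ?case .
  qed
qed

text \<open>Iterating the recursion, the law of a principal block is again of type II, with \<open>b\<close> lowered by half
  the number of deleted indices.\<close>

lemma beta_kernel_marginal:
  fixes I D :: "'n::{finite,linorder} set"
  assumes "D \<inter> I = {}" and I: "I \<noteq> {}"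
    and "a > (real (card I + card D) - 1) / 2" "b > (real (card I + card D) - 1) / 2"
    and f[measurable]: "f \<in> borel_measurable (block_lborel I)"
  shows "(\<integral>\<^sup>+x. f (restrict x (pairs I)) * beta_kernel (I \<union> D) a b x \<partial>block_lborel (I \<union> D))
    = ennreal (mv_Beta (card I + card D) a b / mv_Beta (card I) a (b - real (card D) / 2)) *
      (\<integral>\<^sup>+x. f x * beta_kernel I a (b - real (card D) / 2) x \<partial>block_lborel I)"
proof -
  have cI: "card I > 0" using I by (simp add: card_gt_0_iff)
  have "finite D" by simp
  then show ?thesis using assms(1,3,4)
  proof (induction D arbitrary: b rule: finite_induct)
    case empty
    have "mv_Beta (card I) a b > 0" using empty.prems cI by (intro mv_Beta_pos) auto
    moreover have "(\<integral>\<^sup>+x. f (restrict x (pairs I)) * beta_kernel I a b x \<partial>block_lborel I) =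
        (\<integral>\<^sup>+x. f x * beta_kernel I a b x \<partial>block_lborel I)"
      by (intro nn_integral_cong) (simp add: space_PiM PiE_def extensional_restrict)
    ultimately show ?case by (simp del: restrict_apply)
  next
    case (insert k D)
    let ?N = "card I + card D"
    have k: "k \<notin> I \<union> D" using insert by auto
    have c: "card (I \<union> D) = ?N" "card (insert k D) = Suc (card D)"
      using insert by (auto intro!: card_Un_disjoint)
    have a: "a > real (card (I \<union> D)) / 2" "b > 0" using insert.prems unfolding c by auto
    let ?K = "pi powr (real ?N / 2) * Gamma (a - real ?N / 2) * Gamma b / Gamma (a + b)"
    have K: "?K > 0" using a unfolding c by (auto intro!: mult_pos_pos divide_pos_pos Gamma_real_pos)
    have sub: "pairs I \<subseteq> pairs (I \<union> D)" by (auto simp: pairs_def)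
    have [measurable]: "(\<lambda>x. restrict x (pairs I)) \<in> measurable (block_lborel (I \<union> D)) (block_lborel I)"
      using sub by (rule measurable_restrict_subset)
    have "(\<lambda>x. f (restrict x (pairs I))) \<in> borel_measurable (block_lborel (I \<union> D))"
      by measurable
    from beta_kernel_recursion[OF k a this]
    have "(\<integral>\<^sup>+x. f (restrict x (pairs I)) * beta_kernel (I \<union> insert k D) a b x \<partial>block_lborel (I \<union> insert k D))
      = ennreal ?K * (\<integral>\<^sup>+x. f (restrict x (pairs I)) * beta_kernel (I \<union> D) a (b - 1 / 2) x \<partial>block_lborel (I \<union> D))"
      using sub by (simp add: c Int_absorb1)
    also have "(\<integral>\<^sup>+x. f (restrict x (pairs I)) * beta_kernel (I \<union> D) a (b - 1 / 2) x \<partial>block_lborel (I \<union> D))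
      = ennreal (mv_Beta ?N a (b - 1 / 2) / mv_Beta (card I) a (b - 1 / 2 - real (card D) / 2)) *
        (\<integral>\<^sup>+x. f x * beta_kernel I a (b - 1 / 2 - real (card D) / 2) x \<partial>block_lborel I)"
      using insert.prems unfolding c by (intro insert.IH) (auto simp: field_simps)
    also have "b - 1 / 2 - real (card D) / 2 = b - real (card (insert k D)) / 2"
      unfolding c by (simp add: field_simps)
    also have "ennreal ?K * (ennreal (mv_Beta ?N a (b - 1 / 2) / y) * z) = ennreal (mv_Beta (card I + card (insert k D)) a b / y) * z" for y z
      unfolding c add_Suc_right mv_Beta_Suc times_divide_eq_right[symmetric, of ?K]
      using K by (subst ennreal_mult') (simp_all only: mult.assoc less_imp_le)
    finally show ?case .
  qed
qed

text \<open>A power of a principal minor only shifts the two parameters, so its mean is a ratio of two multivariate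
  beta functions of the size of the block.\<close>

lemma beta_kernel_minor_moment:
  fixes I :: "'n::{finite,linorder} set" and a b t :: real
  defines "d \<equiv> real CARD('n)" and "m \<equiv> real (card I)"
  defines "b' \<equiv> b - (d - m) / 2"
  assumes "a > (d - 1) / 2" "b > (d - 1) / 2" "I \<noteq> {}" "t \<ge> 0" "b' - t > (m - 1) / 2"
  shows "(\<integral>\<^sup>+x. ennreal (det (block I x) powr t) * beta_kernel UNIV a b x \<partial>block_lborel UNIV)
    = ennreal (mv_Beta CARD('n) a b * (mv_Beta (card I) (a + t) (b' - t) / mv_Beta (card I) a b'))"
proof -
  have cI: "card I > 0" using \<open>I \<noteq> {}\<close> by (simp add: card_gt_0_iff)
  have cD: "card I + card (- I) = CARD('n)" by (simp add: card_Un_disjoint[symmetric])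
  then have D: "real (card (- I)) = d - m" by (simp add: d_def m_def)
  have dm: "m \<le> d" "m \<ge> 1" "d \<ge> 1" using D cI by (auto simp: m_def d_def)
  have B: "mv_Beta CARD('n) a b > 0" "mv_Beta (card I) a b' > 0" "mv_Beta (card I) (a + t) (b' - t) > 0"
    using assms dm cI by (auto intro!: mv_Beta_pos simp: d_def m_def)
  have weight: "ennreal (det (block I x) powr t) * beta_kernel I a b' x = beta_kernel I (a + t) (b' - t) x" for x
  proof (cases "block I x \<in> spd")
    case True
    have "t + (a - (m + 1) / 2) = a + t - (m + 1) / 2" by simp
    then have e: "det (block I x) powr t * det (block I x) powr (a - (m + 1) / 2) = det (block I x) powr (a + t - (m + 1) / 2)"
      by (simp only: powr_add[symmetric])
    have e': "- (a + t + (b' - t)) = - (a + b')" by simp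
    have "indicator spd (block I x) = (1 :: ennreal)" using True by simp
    moreover have "ennreal (det (block I x) powr t) * ennreal y = ennreal (det (block I x) powr t * y)" for y
      by (rule ennreal_mult'[symmetric]) simp
    ultimately show ?thesis
      unfolding beta_kernel_def m_def[symmetric] e' by (simp only: mult_1 mult.assoc[symmetric] e)
  qed (simp add: beta_kernel_def)
  have restr: "block I (restrict x (pairs I)) = block I x" for x by (rule block_cong) simp
  have "(\<lambda>x. ennreal (det (block I x) powr t)) \<in> borel_measurable (block_lborel I)"
    by measurable
  then have "(\<integral>\<^sup>+x. ennreal (det (block I (restrict x (pairs I))) powr t) * beta_kernel (I \<union> - I) a b x
        \<partial>block_lborel (I \<union> - I))
    = ennreal (mv_Beta (card I + card (- I)) a b / mv_Beta (card I) a (b - real (card (- I)) / 2)) *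
      (\<integral>\<^sup>+x. ennreal (det (block I x) powr t) * beta_kernel I a (b - real (card (- I)) / 2) x \<partial>block_lborel I)"
    using assms by (intro beta_kernel_marginal) (auto simp: cD d_def)
  then have "(\<integral>\<^sup>+x. ennreal (det (block I x) powr t) * beta_kernel UNIV a b x \<partial>block_lborel UNIV)
    = ennreal (mv_Beta CARD('n) a b / mv_Beta (card I) a b') *
      (\<integral>\<^sup>+x. beta_kernel I (a + t) (b' - t) x \<partial>block_lborel I)"
    unfolding restr cD D b'_def[symmetric] weight Compl_partition .
  also have "(\<integral>\<^sup>+x. beta_kernel I (a + t) (b' - t) x \<partial>block_lborel I) = ennreal (mv_Beta (card I) (a + t) (b' - t))"
    using assms dm by (intro beta_kernel_integral) (auto simp: m_def)
  finally show ?thesis using B by (simp add: ennreal_mult'[symmetric])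
qed

section \<open>Invariance of Lebesgue measure on symmetric matrices\<close>

lemma pairs_UNIV: "pairs UNIV = {(i, j). i \<le> j}"
  by (simp add: pairs_def)

lemma sym_of_upper_measurable [measurable]:
  "sym_of_upper \<in> borel_measurable (block_lborel UNIV)"
  using block_measurable(1)[of UNIV "pairs UNIV"] by (simp add: block_def[abs_def])

lemma nn_integral_sym_lborel:
  "f \<in> borel_measurable borel \<Longrightarrow>
    (\<integral>\<^sup>+X. f X \<partial>sym_lborel) = (\<integral>\<^sup>+x. f (sym_of_upper x) \<partial>block_lborel UNIV)"
  unfolding sym_lborel_def pairs_UNIV[symmetric] by (rule nn_integral_distr) simp_all

lemma borel_measurable_congruence [measurable]:
  "(\<lambda>X. G ** X ** H) \<in> borel_measurable borel" for G H :: "real^'n^'n"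
  unfolding matrix_matrix_mult_def by (intro borel_measurable_vecI) simp

lemma nn_integral_sym_translate:
  fixes f :: "'n::{finite,linorder} sqmat \<Rightarrow> ennreal"
  assumes f: "f \<in> borel_measurable borel" and S: "transpose S = S" and c: "\<bar>c\<bar> = 1"
  shows "(\<integral>\<^sup>+x. f (S + c *\<^sub>R sym_of_upper x) \<partial>block_lborel UNIV)
     = (\<integral>\<^sup>+x. f (sym_of_upper x) \<partial>block_lborel UNIV)"
proof -
  have Sij: "S $ min i j $ max i j = S $ i $ j" for i j
    using arg_cong[OF S, of "\<lambda>M. M $ i $ j"] by (auto simp: min_def max_def transpose_def)
  have "sym_of_upper (\<lambda>p\<in>pairs UNIV. S $ fst p $ snd p + c * x p) = S + c *\<^sub>R sym_of_upper x" for x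
    by (simp add: sym_of_upper_def vec_eq_iff pairs_def Sij min_le_iff_disj le_max_iff_disj)
  moreover have "(\<integral>\<^sup>+x. f (sym_of_upper x) \<partial>block_lborel UNIV)
    = ennreal (\<Prod>p\<in>pairs (UNIV :: 'n set). \<bar>c\<bar>) *
      (\<integral>\<^sup>+x. f (sym_of_upper (\<lambda>p\<in>pairs UNIV. S $ fst p $ snd p + c * x p)) \<partial>block_lborel UNIV)"
    using c f by (intro nn_integral_PiM_affine) auto
  ultimately show ?thesis by (simp add: c)
qed

text \<open>The exponent is the number of \<open>j\<close> with \<open>i \<le> j\<close> plus the number with \<open>j \<le> i\<close>.\<close>

lemma prod_pairs_diagonal:
  fixes d :: "'n::{finite,linorder} \<Rightarrow> real"
  shows "(\<Prod>p\<in>pairs UNIV. d (fst p) * d (snd p)) = (\<Prod>i\<in>UNIV. d i) ^ (CARD('n) + 1)"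
proof -
  have 1: "(\<Prod>p\<in>pairs UNIV. d (fst p)) = (\<Prod>i\<in>UNIV. d i ^ card {i..})"
  proof -
    have "pairs UNIV = Sigma (UNIV :: 'n set) (\<lambda>i. {i..})" by (auto simp: pairs_def)
    then have "(\<Prod>p\<in>pairs (UNIV :: 'n set). d (fst p)) = (\<Prod>(i, j)\<in>Sigma UNIV (\<lambda>i. {i..}). d i)"
      by (simp add: case_prod_unfold)
    then show ?thesis by (simp add: prod.Sigma[symmetric])
  qed
  have 2: "(\<Prod>p\<in>pairs UNIV. d (snd p)) = (\<Prod>i\<in>UNIV. d i ^ card {..i})"
  proof -
    have "(\<Prod>p\<in>pairs UNIV. d (snd p)) = (\<Prod>p\<in>Sigma (UNIV :: 'n set) (\<lambda>i. {..i}). d (fst p))"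
      by (rule prod.reindex_bij_witness[of _ "\<lambda>(i, j). (j, i)" "\<lambda>(i, j). (j, i)"]) (auto simp: pairs_def)
    also have "\<dots> = (\<Prod>(i, j)\<in>Sigma (UNIV :: 'n set) (\<lambda>i. {..i}). d i)" by (simp add: case_prod_unfold)
    finally show ?thesis by (simp add: prod.Sigma[symmetric])
  qed
  have 3: "card {i..} + card {..i} = CARD('n) + 1" for i :: 'n
  proof -
    have "card ({i..} \<union> {..i}) + card ({i..} \<inter> {..i}) = card {i..} + card {..i}"
      by (rule card_Un_Int[symmetric]) auto
    moreover have "{i..} \<union> {..i} = UNIV" "{i..} \<inter> {..i} = {i}" by auto
    ultimately show ?thesis by simp
  qed
  show ?thesis
    by (simp only: prod.distrib 1 2 prod.distrib[symmetric] power_add[symmetric] 3 prod_power_distrib)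
qed

lemma nn_integral_sym_diagonal:
  fixes f :: "'n::{finite,linorder} sqmat \<Rightarrow> ennreal"
  assumes f: "f \<in> borel_measurable borel" and d: "\<And>i. d i > 0"
  shows "(\<integral>\<^sup>+x. f (sym_of_upper x) \<partial>block_lborel UNIV)
     = ennreal (det (diag_mat d) ^ (CARD('n) + 1)) *
       (\<integral>\<^sup>+x. f (diag_mat d ** sym_of_upper x ** diag_mat d) \<partial>block_lborel UNIV)"
proof -
  have diag: "(diag_mat d ** X ** diag_mat d) $ i $ j = d i * d j * X $ i $ j" for X i j
    by (simp add: diag_mat_def matrix_matrix_mult_def if_distrib[of "\<lambda>u. u * _"] if_distrib[of "\<lambda>u. _ * u"] cong: if_cong)
  have "sym_of_upper (\<lambda>p\<in>pairs UNIV. 0 + d (fst p) * d (snd p) * x p) = diag_mat d ** sym_of_upper x ** diag_mat d" for x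
    by (simp add: vec_eq_iff diag) (auto simp: sym_of_upper_def pairs_def min_def max_def)
  moreover have "(\<integral>\<^sup>+x. f (sym_of_upper x) \<partial>block_lborel UNIV)
    = ennreal (\<Prod>p\<in>pairs (UNIV :: 'n set). \<bar>d (fst p) * d (snd p)\<bar>) *
      (\<integral>\<^sup>+x. f (sym_of_upper (\<lambda>p\<in>pairs UNIV. 0 + d (fst p) * d (snd p) * x p)) \<partial>block_lborel UNIV)"
    using d f by (intro nn_integral_PiM_affine) (auto simp: less_imp_neq[symmetric])
  moreover have "\<bar>d i * d j\<bar> = d i * d j" for i j using d[of i] d[of j] by simp
  ultimately show ?thesis by (simp only: prod_pairs_diagonal det_diag_mat)
qed

lemma transpose_uminus: "transpose (- A) = - transpose (A :: real^'n^'m)"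
  by (simp add: transpose_def vec_eq_iff)

lemma sets_sym_lborel [measurable_cong, simp]: "sets sym_lborel = sets borel"
  by (simp add: sym_lborel_def)

text \<open>Uniqueness of translation-invariant measures, in the form of a direct Fubini argument: the
  functional \<open>f \<mapsto> \<integral> f (G X G\<^sup>T) dX\<close> is proportional to \<open>f \<mapsto> \<integral> f (X) dX\<close>. With \<open>L\<close> the congruence, the
  substitutions \<open>x \<mapsto> x + L y\<close>, \<open>y \<mapsto> y - L\<^sup>-\<^sup>1 x\<close> and \<open>x \<mapsto> L y - x\<close> move \<open>L\<close> from \<open>g\<close> to \<open>f\<close> in the double
  integral of \<open>f (x) g (L y)\<close>.\<close>

lemma nn_integral_sym_congruence_exchange:
  fixes G :: "'n::{finite,linorder} sqmat"
  assumes f[measurable]: "f \<in> borel_measurable borel" and g[measurable]: "g \<in> borel_measurable borel"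
    and G: "G ** G' = mat 1"
  shows "(\<integral>\<^sup>+x. f (sym_of_upper x) \<partial>block_lborel UNIV) *
      (\<integral>\<^sup>+x. g (G ** sym_of_upper x ** transpose G) \<partial>block_lborel UNIV) =
     (\<integral>\<^sup>+x. f (G ** sym_of_upper x ** transpose G) \<partial>block_lborel UNIV) *
      (\<integral>\<^sup>+x. (g (sym_of_upper x) :: ennreal) \<partial>block_lborel UNIV)"
proof -
  let ?\<mu> = "block_lborel (UNIV :: 'n set)"
  let ?s = "sym_of_upper :: _ \<Rightarrow> 'n::{finite,linorder} sqmat"
  let ?L = "\<lambda>X. G ** X ** transpose G" and ?L' = "\<lambda>X. G' ** X ** transpose G'"
  interpret \<mu>: pair_sigma_finite ?\<mu> ?\<mu>
    unfolding pair_sigma_finite_def by (intro conjI lborel_PiM.sigma_finite) auto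
  have sym: "transpose (?L (?s y)) = ?L (?s y)" "transpose (- ?L' (?s y)) = - ?L' (?s y)" for y
    by (simp_all only: transpose_uminus) (simp_all add: matrix_transpose_mul matrix_mul_assoc)
  have LL': "?L (?L' X) = X" for X
  proof -
    have "transpose G' ** transpose G = mat 1" using G by (metis matrix_transpose_mul transpose_mat)
    moreover have "?L (?L' X) = (G ** G') ** X ** (transpose G' ** transpose G)" by (simp add: matrix_mul_assoc)
    ultimately show ?thesis by (simp add: G)
  qed
  have Ldiff: "?L (X - Y) = ?L X - ?L Y" for X Y
    by (simp add: matrix_diff_ldistrib matrix_diff_rdistrib)
  have Lm[measurable]: "?L \<in> borel_measurable borel" by measurable
  have "(\<integral>\<^sup>+x. f (?s x) \<partial>?\<mu>) * (\<integral>\<^sup>+y. g (?L (?s y)) \<partial>?\<mu>) = (\<integral>\<^sup>+y. (\<integral>\<^sup>+x. f (?s x) \<partial>?\<mu>) * g (?L (?s y)) \<partial>?\<mu>)"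
    by (rule nn_integral_cmult[symmetric]) measurable
  also have "\<dots> = (\<integral>\<^sup>+y. \<integral>\<^sup>+x. f (?L (?s y) + ?s x) * g (?L (?s y)) \<partial>?\<mu> \<partial>?\<mu>)"
  proof (rule nn_integral_cong)
    fix y
    have "(\<integral>\<^sup>+x. f (?L (?s y) + 1 *\<^sub>R ?s x) \<partial>?\<mu>) = (\<integral>\<^sup>+x. f (?s x) \<partial>?\<mu>)"
      by (rule nn_integral_sym_translate[OF f sym(1)]) simp
    moreover have "(\<lambda>x. f (?L (?s y) + ?s x)) \<in> borel_measurable ?\<mu>" by measurable
    ultimately show "(\<integral>\<^sup>+x. f (?s x) \<partial>?\<mu>) * g (?L (?s y)) = (\<integral>\<^sup>+x. f (?L (?s y) + ?s x) * g (?L (?s y)) \<partial>?\<mu>)"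
      by (simp add: nn_integral_multc)
  qed
  also have "\<dots> = (\<integral>\<^sup>+x. \<integral>\<^sup>+y. f (?L (?s y) + ?s x) * g (?L (?s y)) \<partial>?\<mu> \<partial>?\<mu>)"
    by (rule \<mu>.Fubini') measurable
  also have "\<dots> = (\<integral>\<^sup>+x. \<integral>\<^sup>+y. f (?L (?s y)) * g (?L (?s y) - ?s x) \<partial>?\<mu> \<partial>?\<mu>)"
  proof (rule nn_integral_cong)
    fix x
    let ?h = "\<lambda>Y. f (?L Y + ?s x) * g (?L Y)"
    have h: "?h \<in> borel_measurable borel" by measurable
    have eq: "?L (- ?L' (?s x) + 1 *\<^sub>R Y) = ?L Y - ?s x" for Y
      using Ldiff[of Y "?L' (?s x)"] by (simp add: LL')
    have "(\<integral>\<^sup>+y. ?h (?s y) \<partial>?\<mu>) = (\<integral>\<^sup>+y. ?h (- ?L' (?s x) + 1 *\<^sub>R ?s y) \<partial>?\<mu>)"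
      by (rule nn_integral_sym_translate[OF h sym(2), symmetric]) simp
    then show "(\<integral>\<^sup>+y. ?h (?s y) \<partial>?\<mu>) = (\<integral>\<^sup>+y. f (?L (?s y)) * g (?L (?s y) - ?s x) \<partial>?\<mu>)"
      unfolding eq by simp
  qed
  also have "\<dots> = (\<integral>\<^sup>+y. \<integral>\<^sup>+x. f (?L (?s y)) * g (?L (?s y) - ?s x) \<partial>?\<mu> \<partial>?\<mu>)"
    by (rule \<mu>.Fubini') measurable
  also have "\<dots> = (\<integral>\<^sup>+y. f (?L (?s y)) * (\<integral>\<^sup>+x. g (?s x) \<partial>?\<mu>) \<partial>?\<mu>)"
  proof (rule nn_integral_cong)
    fix y
    have "(\<integral>\<^sup>+x. g (?L (?s y) + (- 1) *\<^sub>R ?s x) \<partial>?\<mu>) = (\<integral>\<^sup>+x. g (?s x) \<partial>?\<mu>)"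
      by (rule nn_integral_sym_translate[OF g sym(1)]) simp
    moreover have "(\<lambda>x. g (?L (?s y) - ?s x)) \<in> borel_measurable ?\<mu>" by measurable
    ultimately show "(\<integral>\<^sup>+x. f (?L (?s y)) * g (?L (?s y) - ?s x) \<partial>?\<mu>) = f (?L (?s y)) * (\<integral>\<^sup>+x. g (?s x) \<partial>?\<mu>)"
      by (simp add: nn_integral_cmult)
  qed
  also have "\<dots> = (\<integral>\<^sup>+x. f (?L (?s x)) \<partial>?\<mu>) * (\<integral>\<^sup>+x. g (?s x) \<partial>?\<mu>)"
    by (rule nn_integral_multc) measurable
  finally show ?thesis .
qed

text \<open>The kernel of the full block as a function of the matrix; positive definiteness is part of the weight,
  so that it lives on all matrices.\<close>

definition beta_weight :: "real \<Rightarrow> real \<Rightarrow> real ^ 'n ^ 'n \<Rightarrow> ennreal" where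
  "beta_weight a b X = indicator spd X *
     ennreal (det X powr (a - (real CARD('n) + 1) / 2) * det (mat 1 + X) powr (- (a + b)))"

lemma beta_weight_measurable [measurable]: "beta_weight a b \<in> borel_measurable borel"
  unfolding beta_weight_def[abs_def] by measurable

lemma beta_kernel_UNIV: "beta_kernel UNIV a b x = beta_weight a b (sym_of_upper x)"
  by (simp add: beta_kernel_def beta_weight_def block_def shifted_block_def)

lemma spd_orthogonal_iff:
  fixes Q X :: "real^'n^'n"
  assumes "orthogonal_matrix Q"
  shows "Q ** X ** transpose Q \<in> spd \<longleftrightarrow> X \<in> spd"
proof
  assume "X \<in> spd"
  then show "Q ** X ** transpose Q \<in> spd"
    using spd_congruence[of "transpose Q" X] assms by (simp add: orthogonal_matrix_invertible)
next
  assume "Q ** X ** transpose Q \<in> spd"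
  then have "transpose Q ** (Q ** X ** transpose Q) ** Q \<in> spd"
    using assms by (intro spd_congruence orthogonal_matrix_invertible)
  moreover have "transpose Q ** (Q ** X ** transpose Q) ** Q = (transpose Q ** Q) ** X ** (transpose Q ** Q)"
    by (simp add: matrix_mul_assoc)
  ultimately show "X \<in> spd" using assms by (simp add: orthogonal_matrix_def)
qed

lemma beta_weight_orthogonal:
  assumes Q: "orthogonal_matrix (Q :: real^'n^'n)"
  shows "beta_weight a b (Q ** X ** transpose Q) = beta_weight a b X"
proof -
  have "mat 1 + Q ** X ** transpose Q = Q ** (mat 1 + X) ** transpose Q"
    using Q by (simp add: matrix_add_ldistrib matrix_add_rdistrib orthogonal_matrix_def)
  then show ?thesis
    using Q by (simp add: beta_weight_def det_orthogonal_congruence indicator_def spd_orthogonal_iff)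
qed

text \<open>An integrable weight that is invariant under orthogonal congruence pins down the constant of
  proportionality.\<close>

lemma nn_integral_sym_orthogonal:
  fixes Q :: "'n::{finite,linorder} sqmat"
  assumes f: "f \<in> borel_measurable borel" and Q: "orthogonal_matrix Q"
  shows "(\<integral>\<^sup>+X. f X \<partial>sym_lborel) = (\<integral>\<^sup>+X. f (Q ** X ** transpose Q) \<partial>sym_lborel)"
proof -
  let ?\<mu> = "block_lborel (UNIV :: 'n set)"
  let ?d = "real CARD('n)"
  let ?B = "mv_Beta CARD('n) ?d ?d"
  have "?d > 0" by simp
  then have "?d > (?d - 1) / 2" by (simp add: field_simps)
  then have B: "?B > 0" "(\<integral>\<^sup>+x. beta_weight ?d ?d (sym_of_upper x) \<partial>?\<mu>) = ennreal ?B"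
    using beta_kernel_integral[of "UNIV :: 'n set" ?d ?d]
    by (auto simp: beta_kernel_UNIV intro!: mv_Beta_pos)
  have Q1: "Q ** transpose Q = mat 1" using Q by (simp add: orthogonal_matrix_def)
  have "(\<integral>\<^sup>+x. f (sym_of_upper x) \<partial>?\<mu>) * ennreal ?B = (\<integral>\<^sup>+x. f (Q ** sym_of_upper x ** transpose Q) \<partial>?\<mu>) * ennreal ?B"
    using nn_integral_sym_congruence_exchange[OF f beta_weight_measurable Q1, of ?d ?d]
    by (simp only: beta_weight_orthogonal[OF Q] B(2))
  then have "(\<integral>\<^sup>+x. f (sym_of_upper x) \<partial>?\<mu>) = (\<integral>\<^sup>+x. f (Q ** sym_of_upper x ** transpose Q) \<partial>?\<mu>)"
    using B(1) ennreal_mult_cancel_left[of "ennreal ?B"] by (simp add: mult.commute)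
  moreover have "(\<lambda>X. f (Q ** X ** transpose Q)) \<in> borel_measurable borel" using f by measurable
  ultimately show ?thesis using f by (simp only: nn_integral_sym_lborel)
qed

text \<open>The spectral theorem reduces to the orthogonal case, with factor 1, and to the diagonal case, where
  the factor is explicit.\<close>

theorem nn_integral_sym_spd_congruence:
  fixes G :: "'n::{finite,linorder} sqmat"
  assumes f[measurable]: "f \<in> borel_measurable borel" and G: "G \<in> spd"
  shows "(\<integral>\<^sup>+X. f X \<partial>sym_lborel) = ennreal (det G ^ (CARD('n) + 1)) * (\<integral>\<^sup>+X. f (G ** X ** G) \<partial>sym_lborel)"
proof -
  obtain Q d where Q: "orthogonal_matrix Q" and d: "\<And>i. d i > 0" and GQ: "G = Q ** diag_mat d ** transpose Q"
    using spd_spectral[OF G] by metis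
  let ?D = "diag_mat d"
  have detG: "det G = det ?D" unfolding GQ by (rule det_orthogonal_congruence[OF Q])
  have Q': "orthogonal_matrix (transpose Q)" using Q by simp
  have "(\<integral>\<^sup>+X. f X \<partial>sym_lborel) = (\<integral>\<^sup>+X. f (Q ** X ** transpose Q) \<partial>sym_lborel)"
    by (rule nn_integral_sym_orthogonal[OF f Q])
  also have "\<dots> = ennreal (det ?D ^ (CARD('n) + 1)) * (\<integral>\<^sup>+X. f (Q ** (?D ** X ** ?D) ** transpose Q) \<partial>sym_lborel)"
  proof -
    have m: "(\<lambda>X. f (Q ** X ** transpose Q)) \<in> borel_measurable borel"
        "(\<lambda>X. f (Q ** (?D ** X ** ?D) ** transpose Q)) \<in> borel_measurable borel" by measurable
    show ?thesis
      unfolding nn_integral_sym_lborel[OF m(1)] nn_integral_sym_lborel[OF m(2)]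
      by (rule nn_integral_sym_diagonal[OF m(1) d])
  qed
  also have "(\<integral>\<^sup>+X. f (Q ** (?D ** X ** ?D) ** transpose Q) \<partial>sym_lborel)
     = (\<integral>\<^sup>+X. f (Q ** (?D ** (transpose Q ** X ** transpose (transpose Q)) ** ?D) ** transpose Q) \<partial>sym_lborel)"
    by (rule nn_integral_sym_orthogonal[OF _ Q']) measurable
  also have "\<dots> = (\<integral>\<^sup>+X. f (G ** X ** G) \<partial>sym_lborel)"
    by (simp add: GQ matrix_mul_assoc)
  finally show ?thesis unfolding detG .
qed

section \<open>Matrix beta type II laws\<close>

lemma mat_beta_II_density_measurable [measurable]:
  "mat_beta_II_density q1 q2 S \<in> borel_measurable borel"
  unfolding mat_beta_II_density_def[abs_def] by measurable

lemma mat_beta_II_measurable: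
  "f \<in> borel_measurable borel \<Longrightarrow> f \<in> borel_measurable (mat_beta_II q1 q2 S)"
  by (subst measurable_cong_sets[OF sets_mat_beta_II refl]) (rule measurable_restrict_space1)

lemma nn_integral_mat_beta_II:
  assumes [measurable]: "f \<in> borel_measurable borel"
  shows "(\<integral>\<^sup>+X. f X \<partial>mat_beta_II q1 q2 S)
     = (\<integral>\<^sup>+X. indicator spd X * ennreal (mat_beta_II_density q1 q2 S X) * f X \<partial>sym_lborel)"
proof -
  have m: "g \<in> borel_measurable (restrict_space sym_lborel spd)" if "g \<in> borel_measurable borel" for g :: "_ \<Rightarrow> ennreal"
    using that unfolding measurable_cong_sets[OF sets_sym_lborel[symmetric] refl] by (rule measurable_restrict_space1)
  have "(\<integral>\<^sup>+X. f X \<partial>mat_beta_II q1 q2 S)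
     = (\<integral>\<^sup>+X. ennreal (mat_beta_II_density q1 q2 S X) * f X \<partial>restrict_space sym_lborel spd)"
    unfolding mat_beta_II_def by (rule nn_integral_density; rule m; measurable)
  also have "\<dots> = (\<integral>\<^sup>+X. ennreal (mat_beta_II_density q1 q2 S X) * f X * indicator spd X \<partial>sym_lborel)"
    by (rule nn_integral_restrict_space) simp
  finally show ?thesis by (simp only: mult_ac)
qed

text \<open>The powers of \<open>det G\<close> from the density add up to \<open>2 q2 + (2 q1 - (d+1)) - 2 (q1 + q2) = - (d+1)\<close> and
  cancel the Jacobian, so that congruence acts on the scale parameter only.\<close>

lemma nn_integral_mat_beta_II_congruence:
  fixes G S :: "'n::{finite,linorder} sqmat"
  assumes f[measurable]: "f \<in> borel_measurable borel" and G: "G \<in> spd" and S: "S \<in> spd"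
  shows "(\<integral>\<^sup>+X. f X \<partial>mat_beta_II q1 q2 (G ** S ** G)) = (\<integral>\<^sup>+X. f (G ** X ** G) \<partial>mat_beta_II q1 q2 S)"
proof -
  let ?d = "real CARD('n)"
  let ?k = "\<lambda>X. indicator spd (G ** X ** G) * ennreal (mat_beta_II_density q1 q2 (G ** S ** G) (G ** X ** G)) * f (G ** X ** G)"
  have tG: "transpose G = G" and iG: "invertible G" and dG: "det G > 0" and dS: "det S > 0"
    using G S by (simp_all add: spd_symmetric spd_invertible spd_det_pos)
  have iff: "G ** X ** G \<in> spd \<longleftrightarrow> X \<in> spd" for X
  proof
    assume "X \<in> spd" then show "G ** X ** G \<in> spd" using spd_congruence[OF iG] by (simp add: tG)
  next
    let ?H = "matrix_inv G"
    assume "G ** X ** G \<in> spd"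
    then have "transpose ?H ** (G ** X ** G) ** ?H \<in> spd" by (intro spd_congruence matrix_inv_invertible iG)
    moreover have "transpose ?H ** (G ** X ** G) ** ?H = (?H ** G) ** X ** (G ** ?H)"
      by (simp add: matrix_inv_symmetric[OF iG tG] matrix_mul_assoc)
    ultimately show "X \<in> spd" by (simp add: matrix_inv_left[OF iG] matrix_inv_right[OF iG])
  qed
  have dens: "det G ^ (CARD('n) + 1) * mat_beta_II_density q1 q2 (G ** S ** G) (G ** X ** G) = mat_beta_II_density q1 q2 S X"
    if X: "X \<in> spd" for X
  proof -
    have dX: "det X > 0" "det (S + X) > 0" using X S by (simp_all add: spd_det_pos spd_add)
    have "G ** S ** G + G ** X ** G = G ** (S + X) ** G"
      by (simp add: matrix_add_ldistrib matrix_add_rdistrib)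
    then have "mat_beta_II_density q1 q2 (G ** S ** G) (G ** X ** G)
      = mat_beta_II_density q1 q2 S X * ((det G powr 2) powr q2 * (det G powr 2) powr (q1 - (?d + 1) / 2) * (det G powr 2) powr (- (q1 + q2)))"
      using dG dS dX by (simp add: mat_beta_II_density_def det_mul powr_mult power2_eq_square)
    also have "(det G powr 2) powr q2 * (det G powr 2) powr (q1 - (?d + 1) / 2) * (det G powr 2) powr (- (q1 + q2)) = det G powr (- (?d + 1))"
    proof -
      have "2 * q2 + 2 * (q1 - (?d + 1) / 2) + 2 * (- (q1 + q2)) = - (?d + 1)" by (simp add: field_simps)
      then show ?thesis by (simp only: powr_powr powr_add[symmetric])
    qed
    also have "\<dots> = 1 / det G ^ (CARD('n) + 1)"
    proof -
      have "det G powr (?d + 1) = det G ^ (CARD('n) + 1)"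
        using powr_realpow[OF dG, of "CARD('n) + 1"] by (simp only: of_nat_add of_nat_1)
      then show ?thesis by (simp only: powr_minus_divide)
    qed
    finally show ?thesis using dG by simp
  qed
  have "(\<integral>\<^sup>+X. f X \<partial>mat_beta_II q1 q2 (G ** S ** G))
     = ennreal (det G ^ (CARD('n) + 1)) * (\<integral>\<^sup>+X. ?k X \<partial>sym_lborel)"
    unfolding nn_integral_mat_beta_II[OF f] by (rule nn_integral_sym_spd_congruence[OF _ G]) measurable
  also have "\<dots> = (\<integral>\<^sup>+X. ennreal (det G ^ (CARD('n) + 1)) * ?k X \<partial>sym_lborel)"
    by (rule nn_integral_cmult[symmetric]) measurable
  also have "\<dots> = (\<integral>\<^sup>+X. indicator spd X * ennreal (mat_beta_II_density q1 q2 S X) * f (G ** X ** G) \<partial>sym_lborel)"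
  proof (rule nn_integral_cong)
    fix X
    show "ennreal (det G ^ (CARD('n) + 1)) * ?k X
       = indicator spd X * ennreal (mat_beta_II_density q1 q2 S X) * f (G ** X ** G)"
    proof (cases "X \<in> spd")
      case True
      have "ennreal (mat_beta_II_density q1 q2 S X)
         = ennreal (det G ^ (CARD('n) + 1)) * ennreal (mat_beta_II_density q1 q2 (G ** S ** G) (G ** X ** G))"
        unfolding dens[OF True, symmetric] using dG by (intro ennreal_mult') simp
      then show ?thesis using True iff by (simp add: mult_ac)
    qed (simp add: iff)
  qed
  also have "\<dots> = (\<integral>\<^sup>+X. f (G ** X ** G) \<partial>mat_beta_II q1 q2 S)"
    by (rule nn_integral_mat_beta_II[symmetric]) measurable
  finally show ?thesis .
qed

lemma mat_beta_II_density_mat_1: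
  "indicator spd X * ennreal (mat_beta_II_density q1 q2 (mat 1) X)
     = ennreal (1 / mv_Beta CARD('n) q1 q2) * beta_weight q1 q2 (X :: real^'n^'n)"
  if "mv_Beta CARD('n) q1 q2 > 0"
  using that
  by (simp add: mat_beta_II_density_def beta_weight_def ennreal_mult'[symmetric] mult_ac)

lemma nn_integral_mat_beta_II_mat_1:
  fixes f :: "'n::{finite,linorder} sqmat \<Rightarrow> ennreal"
  assumes f[measurable]: "f \<in> borel_measurable borel"
    and q: "q1 > (real CARD('n) - 1) / 2" "q2 > (real CARD('n) - 1) / 2"
  shows "(\<integral>\<^sup>+X. f X \<partial>mat_beta_II q1 q2 (mat 1)) = ennreal (1 / mv_Beta CARD('n) q1 q2) *
    (\<integral>\<^sup>+x. f (sym_of_upper x) * beta_kernel UNIV q1 q2 x \<partial>block_lborel UNIV)"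
proof -
  let ?c = "ennreal (1 / mv_Beta CARD('n) q1 q2)"
  have B: "mv_Beta CARD('n) q1 q2 > 0" using q by (intro mv_Beta_pos) auto
  have "(\<integral>\<^sup>+X. f X \<partial>mat_beta_II q1 q2 (mat 1))
     = (\<integral>\<^sup>+X. ?c * beta_weight q1 q2 X * f X \<partial>sym_lborel)"
    unfolding nn_integral_mat_beta_II[OF f] mat_beta_II_density_mat_1[OF B] ..
  also have "\<dots> = (\<integral>\<^sup>+X. ?c * (f X * beta_weight q1 q2 X) \<partial>sym_lborel)"
    by (simp only: mult_ac)
  also have "\<dots> = ?c * (\<integral>\<^sup>+X. f X * beta_weight q1 q2 X \<partial>sym_lborel)"
    by (rule nn_integral_cmult) measurable
  also have "(\<integral>\<^sup>+X. f X * beta_weight q1 q2 X \<partial>sym_lborel)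
      = (\<integral>\<^sup>+x. f (sym_of_upper x) * beta_kernel UNIV q1 q2 x \<partial>block_lborel UNIV)"
    unfolding beta_kernel_UNIV by (rule nn_integral_sym_lborel) measurable
  finally show ?thesis .
qed

lemma nn_integral_mat_beta_II_sqrt:
  fixes S :: "'n::{finite,linorder} sqmat"
  assumes f: "f \<in> borel_measurable borel" and S: "S \<in> spd"
  shows "(\<integral>\<^sup>+X. f X \<partial>mat_beta_II q1 q2 S) = (\<integral>\<^sup>+X. f (spd_sqrt S ** X ** spd_sqrt S) \<partial>mat_beta_II q1 q2 (mat 1))"
  using nn_integral_mat_beta_II_congruence[OF f spd_sqrt_spd[OF S] spd_mat_1] spd_sqrt_square[OF S] by simp

lemma prob_space_mat_beta_II:
  fixes S :: "'n::{finite,linorder} sqmat"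
  assumes S: "S \<in> spd" and q: "q1 > (real CARD('n) - 1) / 2" "q2 > (real CARD('n) - 1) / 2"
  shows "prob_space (mat_beta_II q1 q2 S)"
proof
  have B: "mv_Beta CARD('n) q1 q2 > 0" using q by (intro mv_Beta_pos) auto
  have "(\<integral>\<^sup>+X. 1 \<partial>mat_beta_II q1 q2 S) = (\<integral>\<^sup>+X. 1 \<partial>mat_beta_II q1 q2 (mat 1 :: 'n::{finite,linorder} sqmat))"
    by (rule nn_integral_mat_beta_II_sqrt[OF _ S]) simp
  also have "\<dots> = ennreal (1 / mv_Beta CARD('n) q1 q2) * ennreal (mv_Beta CARD('n) q1 q2)"
    using nn_integral_mat_beta_II_mat_1[of "\<lambda>_. 1", OF _ q] beta_kernel_integral[of "UNIV :: 'n set" q1 q2] q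
    by simp
  also have "\<dots> = 1" using B by (simp add: ennreal_mult'[symmetric])
  finally show "emeasure (mat_beta_II q1 q2 S) (space (mat_beta_II q1 q2 S)) = 1" by simp
qed

lemma spd_congruence_symmetric: "G \<in> spd \<Longrightarrow> X \<in> spd \<Longrightarrow> G ** X ** G \<in> spd" for G X :: "real^'n^'n"
  using spd_congruence[of G X] by (simp add: spd_symmetric spd_invertible)

lemma congruence_transport_map:
  fixes G S :: "'n::{finite,linorder} sqmat"
  assumes G: "G \<in> spd" and S: "S \<in> spd"
  shows "(\<lambda>X. G ** X ** G) \<in> transport_maps (mat_beta_II q1 q2 S) (mat_beta_II q1 q2 (G ** S ** G))"
proof -
  let ?M = "mat_beta_II q1 q2 S" and ?N = "mat_beta_II q1 q2 (G ** S ** G)" and ?T = "\<lambda>X. G ** X ** G"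
  have "?T \<in> measurable (restrict_space borel spd) (restrict_space borel spd)"
    using G by (intro measurable_restrict_space2 measurable_restrict_space1)
      (auto simp: space_restrict_space spd_congruence_symmetric)
  then have T: "?T \<in> measurable ?M ?N"
    by (simp add: measurable_cong_sets[OF sets_mat_beta_II sets_mat_beta_II])
  moreover have "distr ?M ?N ?T = ?N"
  proof (rule measure_eqI)
    fix A assume A: "A \<in> sets (distr ?M ?N ?T)"
    then have AN: "A \<in> sets ?N" by simp
    then have AB: "A \<in> sets borel" by (simp add: sets_restrict_space_iff)
    have "emeasure (distr ?M ?N ?T) A = (\<integral>\<^sup>+X. indicator A X \<partial>distr ?M ?N ?T)"
      using A by simp
    also have "\<dots> = (\<integral>\<^sup>+X. indicator A (?T X) \<partial>?M)"
      by (intro nn_integral_distr T borel_measurable_indicator A)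
    also have "\<dots> = (\<integral>\<^sup>+X. indicator A X \<partial>?N)"
      using AB by (intro nn_integral_mat_beta_II_congruence[symmetric] G S) auto
    finally show "emeasure (distr ?M ?N ?T) A = emeasure ?N A" using AN by simp
  qed simp
  ultimately show ?thesis by (simp add: transport_maps_def)
qed

lemma nn_integral_mat_beta_II_orthogonal:
  fixes Q :: "'n::{finite,linorder} sqmat"
  assumes f[measurable]: "f \<in> borel_measurable borel" and Q: "orthogonal_matrix Q"
    and q: "q1 > (real CARD('n) - 1) / 2" "q2 > (real CARD('n) - 1) / 2"
  shows "(\<integral>\<^sup>+X. f X \<partial>mat_beta_II q1 q2 (mat 1)) = (\<integral>\<^sup>+X. f (Q ** X ** transpose Q) \<partial>mat_beta_II q1 q2 (mat 1))"
proof -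
  have B: "mv_Beta CARD('n) q1 q2 > 0" using q by (intro mv_Beta_pos) auto
  let ?c = "ennreal (1 / mv_Beta CARD('n) q1 q2)"
  have "(\<integral>\<^sup>+X. f X \<partial>mat_beta_II q1 q2 (mat 1)) = (\<integral>\<^sup>+X. ?c * beta_weight q1 q2 X * f X \<partial>sym_lborel)"
    unfolding nn_integral_mat_beta_II[OF f] mat_beta_II_density_mat_1[OF B] ..
  also have "\<dots> = (\<integral>\<^sup>+X. ?c * beta_weight q1 q2 (Q ** X ** transpose Q) * f (Q ** X ** transpose Q) \<partial>sym_lborel)"
    by (rule nn_integral_sym_orthogonal[OF _ Q]) measurable
  also have "\<dots> = (\<integral>\<^sup>+X. f (Q ** X ** transpose Q) \<partial>mat_beta_II q1 q2 (mat 1))"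
    unfolding beta_weight_orthogonal[OF Q] mat_beta_II_density_mat_1[OF B, symmetric]
    by (rule nn_integral_mat_beta_II[symmetric]) measurable
  finally show ?thesis .
qed

section \<open>Second moments\<close>

lemma det_emb_singleton:
  fixes M :: "real^'n^'n"
  assumes "transpose M = M" shows "det (emb {i} M) = M $ i $ i"
proof -
  have "border {} i M = 0" by (simp add: border_def vec_eq_iff)
  then show ?thesis using det_emb_insert[of i "{}" M] assms by (simp add: schur_def)
qed

text \<open>The pivot at \<open>j\<close> is the diagonal entry, so the Schur complement is explicit.\<close>

lemma det_emb_pair:
  fixes M :: "real^'n^'n"
  assumes M: "M \<in> spd" and ij: "i \<noteq> j"
  shows "det (emb {i, j} M) = M $ i $ i * M $ j $ j - (M $ i $ j)\<^sup>2"
proof -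
  let ?P = "emb {j} M"
  have sym: "transpose M = M" using M by (rule spd_symmetric)
  have P: "?P \<in> spd" by (rule spd_emb[OF M])
  have pos: "M $ j $ j > 0" using spd_det_pos[OF P] by (simp add: det_emb_singleton[OF sym])
  have Mij: "M $ j $ i = M $ i $ j"
    using arg_cong[OF sym, of "\<lambda>M. M $ i $ j"] by (simp add: transpose_def)
  have b: "border {j} i M = M $ i $ j *\<^sub>R axis j 1"
    by (auto simp: border_def vec_eq_iff axis_def Mij)
  have "?P *v ((M $ i $ j / M $ j $ j) *\<^sub>R axis j 1) = M $ i $ j *\<^sub>R axis j 1"
    unfolding matrix_vector_mult_scaleR matrix_vector_mult_basis
    using pos by (auto simp: vec_eq_iff column_def emb_def axis_def)
  then have "matrix_inv ?P *v (M $ i $ j *\<^sub>R axis j 1) = (M $ i $ j / M $ j $ j) *\<^sub>R axis j 1"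
    using matrix_inv_left[OF spd_invertible[OF P]] by (metis matrix_vector_mul_assoc matrix_vector_mul_lid)
  then have "schur {j} i M = M $ i $ i - (M $ i $ j)\<^sup>2 / M $ j $ j"
    by (simp add: schur_def b inner_axis power2_eq_square)
  then show ?thesis
    using det_emb_insert[of i "{j}" M] ij sym P pos by (simp add: det_emb_singleton field_simps)
qed

lemma emb_measurable [measurable]: "emb I \<in> borel_measurable borel"
proof (intro borel_measurable_vecI)
  fix i j show "(\<lambda>X. emb I X $ i $ j) \<in> borel_measurable borel"
    by (cases "i \<in> I \<and> j \<in> I") (auto simp: emb_def)
qed

lemma Gamma_diff_1: "x > 1 \<Longrightarrow> Gamma x = (x - 1) * Gamma (x - 1)" for x :: real
  using Gamma_plus1[of "x - 1"] nonpos_Ints_nonpos[of "x - 1"] by fastforce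

lemma Gamma_add_1: "x > 0 \<Longrightarrow> Gamma (x + 1) = x * Gamma x" for x :: real
  using Gamma_plus1[of x] nonpos_Ints_nonpos[of x] by fastforce

lemma mv_Beta_ratio_1:
  assumes a: "a > 0" and b: "b > 2"
  shows "mv_Beta 1 (a + 2) (b - 2) / mv_Beta 1 a b = a * (a + 1) / ((b - 1) * (b - 2))"
proof -
  have G1: "mv_Gamma 1 x = Gamma x" for x by (simp add: mv_Gamma_def)
  have 1: "Gamma (a + 2) = (a + 1) * (a * Gamma a)"
    using Gamma_add_1[of "a + 1"] Gamma_add_1[of a] a by (simp add: add.assoc)
  have 2: "Gamma b = (b - 1) * ((b - 2) * Gamma (b - 2))"
    using Gamma_diff_1[of "b - 1"] Gamma_diff_1[of b] b by simp
  have pos: "Gamma a > 0" "Gamma (b - 2) > 0" "Gamma (a + b) > 0"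
    using a b by (auto intro!: Gamma_real_pos)
  have e: "a + 2 + (b - 2) = a + b" by simp
  have cancel: "((a + 1) * (a * g1)) * g2 / z / (g1 * (b1 * (b2 * g2)) / z) = a * (a + 1) / (b1 * b2)"
    if "g1 > 0" "g2 > 0" "z > 0" "b1 > 0" "b2 > 0" for g1 g2 z b1 b2 :: real
    using that by (simp add: field_simps)
  show ?thesis
    unfolding mv_Beta_def e G1 1 2 using pos b by (intro cancel) simp_all
qed

lemma mv_Beta_ratio_2:
  assumes a: "a > 1 / 2" and b: "b > 3 / 2"
  shows "mv_Beta 2 (a + 1) (b - 1) / mv_Beta 2 a b = a * (a - 1 / 2) / ((b - 1) * (b - 3 / 2))"
proof -
  have G2: "mv_Gamma 2 x = sqrt pi * Gamma x * Gamma (x - 1 / 2)" for x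
  proof -
    have "{1..2::nat} = {1, 2}" by auto
    then show ?thesis by (simp add: mv_Gamma_def powr_half_sqrt)
  qed
  have 1: "Gamma (a + 1) = a * Gamma a" "Gamma (a + 1 - 1 / 2) = (a - 1 / 2) * Gamma (a - 1 / 2)"
    using Gamma_add_1[of a] Gamma_add_1[of "a - 1 / 2"] a by (simp_all add: algebra_simps)
  have 2: "Gamma b = (b - 1) * Gamma (b - 1)" "Gamma (b - 1 / 2) = (b - 3 / 2) * Gamma (b - 1 - 1 / 2)"
    using Gamma_diff_1[of b] Gamma_diff_1[of "b - 1 / 2"] b by (simp_all add: algebra_simps)
  have pos: "Gamma a > 0" "Gamma (a - 1 / 2) > 0" "Gamma (b - 1) > 0" "Gamma (b - 1 - 1 / 2) > 0"
    "Gamma (a + b) > 0" "Gamma (a + b - 1 / 2) > 0"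
    using a b by (auto intro!: Gamma_real_pos)
  have e: "a + 1 + (b - 1) = a + b" by simp
  have cancel: "(p * (a * g1) * (a' * g2) * (p * g3 * g4) / z) / (p * g1 * g2 * (p * (b1 * g3) * (b2 * g4)) / z) = a * a' / (b1 * b2)"
    if "p > 0" "g1 > 0" "g2 > 0" "g3 > 0" "g4 > 0" "z > 0" for p g1 g2 g3 g4 z a' b1 b2 :: real
    using that by (simp add: field_simps)
  show ?thesis
    unfolding mv_Beta_def e G2 1 2 using pos by (intro cancel) auto
qed

definition diag_moment :: "real \<Rightarrow> real \<Rightarrow> real" where
  "diag_moment q1 q = 4 * q1 * (q1 + 1) / ((q - 1) * (q - 3))"

definition offdiag_moment :: "real \<Rightarrow> real \<Rightarrow> real" where
  "offdiag_moment q1 q = 2 * q1 * (2 * q1 + q - 1) / (q * (q - 1) * (q - 3))"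

lemma trace_sandwich_measurable: "(\<lambda>X. trace (X ** M ** X ** M)) \<in> borel_measurable borel" for M :: "real^'n^'n"
  unfolding trace_def matrix_matrix_mult_def by simp

text \<open>For unit scale the second moments are governed by two numbers, the means of a squared diagonal and of
  a squared off-diagonal entry. Principal minors give the first number and the mean of
  \<open>X\<^sub>i\<^sub>i X\<^sub>j\<^sub>j - X\<^sub>i\<^sub>j\<^sup>2\<close>; orthogonal invariance supplies the missing linear relation.\<close>

context
  fixes q1 q2 q :: real and \<mu> :: "('n::{finite,linorder} sqmat) measure"
  assumes q1: "q1 > (real CARD('n) - 1) / 2" and q2: "2 * q2 > real CARD('n) + 3"
  defines "q \<equiv> 2 * q2 - real CARD('n)" and "\<mu> \<equiv> mat_beta_II q1 q2 (mat 1)"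
begin

lemma dim_pos: "real CARD('n) \<ge> 1"
proof -
  have "CARD('n) \<ge> 1" by (simp add: Suc_leI)
  then show ?thesis by linarith
qed

lemma q_gt_3: "q > 3" using q2 by (simp add: q_def)

lemma q2_gt: "q2 > (real CARD('n) - 1) / 2" using q2 dim_pos by simp

lemma space_mu: "space \<mu> = spd"
  by (simp add: \<mu>_def)

lemma measurable_mu: "f \<in> borel_measurable borel \<Longrightarrow> f \<in> borel_measurable \<mu>"
  unfolding \<mu>_def by (rule mat_beta_II_measurable)

lemma minor_moment:
  assumes "I \<noteq> {}" "t \<ge> 0" and b: "b = q2 - (real CARD('n) - real (card I)) / 2" "b - t > (real (card I) - 1) / 2"
  shows "(\<integral>\<^sup>+X. ennreal (det (emb I X) powr t) \<partial>\<mu>) = ennreal (mv_Beta (card I) (q1 + t) (b - t) / mv_Beta (card I) q1 b)"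
proof -
  have B: "mv_Beta CARD('n) q1 q2 > 0" using q1 q2_gt by (intro mv_Beta_pos) auto
  have m: "(\<lambda>X. ennreal (det (emb I X) powr t)) \<in> borel_measurable borel" by measurable
  have "(\<integral>\<^sup>+X. ennreal (det (emb I X) powr t) \<partial>\<mu>) = ennreal (1 / mv_Beta CARD('n) q1 q2) *
     (\<integral>\<^sup>+x. ennreal (det (block I x) powr t) * beta_kernel UNIV q1 q2 x \<partial>block_lborel UNIV)"
    unfolding \<mu>_def nn_integral_mat_beta_II_mat_1[OF m q1 q2_gt] block_def ..
  also have "\<dots> = ennreal (1 / mv_Beta CARD('n) q1 q2) *
      ennreal (mv_Beta CARD('n) q1 q2 * (mv_Beta (card I) (q1 + t) (b - t) / mv_Beta (card I) q1 b))"
    using beta_kernel_minor_moment[of q1 q2 I t] q1 q2_gt assms by simp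
  also have "\<dots> = ennreal (mv_Beta (card I) (q1 + t) (b - t) / mv_Beta (card I) q1 b)"
    using B by (subst ennreal_mult'[symmetric]) auto
  finally show ?thesis .
qed

lemma q1_pos: "q1 > 0"
proof -
  have "0 \<le> (real CARD('n) - 1) / 2" using dim_pos by simp
  then show ?thesis using q1 by (rule le_less_trans)
qed

lemma diagonal_second_moment: "has_bochner_integral \<mu> (\<lambda>X. (X $ i $ i)\<^sup>2) (diag_moment q1 q)"
proof (rule has_bochner_integral_nn_integral)
  show "(\<lambda>X. (X $ i $ i)\<^sup>2) \<in> borel_measurable \<mu>" by (rule measurable_mu) measurable
  show "0 \<le> diag_moment q1 q" using q1_pos q_gt_3 by (simp add: diag_moment_def)
  let ?b = "q2 - (real CARD('n) - 1) / 2"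
  have b: "?b = (q + 1) / 2" by (simp add: q_def field_simps)
  have "(\<integral>\<^sup>+X. ennreal ((X $ i $ i)\<^sup>2) \<partial>\<mu>) = (\<integral>\<^sup>+X. ennreal (det (emb {i} X) powr 2) \<partial>\<mu>)"
  proof (rule nn_integral_cong)
    fix X assume "X \<in> space \<mu>"
    then have X: "X \<in> spd" by (simp add: space_mu)
    have "det (emb {i} X) = X $ i $ i" by (rule det_emb_singleton[OF spd_symmetric[OF X]])
    moreover have "det (emb {i} X) > 0" by (rule spd_det_pos[OF spd_emb[OF X]])
    ultimately show "ennreal ((X $ i $ i)\<^sup>2) = ennreal (det (emb {i} X) powr 2)" by simp
  qed
  also have "\<dots> = ennreal (mv_Beta 1 (q1 + 2) (?b - 2) / mv_Beta 1 q1 ?b)"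
  proof -
    have h: "?b - 2 > (real (card {i}) - 1) / 2" unfolding b using q_gt_3 by simp
    show ?thesis using minor_moment[of "{i}" 2 ?b, OF _ _ _ h] by simp
  qed
  also have "mv_Beta 1 (q1 + 2) (?b - 2) / mv_Beta 1 q1 ?b = q1 * (q1 + 1) / ((?b - 1) * (?b - 2))"
    using q_gt_3 q1_pos by (intro mv_Beta_ratio_1) (simp_all add: b)
  also have "\<dots> = diag_moment q1 q" unfolding b diag_moment_def
    using q_gt_3 by (simp add: field_simps)
  finally show "(\<integral>\<^sup>+X. ennreal ((X $ i $ i)\<^sup>2) \<partial>\<mu>) = ennreal (diag_moment q1 q)" .
qed simp

lemma pair_minor_moment:
  assumes ij: "i \<noteq> j"
  shows "has_bochner_integral \<mu> (\<lambda>X. X $ i $ i * X $ j $ j - (X $ i $ j)\<^sup>2) (2 * q1 * (2 * q1 - 1) / (q * (q - 1)))"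
proof -
  let ?b = "q2 - (real CARD('n) - 2) / 2"
  let ?M = "\<lambda>X. X $ i $ i * X $ j $ j - (X $ i $ j)\<^sup>2"
  let ?e = "2 * q1 * (2 * q1 - 1) / (q * (q - 1))"
  have b: "?b = (q + 2) / 2" by (simp add: q_def field_simps)
  have c: "card {i, j} = 2" using ij by simp
  have "card {i, j} \<le> CARD('n)" by (rule card_mono) auto
  then have d2: "real CARD('n) \<ge> 2" using c by linarith
  then have "1 / 2 \<le> (real CARD('n) - 1) / 2" by simp
  then have q12: "q1 > 1 / 2" using q1 by (rule le_less_trans)
  have pos: "?M X = det (emb {i, j} X)" "det (emb {i, j} X) > 0"
    if "X \<in> space \<mu>" for X
  proof -
    have X: "X \<in> spd" using that by (simp add: space_mu)
    show "?M X = det (emb {i, j} X)" by (rule det_emb_pair[OF X ij, symmetric])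
    show "det (emb {i, j} X) > 0" by (rule spd_det_pos[OF spd_emb[OF X]])
  qed
  show ?thesis
  proof (rule has_bochner_integral_nn_integral)
    show "(\<lambda>X. ?M X) \<in> borel_measurable \<mu>" by (rule measurable_mu) measurable
    show "AE X in \<mu>. 0 \<le> ?M X"
      using pos by (intro AE_I2) (simp add: less_imp_le)
    show "0 \<le> ?e" using q12 q_gt_3 by simp
    have "(\<integral>\<^sup>+X. ennreal (?M X) \<partial>\<mu>) = (\<integral>\<^sup>+X. ennreal (det (emb {i, j} X) powr 1) \<partial>\<mu>)"
      using pos by (intro nn_integral_cong) (simp add: abs_of_pos)
    also have "\<dots> = ennreal (mv_Beta 2 (q1 + 1) (?b - 1) / mv_Beta 2 q1 ?b)"
    proof -
      have h: "?b - 1 > (real (card {i, j}) - 1) / 2" unfolding b c using q_gt_3 by simp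
      show ?thesis using minor_moment[of "{i, j}" 1 ?b, OF _ _ _ h] c by simp
    qed
    also have "mv_Beta 2 (q1 + 1) (?b - 1) / mv_Beta 2 q1 ?b = q1 * (q1 - 1 / 2) / ((?b - 1) * (?b - 3 / 2))"
      using q_gt_3 q12 by (intro mv_Beta_ratio_2) (simp_all add: b)
    also have "\<dots> = ?e" unfolding b
      using q_gt_3 by (simp add: field_simps)
    finally show "(\<integral>\<^sup>+X. ennreal (?M X) \<partial>\<mu>)
      = ennreal ?e" .
  qed
qed

lemma congruence_nth: "(Q ** X ** transpose Q) $ i $ j = Q $ i \<bullet> (X *v (Q $ j))" for Q X :: "real^'m^'m"
proof -
  have "(Q ** X ** transpose Q) $ i $ j = (\<Sum>l\<in>UNIV. (\<Sum>k\<in>UNIV. Q $ i $ k * X $ k $ l) * Q $ j $ l)"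
    by (simp add: matrix_matrix_mult_def transpose_def)
  also have "\<dots> = (\<Sum>k\<in>UNIV. \<Sum>l\<in>UNIV. Q $ i $ k * X $ k $ l * Q $ j $ l)"
    unfolding sum_distrib_right by (rule sum.swap)
  also have "\<dots> = Q $ i \<bullet> (X *v (Q $ j))"
    by (simp add: inner_vec_def matrix_vector_mult_def sum_distrib_left mult.assoc)
  finally show ?thesis .
qed

text \<open>Rotating by an angle of \<open>\<pi>/4\<close> in the \<open>(i, j)\<close> plane turns the off-diagonal entry into half the
  difference of the two diagonal ones.\<close>

lemma rotation_quarter_pi:
  assumes ij: "i \<noteq> (j :: 'm::finite)"
  obtains Q :: "real^'m^'m" where "orthogonal_matrix Q"
    "\<And>X. transpose X = X \<Longrightarrow> (Q ** X ** transpose Q) $ i $ j = (X $ i $ i - X $ j $ j) / 2"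
proof -
  define r where "r = 1 / sqrt 2"
  have r: "r * r = 1 / 2" by (simp add: r_def)
  define Q :: "real^'m^'m" where "Q = (\<chi> k. if k = i then r *\<^sub>R (axis i 1 + axis j 1)
      else if k = j then r *\<^sub>R (axis i 1 - axis j 1) else axis k 1)"
  have row: "row k Q = Q $ k" for k by (simp add: row_def vec_eq_iff)
  have inner: "Q $ k \<bullet> Q $ l = (if k = l then 1 else 0)" for k l
    using ij r by (auto simp: Q_def inner_axis_axis inner_add_left inner_add_right inner_diff_left inner_diff_right)
  have "orthogonal_matrix Q"
    unfolding orthogonal_matrix_orthonormal_rows row orthogonal_def norm_eq_1 inner by simp
  moreover have "(Q ** X ** transpose Q) $ i $ j = (X $ i $ i - X $ j $ j) / 2" if X: "transpose X = X" for X
  proof -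
    have Xij: "X $ i $ j = X $ j $ i" using arg_cong[OF X, of "\<lambda>M. M $ j $ i"] by (simp add: transpose_def)
    have "(Q ** X ** transpose Q) $ i $ j = (r * r) * ((axis i 1 + axis j 1) \<bullet> (X *v (axis i 1 - axis j 1)))"
      unfolding congruence_nth using ij by (simp add: Q_def matrix_vector_mult_scaleR)
    also have "(axis i 1 + axis j 1) \<bullet> (X *v (axis i 1 - axis j 1)) = X $ i $ i - X $ j $ j"
      by (simp add: matrix_vector_mult_diff_distrib matrix_vector_mult_basis inner_axis' inner_add_left
          inner_diff_right column_def Xij)
    finally show ?thesis by (simp add: r)
  qed
  ultimately show thesis using that by blast
qed

text \<open>By the rotation, the mean of \<open>X\<^sub>i\<^sub>j\<^sup>2\<close> is that of \<open>(X\<^sub>i\<^sub>i - X\<^sub>j\<^sub>j)\<^sup>2 / 4\<close>, and its difference from the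
  mean of \<open>X\<^sub>i\<^sub>i X\<^sub>j\<^sub>j\<close> is a known minor moment: two linear equations for two unknown means.\<close>

lemma offdiagonal_second_moment:
  assumes ij: "i \<noteq> j"
  shows "has_bochner_integral \<mu> (\<lambda>X. (X $ i $ j)\<^sup>2) (offdiag_moment q1 q)"
proof -
  let ?e = "2 * q1 * (2 * q1 - 1) / (q * (q - 1))"
  have mm: "(\<lambda>X. X $ k $ l) \<in> borel_measurable \<mu>" for k l by (rule measurable_mu) measurable
  note [measurable] = mm
  note D = diagonal_second_moment
  note E = pair_minor_moment[OF ij]
  have iP: "integrable \<mu> (\<lambda>X. X $ i $ i * X $ j $ j)"
  proof (rule Bochner_Integration.integrable_bound)
    show "integrable \<mu> (\<lambda>X. (X $ i $ i)\<^sup>2 + (X $ j $ j)\<^sup>2)"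
      using D[of i] D[of j] by (auto intro!: integrable_add integrable.intros)
    have "\<bar>x * y\<bar> \<le> x\<^sup>2 + y\<^sup>2" for x y :: real
      using sum_squares_ge_zero[of "\<bar>x\<bar> - \<bar>y\<bar>" 0] sum_squares_ge_zero[of x y]
      by (simp add: power2_eq_square algebra_simps abs_mult[symmetric])
    then show "AE X in \<mu>. norm (X $ i $ i * X $ j $ j) \<le> norm ((X $ i $ i)\<^sup>2 + (X $ j $ j)\<^sup>2)"
      by (simp add: abs_of_nonneg)
  qed measurable
  define p where "p = (\<integral>X. X $ i $ i * X $ j $ j \<partial>\<mu>)"
  have P: "has_bochner_integral \<mu> (\<lambda>X. X $ i $ i * X $ j $ j) p"
    unfolding p_def using iP by (rule has_bochner_integral_integrable)
  have c: "has_bochner_integral \<mu> (\<lambda>X. (X $ i $ j)\<^sup>2) (p - ?e)"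
    using has_bochner_integral_diff[OF P E] by simp
  have d: "has_bochner_integral \<mu> (\<lambda>X. ((X $ i $ i - X $ j $ j) / 2)\<^sup>2) ((diag_moment q1 q + diag_moment q1 q - 2 * p) / 4)"
  proof -
    have sq: "((x - y) / 2)\<^sup>2 = (x\<^sup>2 + y\<^sup>2 - 2 * (x * y)) / 4" for x y :: real
      by (simp add: power2_eq_square field_simps)
    show ?thesis unfolding sq
      using has_bochner_integral_divide_zero[OF has_bochner_integral_diff[OF has_bochner_integral_add[OF D[of i] D[of j]]
        has_bochner_integral_mult_right[OF P, of 2]], of 4]
      by simp
  qed
  have nn: "(\<integral>\<^sup>+X. ennreal (f X) \<partial>\<mu>) = ennreal x \<and> 0 \<le> x"
    if "has_bochner_integral \<mu> f x" "\<And>X. 0 \<le> f X" for f x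
    using that nn_integral_eq_integral[of \<mu> f] by (auto simp: has_bochner_integral_iff intro!: integral_nonneg_AE)
  obtain Q :: "'n::{finite,linorder} sqmat" where Q: "orthogonal_matrix Q"
    "\<And>X. transpose X = X \<Longrightarrow> (Q ** X ** transpose Q) $ i $ j = (X $ i $ i - X $ j $ j) / 2"
    using rotation_quarter_pi[OF ij] by blast
  have m: "(\<lambda>X::'n::{finite,linorder} sqmat. ennreal ((X $ i $ j)\<^sup>2)) \<in> borel_measurable borel" by measurable
  have "(\<integral>\<^sup>+X. ennreal ((X $ i $ j)\<^sup>2) \<partial>\<mu>) = (\<integral>\<^sup>+X. ennreal (((Q ** X ** transpose Q) $ i $ j)\<^sup>2) \<partial>\<mu>)"
    unfolding \<mu>_def by (rule nn_integral_mat_beta_II_orthogonal[OF m Q(1) q1 q2_gt])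
  also have "\<dots> = (\<integral>\<^sup>+X. ennreal (((X $ i $ i - X $ j $ j) / 2)\<^sup>2) \<partial>\<mu>)"
    by (rule nn_integral_cong) (simp add: space_mu Q(2) spd_symmetric)
  finally have rel: "p - ?e = (diag_moment q1 q + diag_moment q1 q - 2 * p) / 4"
    using nn[OF c] nn[OF d] by simp
  have "y - e = (x - e) / 3" if "y - e = (x + x - 2 * y) / 4" for x y e :: real
    using that by (simp add: field_simps)
  from this[OF rel] have "p - ?e = (diag_moment q1 q - ?e) / 3" .
  also have "\<dots> = offdiag_moment q1 q"
  proof -
    have 1: "diag_moment q1 q * ((q - 1) * (q - 3)) = 4 * q1 * (q1 + 1)" and 2: "?e * (q * (q - 1)) = 2 * q1 * (2 * q1 - 1)"
      and D: "q * (q - 1) * (q - 3) \<noteq> 0"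
      using q_gt_3 by (simp_all add: diag_moment_def)
    have "(x - e) * (q * (q - 1) * (q - 3)) = q * (x * ((q - 1) * (q - 3))) - (q - 3) * (e * (q * (q - 1)))" for x e :: real
      by (simp add: algebra_simps)
    then have "(diag_moment q1 q - ?e) * (q * (q - 1) * (q - 3)) = q * (4 * q1 * (q1 + 1)) - (q - 3) * (2 * q1 * (2 * q1 - 1))"
      by (simp only: 1 2)
    also have "\<dots> = 3 * (2 * q1 * (2 * q1 + q - 1))" by (simp add: algebra_simps)
    finally have "diag_moment q1 q - ?e = 3 * (2 * q1 * (2 * q1 + q - 1)) / (q * (q - 1) * (q - 3))"
      using D by (simp only: nonzero_eq_divide_eq[OF D])
    moreover have "3 * n / m / 3 = n / m" for n m :: real by simp
    ultimately show ?thesis unfolding offdiag_moment_def by (simp only:)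
  qed
  finally show ?thesis using c by simp
qed

lemma moment_weights: "diag_moment q1 q - offdiag_moment q1 q = 2 * q1 * (2 * q1 * q - 2 * q1 + q + 1) / (q * (q - 1) * (q - 3))"
proof -
  have 1: "diag_moment q1 q * ((q - 1) * (q - 3)) = 4 * q1 * (q1 + 1)"
    and 2: "offdiag_moment q1 q * (q * (q - 1) * (q - 3)) = 2 * q1 * (2 * q1 + q - 1)"
    and D: "q * (q - 1) * (q - 3) \<noteq> 0"
    using q_gt_3 by (simp_all add: diag_moment_def offdiag_moment_def)
  have "(x - e) * (q * (q - 1) * (q - 3)) = q * (x * ((q - 1) * (q - 3))) - e * (q * (q - 1) * (q - 3))" for x e :: real
    by (simp add: algebra_simps)
  then have "(diag_moment q1 q - offdiag_moment q1 q) * (q * (q - 1) * (q - 3)) = q * (4 * q1 * (q1 + 1)) - 2 * q1 * (2 * q1 + q - 1)"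
    by (simp only: 1 2)
  also have "\<dots> = 2 * q1 * (2 * q1 * q - 2 * q1 + q + 1)" by (simp add: algebra_simps)
  finally show ?thesis using D by (simp only: nonzero_eq_divide_eq[OF D])
qed

lemma trace_diag_sandwich: "trace (X ** diag_mat d ** X ** diag_mat d) = (\<Sum>i\<in>UNIV. \<Sum>j\<in>UNIV. d i * d j * (X $ i $ j)\<^sup>2)"
  if X: "transpose X = X" for X :: "real^'m^'m"
proof -
  have Xij: "X $ j $ i = X $ i $ j" for i j using arg_cong[OF X, of "\<lambda>M. M $ i $ j"] by (simp add: transpose_def)
  have "(X ** diag_mat d) $ i $ j = X $ i $ j * d j" for i j
    by (simp add: matrix_matrix_mult_def diag_mat_def if_distrib[of "\<lambda>u. _ * u"] cong: if_cong)
  then have "((X ** diag_mat d) ** (X ** diag_mat d)) $ i $ i = (\<Sum>j\<in>UNIV. d i * d j * (X $ i $ j)\<^sup>2)" for i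
    by (simp add: matrix_matrix_mult_def[of "X ** diag_mat d"] Xij[of _ i] power2_eq_square mult_ac)
  then show ?thesis by (simp add: trace_def matrix_mul_assoc)
qed

lemma trace_orthogonal: "orthogonal_matrix Q \<Longrightarrow> trace (Q ** X ** transpose Q) = trace X" for Q X :: "real^'m^'m"
  by (metis matrix_mul_assoc matrix_mul_lid orthogonal_matrix_def trace_mul_sym)

text \<open>By orthogonal invariance \<open>M\<close> may be taken diagonal, and then the trace is a combination of squares of
  single entries.\<close>

lemma trace_sandwich_moment:
  assumes M: "M \<in> spd"
  shows "(\<integral>\<^sup>+X. ennreal (trace (X ** M ** X ** M)) \<partial>\<mu>) =
    ennreal ((diag_moment q1 q - offdiag_moment q1 q) * trace (M ** M) + offdiag_moment q1 q * (trace M)\<^sup>2)"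
proof -
  obtain Q d where Q: "orthogonal_matrix Q" and d: "\<And>i. d i > 0" and MQ: "M = Q ** diag_mat d ** transpose Q"
    using spd_spectral[OF M] by metis
  let ?D = "diag_mat d"
  let ?w = "\<lambda>i j. if i = j then diag_moment q1 q else offdiag_moment q1 q"
  have QQ: "transpose Q ** Q = mat 1" using Q by (simp add: orthogonal_matrix_def)
  have m: "(\<lambda>X. ennreal (trace (X ** M ** X ** M))) \<in> borel_measurable borel"
    by (intro measurable_compose[OF trace_sandwich_measurable measurable_ennreal])
  have eq: "trace ((Q ** X ** transpose Q) ** M ** (Q ** X ** transpose Q) ** M) = trace (X ** ?D ** X ** ?D)" for X
  proof -
    have "(Q ** X ** transpose Q) ** M ** (Q ** X ** transpose Q) ** M
      = Q ** (X ** (transpose Q ** Q) ** ?D ** (transpose Q ** Q) ** X ** (transpose Q ** Q) ** ?D) ** transpose Q"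
      by (simp only: MQ matrix_mul_assoc)
    then show ?thesis by (simp only: QQ matrix_mul_rid trace_orthogonal[OF Q])
  qed
  have ent: "(\<integral>\<^sup>+X. ennreal ((X $ i $ j)\<^sup>2) \<partial>\<mu>) = ennreal (?w i j)" for i j
  proof -
    have "has_bochner_integral \<mu> (\<lambda>X. (X $ i $ j)\<^sup>2) (?w i j)"
      using diagonal_second_moment offdiagonal_second_moment by simp
    then show ?thesis using nn_integral_eq_integral[of \<mu> "\<lambda>X. (X $ i $ j)\<^sup>2"]
      by (simp add: has_bochner_integral_iff)
  qed
  have pos: "diag_moment q1 q \<ge> 0" "offdiag_moment q1 q \<ge> 0"
    using q1_pos q_gt_3 by (simp_all add: diag_moment_def offdiag_moment_def)
  have [measurable]: "(\<lambda>X. X $ k $ l) \<in> borel_measurable \<mu>" for k l by (rule measurable_mu) measurable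
  have "(\<integral>\<^sup>+X. ennreal (trace (X ** M ** X ** M)) \<partial>\<mu>) = (\<integral>\<^sup>+X. ennreal (trace (X ** ?D ** X ** ?D)) \<partial>\<mu>)"
    unfolding \<mu>_def eq[symmetric] by (rule nn_integral_mat_beta_II_orthogonal[OF m Q q1 q2_gt])
  also have "\<dots> = (\<integral>\<^sup>+X. (\<Sum>i\<in>UNIV. \<Sum>j\<in>UNIV. ennreal (d i * d j) * ennreal ((X $ i $ j)\<^sup>2)) \<partial>\<mu>)"
  proof (rule nn_integral_cong)
    fix X assume "X \<in> space \<mu>"
    then have X: "transpose X = X" by (simp add: space_mu spd_symmetric)
    have dd: "0 \<le> d i * d j" for i j using d[of i] d[of j] by simp
    show "ennreal (trace (X ** ?D ** X ** ?D)) = (\<Sum>i\<in>UNIV. \<Sum>j\<in>UNIV. ennreal (d i * d j) * ennreal ((X $ i $ j)\<^sup>2))"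
      unfolding trace_diag_sandwich[OF X] using dd
      by (simp add: ennreal_mult'[symmetric] sum_ennreal sum_nonneg)
  qed
  also have "\<dots> = (\<Sum>i\<in>UNIV. \<Sum>j\<in>UNIV. ennreal (d i * d j) * ennreal (?w i j))"
    by (simp add: nn_integral_sum nn_integral_cmult ent)
  also have "\<dots> = ennreal (\<Sum>i\<in>UNIV. \<Sum>j\<in>UNIV. d i * d j * (?w i j))"
  proof -
    have dd: "0 \<le> d i * d j" for i j using d[of i] d[of j] by simp
    have "0 \<le> d i * d j * (?w i j)" for i j using dd[of i j] pos by simp
    then show ?thesis using dd by (simp add: ennreal_mult'[symmetric] sum_ennreal sum_nonneg)
  qed
  also have "(\<Sum>i\<in>UNIV. \<Sum>j\<in>UNIV. d i * d j * (?w i j))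
     = (diag_moment q1 q - offdiag_moment q1 q) * (\<Sum>i\<in>UNIV. (d i)\<^sup>2) + offdiag_moment q1 q * (\<Sum>i\<in>UNIV. d i)\<^sup>2"
  proof -
    have "d i * d j * (?w i j)
       = (if i = j then (diag_moment q1 q - offdiag_moment q1 q) * (d i)\<^sup>2 else 0) + offdiag_moment q1 q * (d i * d j)" for i j
      by (simp add: power2_eq_square algebra_simps)
    then show ?thesis
      by (simp add: sum.distrib sum_distrib_left[symmetric] power2_eq_square sum_product)
  qed
  also have "(\<Sum>i\<in>UNIV. d i) = trace M" unfolding MQ trace_orthogonal[OF Q] by (simp add: trace_def diag_mat_def)
  also have "(\<Sum>i\<in>UNIV. (d i)\<^sup>2) = trace (M ** M)"
  proof -
    have "M ** M = Q ** (?D ** (transpose Q ** Q) ** ?D) ** transpose Q" by (simp only: MQ matrix_mul_assoc)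
    then show ?thesis
      by (simp only: QQ matrix_mul_rid trace_orthogonal[OF Q] diag_mat_mult) (simp add: trace_def diag_mat_def power2_eq_square)
  qed
  finally show ?thesis .
qed

end

section \<open>Quadratic transport along positive self-adjoint maps\<close>

lemma transport_mapsD:
  assumes "T \<in> transport_maps M N"
  shows "T \<in> measurable M N" "distr M N T = N"
  using assms by (auto simp: transport_maps_def)

lemma graph_plan:
  assumes "prob_space M" and T: "T \<in> transport_maps M N"
  shows "distr M (M \<Otimes>\<^sub>M N) (\<lambda>x. (x, T x)) \<in> transport_plans M N"
proof -
  note [measurable] = transport_mapsD(1)[OF T]
  interpret prob_space M by fact
  show ?thesis
    unfolding transport_plans_def
  proof (safe)
    show "prob_space (distr M (M \<Otimes>\<^sub>M N) (\<lambda>x. (x, T x)))" by (rule prob_space_distr) measurable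
    show "distr (distr M (M \<Otimes>\<^sub>M N) (\<lambda>x. (x, T x))) M fst = M"
      by (simp add: distr_distr o_def)
    show "distr (distr M (M \<Otimes>\<^sub>M N) (\<lambda>x. (x, T x))) N snd = N"
      by (simp add: distr_distr o_def transport_mapsD(2)[OF T])
  qed simp_all
qed

text \<open>The transport map is \<open>L = K \<circ> K\<close> with \<open>K\<close> self-adjoint and \<open>K'\<close> its inverse. The first two
  summands of the decomposed cost depend on one marginal each, so they integrate to the same number
  under every plan; the remaining one, the residual, vanishes exactly on the graph of \<open>L\<close>.\<close>

context
  fixes M N :: "'a::euclidean_space measure" and U V :: "'a set" and K K' :: "'a \<Rightarrow> 'a"
  assumes prob_M: "prob_space M" and prob_N: "prob_space N"
    and sets_M: "sets M = sets (restrict_space borel U)"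
    and sets_N: "sets N = sets (restrict_space borel V)"
    and int_M: "integrable M (\<lambda>x. (norm x)\<^sup>2)" and int_N: "integrable N (\<lambda>x. (norm x)\<^sup>2)"
    and K: "linear K" "\<And>x y. K x \<bullet> y = x \<bullet> K y" and K': "linear K'" "\<And>x y. K' x \<bullet> y = x \<bullet> K' y"
    and inv: "\<And>x. K (K' x) = x" "\<And>x. K' (K x) = x"
    and T: "(\<lambda>x. K (K x)) \<in> transport_maps M N"
begin

definition residual :: "'a \<times> 'a \<Rightarrow> real" where
  "residual p = (norm (K (fst p) - K' (snd p)))\<^sup>2"

lemma residual_nonneg: "0 \<le> residual p"
  by (simp add: residual_def)

definition potential_sum :: real where
  "potential_sum = (\<integral>x. (norm x)\<^sup>2 - (norm (K x))\<^sup>2 \<partial>M) + (\<integral>y. (norm y)\<^sup>2 - (norm (K' y))\<^sup>2 \<partial>N)"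

text \<open>The mixed term of the residual is \<open>K x \<bullet> K' y = x \<bullet> y\<close>, by self-adjointness.\<close>

lemma cost_decomposition:
  "(norm (x - y))\<^sup>2 =
     ((norm x)\<^sup>2 - (norm (K x))\<^sup>2) + ((norm y)\<^sup>2 - (norm (K' y))\<^sup>2) + residual (x, y)"
proof -
  have "K x \<bullet> K' y = x \<bullet> y" by (simp add: K(2) inv)
  then show ?thesis
    by (simp add: residual_def power2_norm_eq_inner inner_diff inner_commute algebra_simps)
qed

lemma measurable_M_N [measurable]:
  "(\<lambda>x. x) \<in> borel_measurable M" "(\<lambda>x. x) \<in> borel_measurable N"
  "K \<in> borel_measurable borel" "K' \<in> borel_measurable borel"
proof -
  show "(\<lambda>x. x) \<in> borel_measurable M" "(\<lambda>x. x) \<in> borel_measurable N"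
    by (subst measurable_cong_sets[OF sets_M refl], rule measurable_restrict_space1, simp)
       (subst measurable_cong_sets[OF sets_N refl], rule measurable_restrict_space1, simp)
  show "K \<in> borel_measurable borel" "K' \<in> borel_measurable borel"
    using K K' by (auto intro!: borel_measurable_continuous_onI linear_continuous_on simp: linear_linear)
qed

lemma integrable_norm_linear:
  assumes R: "sets R = sets (restrict_space borel W)" "integrable R (\<lambda>x. (norm x)\<^sup>2)" and F: "linear F"
  shows "integrable R (\<lambda>x. (norm (F (x::'a) :: 'a))\<^sup>2)"
proof -
  obtain B where B: "B > 0" "\<And>x. norm (F x) \<le> B * norm x" using linear_bounded_pos[OF F] by blast
  have [measurable]: "F \<in> borel_measurable borel"
    using F by (auto intro!: borel_measurable_continuous_onI linear_continuous_on simp: linear_linear)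
  have [measurable]: "(\<lambda>x. x) \<in> borel_measurable R"
    by (subst measurable_cong_sets[OF R(1) refl], rule measurable_restrict_space1, simp)
  show ?thesis
  proof (rule Bochner_Integration.integrable_bound)
    show "integrable R (\<lambda>x. B\<^sup>2 * (norm x)\<^sup>2)" using R(2) by simp
    show "(\<lambda>x. (norm (F x))\<^sup>2) \<in> borel_measurable R" by measurable
    show "AE x in R. norm ((norm (F x))\<^sup>2) \<le> norm (B\<^sup>2 * (norm x)\<^sup>2)"
      using B by (auto simp: power_mult_distrib[symmetric] intro!: power_mono)
  qed
qed

lemma plan_cost:
  assumes G: "G \<in> transport_plans M N"
  shows "integrable G residual"
    and "(\<integral>\<^sup>+(x, y). ennreal ((norm (x - y))\<^sup>2) \<partial>G) = ennreal (potential_sum + (\<integral>p. residual p \<partial>G))"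
    and "0 \<le> potential_sum + (\<integral>p. residual p \<partial>G)"
proof -
  have sets_G: "sets G = sets (M \<Otimes>\<^sub>M N)" and marg: "distr G M fst = M" "distr G N snd = N"
    using G by (auto simp: transport_plans_def)
  have m[measurable]: "fst \<in> measurable G M" "snd \<in> measurable G N"
    unfolding measurable_cong_sets[OF sets_G refl] by measurable
  have mb[measurable]: "fst \<in> borel_measurable G" "snd \<in> borel_measurable G"
    using measurable_comp[OF m(1) measurable_M_N(1)] measurable_comp[OF m(2) measurable_M_N(2)]
    by (simp_all add: comp_def)
  have pull_M: "integrable G (\<lambda>p. f (fst p)) \<and> (\<integral>p. f (fst p) \<partial>G) = (\<integral>x. f x \<partial>M)"
    if "integrable M f" for f :: "'a \<Rightarrow> real"
    using that integrable_distr_eq[OF m(1), of f] integral_distr[OF m(1), of f] marg(1)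
    by (metis borel_measurable_integrable)
  have pull_N: "integrable G (\<lambda>p. f (snd p)) \<and> (\<integral>p. f (snd p) \<partial>G) = (\<integral>x. f x \<partial>N)"
    if "integrable N f" for f :: "'a \<Rightarrow> real"
    using that integrable_distr_eq[OF m(2), of f] integral_distr[OF m(2), of f] marg(2)
    by (metis borel_measurable_integrable)
  have iM: "integrable M (\<lambda>x. (norm x)\<^sup>2 - (norm (K x))\<^sup>2)"
    using integrable_norm_linear[OF sets_M int_M K(1)] int_M by simp
  have iN: "integrable N (\<lambda>x. (norm x)\<^sup>2 - (norm (K' x))\<^sup>2)"
    using integrable_norm_linear[OF sets_N int_N K'(1)] int_N by simp
  have ires: "integrable G residual"
  proof (rule Bochner_Integration.integrable_bound)
    show "integrable G (\<lambda>p. 2 * (norm (K (fst p)))\<^sup>2 + 2 * (norm (K' (snd p)))\<^sup>2)"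
      using pull_M[OF integrable_norm_linear[OF sets_M int_M K(1)]]
        pull_N[OF integrable_norm_linear[OF sets_N int_N K'(1)]] by auto
    show "residual \<in> borel_measurable G" unfolding residual_def[abs_def] by measurable
    have "(norm (a - b))\<^sup>2 \<le> 2 * (norm a)\<^sup>2 + 2 * (norm b)\<^sup>2" for a b :: 'a
    proof -
      have "0 \<le> (norm (a + b))\<^sup>2" by simp
      then show ?thesis by (simp add: power2_norm_eq_inner inner_diff inner_add inner_commute algebra_simps)
    qed
    then show "AE p in G. norm (residual p) \<le> norm (2 * (norm (K (fst p)))\<^sup>2 + 2 * (norm (K' (snd p)))\<^sup>2)"
      by (auto simp: residual_def)
  qed
  then show "integrable G residual" .
  have eq: "(norm (fst p - snd p))\<^sup>2 = ((norm (fst p))\<^sup>2 - (norm (K (fst p)))\<^sup>2)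
      + ((norm (snd p))\<^sup>2 - (norm (K' (snd p)))\<^sup>2) + residual p" for p
    using cost_decomposition[of "fst p" "snd p"] by simp
  have icost: "integrable G (\<lambda>p. (norm (fst p - snd p))\<^sup>2)"
    unfolding eq using pull_M[OF iM] pull_N[OF iN] ires by auto
  have cost: "(\<integral>p. (norm (fst p - snd p))\<^sup>2 \<partial>G) = potential_sum + (\<integral>p. residual p \<partial>G)"
    unfolding eq potential_sum_def using pull_M[OF iM] pull_N[OF iN] ires by simp
  show "(\<integral>\<^sup>+(x, y). ennreal ((norm (x - y))\<^sup>2) \<partial>G) = ennreal (potential_sum + (\<integral>p. residual p \<partial>G))"
    using nn_integral_eq_integral[OF icost] by (simp add: cost case_prod_unfold)
  show "0 \<le> potential_sum + (\<integral>p. residual p \<partial>G)"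
    unfolding cost[symmetric] by (rule integral_nonneg_AE) simp
qed

lemma residual_eq_0_iff: "residual p = 0 \<longleftrightarrow> snd p = K (K (fst p))"
  unfolding residual_def using inv by (auto simp: K(1) linear_diff)

abbreviation (input) sq_cost :: "'a \<Rightarrow> 'a \<Rightarrow> ennreal" where
  "sq_cost \<equiv> \<lambda>x y. ennreal ((norm (x - y))\<^sup>2)"

abbreviation (input) graph :: "('a \<Rightarrow> 'a) \<Rightarrow> ('a \<times> 'a) measure" where
  "graph F \<equiv> distr M (M \<Otimes>\<^sub>M N) (\<lambda>x. (x, F x))"

lemma measurable_marginals [measurable]:
  "fst \<in> borel_measurable (M \<Otimes>\<^sub>M N)" "snd \<in> borel_measurable (M \<Otimes>\<^sub>M N)"
  using measurable_comp[OF measurable_fst measurable_M_N(1)]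
    measurable_comp[OF measurable_snd measurable_M_N(2)]
  by (simp_all add: comp_def)

lemma graph_cost:
  assumes "F \<in> transport_maps M N"
  shows "(\<integral>\<^sup>+(x, y). sq_cost x y \<partial>graph F) = (\<integral>\<^sup>+x. sq_cost x (F x) \<partial>M)"
proof -
  have [measurable]: "F \<in> measurable M N" using transport_mapsD[OF assms] by simp
  show ?thesis by (subst nn_integral_distr) (simp_all add: case_prod_unfold)
qed

lemma graph_residual: "(\<integral>p. residual p \<partial>graph (\<lambda>x. K (K x))) = 0"
proof -
  have [measurable]: "(\<lambda>x. K (K x)) \<in> measurable M N" using transport_mapsD[OF T] by simp
  have [measurable]: "residual \<in> borel_measurable (M \<Otimes>\<^sub>M N)"
    unfolding residual_def[abs_def] by measurable
  have 0: "residual (x, K (K x)) = 0" for x by (simp add: residual_eq_0_iff)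
  show ?thesis by (subst integral_distr) (simp_all add: 0)
qed

lemma kantorovich_eq: "kantorovich sq_cost M N = ennreal potential_sum"
  and optimal_graph: "optimal_plan sq_cost M N (graph (\<lambda>x. K (K x)))"
  and potential_sum_nonneg: "0 \<le> potential_sum"
proof -
  have P: "graph (\<lambda>x. K (K x)) \<in> transport_plans M N" by (rule graph_plan[OF prob_M T])
  have c: "(\<integral>\<^sup>+(x, y). sq_cost x y \<partial>graph (\<lambda>x. K (K x))) = ennreal potential_sum"
    using plan_cost(2)[OF P] by (simp only: graph_residual add_0_right)
  have "ennreal potential_sum \<le> (\<integral>\<^sup>+(x, y). sq_cost x y \<partial>G)" if "G \<in> transport_plans M N" for G
  proof -
    have "0 \<le> (\<integral>p. residual p \<partial>G)" by (rule integral_nonneg_AE) (simp add: residual_def)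
    then show ?thesis unfolding plan_cost(2)[OF that] by (intro ennreal_leI) simp
  qed
  then show k: "kantorovich sq_cost M N = ennreal potential_sum"
    unfolding kantorovich_def
    by (intro antisym INF_greatest INF_lower2[OF P]) (simp_all only: c order.refl)
  show "optimal_plan sq_cost M N (graph (\<lambda>x. K (K x)))"
    unfolding optimal_plan_def k using P c by simp
  show "0 \<le> potential_sum" using plan_cost(3)[OF P] by (simp only: graph_residual)
qed

lemma optimal_plan_AE:
  assumes "optimal_plan sq_cost M N G"
  shows "AE p in G. snd p = K (K (fst p))"
proof -
  have G: "G \<in> transport_plans M N" and opt: "(\<integral>\<^sup>+(x, y). sq_cost x y \<partial>G) = ennreal potential_sum"
    using assms by (simp_all add: optimal_plan_def kantorovich_eq)
  have "potential_sum + (\<integral>p. residual p \<partial>G) = potential_sum"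
    using opt plan_cost(2,3)[OF G] potential_sum_nonneg by simp
  then have "(\<integral>p. residual p \<partial>G) = 0" by simp
  then have "AE p in G. residual p = 0"
    using integral_nonneg_eq_0_iff_AE[OF plan_cost(1)[OF G]] residual_nonneg by simp
  then show ?thesis by (simp add: residual_eq_0_iff)
qed

text \<open>A plan concentrated on the graph of a function is determined by its first marginal.\<close>

lemma optimal_plan_unique:
  assumes opt: "optimal_plan sq_cost M N G"
  shows "G = graph (\<lambda>x. K (K x))"
proof -
  have G: "sets G = sets (M \<Otimes>\<^sub>M N)" "distr G M fst = M"
    using opt by (auto simp: optimal_plan_def transport_plans_def)
  have m[measurable]: "fst \<in> measurable G M"
    unfolding measurable_cong_sets[OF G(1) refl] by measurable
  have [measurable]: "(\<lambda>x. K (K x)) \<in> measurable M N" using transport_mapsD[OF T] by simp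
  have "G = distr G (M \<Otimes>\<^sub>M N) (\<lambda>p. p)" using distr_id2[OF G(1)[symmetric]] by simp
  also have "\<dots> = distr G (M \<Otimes>\<^sub>M N) (\<lambda>p. (fst p, K (K (fst p))))"
  proof (rule distr_cong_AE)
    show "AE p in G. p = (fst p, K (K (fst p)))"
      using optimal_plan_AE[OF opt] by eventually_elim (simp add: prod_eq_iff)
    show "(\<lambda>p. p) \<in> measurable G (M \<Otimes>\<^sub>M N)" unfolding measurable_cong_sets[OF G(1) refl] by simp
  qed (simp_all add: G)
  also have "\<dots> = distr (distr G M fst) (M \<Otimes>\<^sub>M N) (\<lambda>x. (x, K (K x)))"
    by (subst distr_distr) (simp_all add: comp_def)
  finally show ?thesis by (simp only: G(2))
qed

lemma monge_eq: "monge sq_cost M N = kantorovich sq_cost M N"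
  and optimal_map_self_adjoint: "optimal_map sq_cost M N (\<lambda>x. K (K x))"
  and kantorovich_eq_map_cost: "kantorovich sq_cost M N = (\<integral>\<^sup>+x. sq_cost x (K (K x)) \<partial>M)"
proof -
  show c: "kantorovich sq_cost M N = (\<integral>\<^sup>+x. sq_cost x (K (K x)) \<partial>M)"
    using optimal_graph graph_cost[OF T] by (simp add: optimal_plan_def)
  have "kantorovich sq_cost M N \<le> (\<integral>\<^sup>+x. sq_cost x (F x) \<partial>M)" if "F \<in> transport_maps M N" for F
    using graph_plan[OF prob_M that] unfolding kantorovich_def graph_cost[OF that, symmetric]
    by (rule INF_lower)
  then show m: "monge sq_cost M N = kantorovich sq_cost M N"
    unfolding monge_def by (intro antisym INF_greatest INF_lower2[OF T]) (simp_all only: c order.refl)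
  show "optimal_map sq_cost M N (\<lambda>x. K (K x))"
    unfolding optimal_map_def m using T c by simp
qed

lemma optimal_map_unique:
  assumes "optimal_map sq_cost M N F"
  shows "AE x in M. F x = K (K x)"
proof -
  have F: "F \<in> transport_maps M N" and c: "(\<integral>\<^sup>+x. sq_cost x (F x) \<partial>M) = monge sq_cost M N"
    using assms by (auto simp: optimal_map_def)
  have [measurable]: "F \<in> measurable M N" using transport_mapsD[OF F] by simp
  have "optimal_plan sq_cost M N (graph F)"
    unfolding optimal_plan_def using graph_plan[OF prob_M F] graph_cost[OF F] c monge_eq by simp
  then have "AE p in graph F. snd p = K (K (fst p))" by (rule optimal_plan_AE)
  from AE_distrD[OF _ this] show ?thesis by simp
qed

end

section \<open>The optimal transport problem between matrix beta laws\<close>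

lemma inner_matrix: "X \<bullet> Y = trace (transpose X ** Y)" for X Y :: "real^'n^'n"
proof -
  have "X \<bullet> Y = (\<Sum>k\<in>UNIV. \<Sum>i\<in>UNIV. X $ k $ i * Y $ k $ i)" by (simp add: inner_vec_def)
  also have "\<dots> = (\<Sum>i\<in>UNIV. \<Sum>k\<in>UNIV. X $ k $ i * Y $ k $ i)" by (rule sum.swap)
  finally show ?thesis by (simp add: trace_def matrix_matrix_mult_def transpose_def)
qed

lemma norm_symmetric_matrix: "transpose X = X \<Longrightarrow> (norm X)\<^sup>2 = trace (X ** X)" for X :: "real^'n^'n"
  by (simp add: power2_norm_eq_inner inner_matrix)

lemma matrix_mult_scaleR:
  fixes A :: "real^'n^'m" and B :: "real^'k^'n"
  shows "A ** (r *\<^sub>R B) = r *\<^sub>R (A ** B)" "(r *\<^sub>R A) ** B = r *\<^sub>R (A ** B)"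
  by (simp_all add: matrix_matrix_mult_def vec_eq_iff sum_distrib_left mult_ac)

lemma congruence_linear: "linear (\<lambda>X. B ** X ** B)" for B :: "real^'n^'n"
  by (rule linearI) (simp_all add: matrix_add_ldistrib matrix_add_rdistrib matrix_mult_scaleR)

lemma congruence_self_adjoint:
  fixes B X Y :: "real^'n^'n"
  assumes "transpose B = B"
  shows "(B ** X ** B) \<bullet> Y = X \<bullet> (B ** Y ** B)"
proof -
  have "(B ** X ** B) \<bullet> Y = trace (B ** (transpose X ** B ** Y))"
    by (simp add: inner_matrix matrix_transpose_mul assms matrix_mul_assoc)
  also have "\<dots> = trace (transpose X ** B ** Y ** B)" by (rule trace_mul_sym)
  finally show ?thesis by (simp add: inner_matrix matrix_mul_assoc)
qed

text \<open>The trace is the squared norm of \<open>M\<^sup>1\<^sup>/\<^sup>2 X M\<^sup>1\<^sup>/\<^sup>2\<close>.\<close>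

lemma trace_sandwich_nonneg:
  fixes X M :: "real^'n^'n"
  assumes X: "X \<in> spd" and M: "M \<in> spd"
  shows "0 \<le> trace (X ** M ** X ** M)"
proof -
  let ?R = "spd_sqrt M"
  have sym: "transpose (?R ** X ** ?R) = ?R ** X ** ?R"
    using spd_symmetric[OF X] spd_symmetric[OF spd_sqrt_spd[OF M]] by (simp add: matrix_transpose_mul matrix_mul_assoc)
  have "trace (X ** M ** X ** M) = trace ((X ** ?R ** ?R ** X ** ?R) ** ?R)"
    by (subst (1 2) spd_sqrt_square[OF M, symmetric]) (simp only: matrix_mul_assoc)
  also have "\<dots> = trace ((?R ** X ** ?R) ** (?R ** X ** ?R))"
    by (subst trace_mul_sym) (simp only: matrix_mul_assoc)
  also have "\<dots> = (norm (?R ** X ** ?R))\<^sup>2" by (rule norm_symmetric_matrix[OF sym, symmetric])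
  finally show ?thesis by simp
qed

text \<open>Second moments of the general law, by congruence with the square root of the scale.\<close>

lemma trace_sandwich_moment_scaled:
  fixes S M :: "'n::{finite,linorder} sqmat"
  assumes q1: "q1 > (real CARD('n) - 1) / 2" and q2: "2 * q2 > real CARD('n) + 3"
    and S: "S \<in> spd" and M: "M \<in> spd"
  defines "q \<equiv> 2 * q2 - real CARD('n)" and "N \<equiv> spd_sqrt S ** M ** spd_sqrt S"
  shows "has_bochner_integral (mat_beta_II q1 q2 S) (\<lambda>X. trace (X ** M ** X ** M))
    ((diag_moment q1 q - offdiag_moment q1 q) * trace (N ** N) + offdiag_moment q1 q * (trace N)\<^sup>2)"
proof (rule has_bochner_integral_nn_integral)
  let ?R = "spd_sqrt S"
  let ?m = "(diag_moment q1 q - offdiag_moment q1 q) * trace (N ** N) + offdiag_moment q1 q * (trace N)\<^sup>2"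
  have R: "?R \<in> spd" by (rule spd_sqrt_spd[OF S])
  have N: "N \<in> spd" unfolding N_def by (rule spd_congruence_symmetric[OF R M])
  have d: "real CARD('n) \<ge> 1" by (simp add: Suc_leI)
  have q3: "q > 3" using q2 by (simp add: q_def)
  have "0 \<le> (real CARD('n) - 1) / 2" using d by simp
  then have "q1 > 0" using q1 by (rule le_less_trans)
  moreover have "diag_moment q1 q - offdiag_moment q1 q \<ge> 0"
    unfolding q_def moment_weights[OF q1 q2] using q3 \<open>q1 > 0\<close>
  proof (intro divide_nonneg_nonneg mult_nonneg_nonneg)
    have "2 * q1 * (q - 1) + (q + 1) \<ge> 0" using q3 \<open>q1 > 0\<close> by simp
    then show "0 \<le> 2 * q1 * (2 * q2 - real CARD('n)) - 2 * q1 + (2 * q2 - real CARD('n)) + 1"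
      by (simp add: q_def algebra_simps)
  qed (simp_all add: q_def)
  moreover have "trace (N ** N) \<ge> 0" using norm_symmetric_matrix[OF spd_symmetric[OF N]] by (metis zero_le_power2)
  ultimately show "0 \<le> ?m" using q3 by (simp add: offdiag_moment_def)
  show "(\<lambda>X. trace (X ** M ** X ** M)) \<in> borel_measurable (mat_beta_II q1 q2 S)"
    by (rule mat_beta_II_measurable[OF trace_sandwich_measurable])
  show "AE X in mat_beta_II q1 q2 S. 0 \<le> trace (X ** M ** X ** M)"
    using M by (intro AE_I2 trace_sandwich_nonneg) simp_all
  have m: "(\<lambda>X. ennreal (trace (X ** M ** X ** M))) \<in> borel_measurable borel"
    by (intro measurable_compose[OF trace_sandwich_measurable measurable_ennreal])
  have eq: "trace ((?R ** X ** ?R) ** M ** (?R ** X ** ?R) ** M) = trace (X ** N ** X ** N)" for X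
  proof -
    have "trace ((?R ** X ** ?R) ** M ** (?R ** X ** ?R) ** M) = trace (?R ** (X ** ?R ** M ** ?R ** X ** ?R ** M))"
      by (simp only: matrix_mul_assoc)
    also have "\<dots> = trace ((X ** ?R ** M ** ?R ** X ** ?R ** M) ** ?R)" by (rule trace_mul_sym)
    finally show ?thesis by (simp only: N_def matrix_mul_assoc)
  qed
  show "(\<integral>\<^sup>+X. ennreal (trace (X ** M ** X ** M)) \<partial>mat_beta_II q1 q2 S) = ennreal ?m"
    unfolding nn_integral_mat_beta_II_sqrt[OF m S] eq q_def by (rule trace_sandwich_moment[OF q1 q2 N])
qed

theorem corollary5:
  fixes S0 S1 :: "real ^ 'n::{finite,linorder} ^ 'n::{finite,linorder}" and q1 q2 :: real
  assumes "S0 \<in> spd" and "S1 \<in> spd"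
    and "q1 > (real CARD('n) - 1) / 2"
    and "2 * q2 > real CARD('n) + 3"
  shows
    "let \<mu>0 = mat_beta_II q1 q2 S0;
         \<mu>1 = mat_beta_II q1 q2 S1;
         c = (\<lambda>X Y. ennreal ((norm (X - Y))\<^sup>2));
         q = 2 * q2 - real CARD('n);
         C = spd_sqrt (spd_sqrt S0 ** S1 ** spd_sqrt S0);
         A = matrix_inv (spd_sqrt S0) ** spd_sqrt (spd_sqrt S0 ** S1 ** spd_sqrt S0)
               ** matrix_inv (spd_sqrt S0);
         T = (\<lambda>X. A ** X ** A);
         P = distr \<mu>0 (\<mu>0 \<Otimes>\<^sub>M \<mu>1) (\<lambda>X. (X, T X))
     in (optimal_map c \<mu>0 \<mu>1 T
          \<and> (\<forall>T'. optimal_map c \<mu>0 \<mu>1 T' \<longrightarrow> (AE X in \<mu>0. T' X = T X)))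
      \<and> (optimal_plan c \<mu>0 \<mu>1 P \<and> (\<forall>P'. optimal_plan c \<mu>0 \<mu>1 P' \<longrightarrow> P' = P))
      \<and> enn2ereal (kantorovich c \<mu>0 \<mu>1) = ereal (
            2 * q1 * (2 * q1 * q - 2 * q1 + q + 1) / (q * (q - 1) * (q - 3))
              * (norm (S0 - S1))\<^sup>2
          + 2 * q1 * (2 * q1 + q - 1) / (q * (q - 1) * (q - 3))
              * ((trace S0)\<^sup>2 + (trace S1)\<^sup>2 - 2 * (trace C)\<^sup>2))
      \<and> monge c \<mu>0 \<mu>1 = kantorovich c \<mu>0 \<mu>1"
proof -
  define \<mu>0 \<mu>1 where "\<mu>0 = mat_beta_II q1 q2 S0" and "\<mu>1 = mat_beta_II q1 q2 S1"
  define q where "q = 2 * q2 - real CARD('n)"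
  define R where "R = spd_sqrt S0"
  define C where "C = spd_sqrt (R ** S1 ** R)"
  define A where "A = matrix_inv R ** C ** matrix_inv R"
  define B where "B = spd_sqrt A"
  define T where "T = (\<lambda>X. A ** X ** A)"
  define K where "K = (\<lambda>X. B ** X ** B)"
  define K' where "K' = (\<lambda>X. matrix_inv B ** X ** matrix_inv B)"
  note S0 = assms(1) and S1 = assms(2) and q1 = assms(3) and q2 = assms(4)
  have R: "R \<in> spd" "R ** R = S0" unfolding R_def using spd_sqrt[OF S0] by auto
  have iR: "invertible R" by (rule spd_invertible[OF R(1)])
  have RS: "R ** S1 ** R \<in> spd" by (rule spd_congruence_symmetric[OF R(1) S1])
  have C: "C \<in> spd" "C ** C = R ** S1 ** R" unfolding C_def using spd_sqrt[OF RS] by auto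
  have A: "A \<in> spd" unfolding A_def by (intro spd_congruence_symmetric spd_matrix_inv R C)
  have B: "B \<in> spd" "B ** B = A" unfolding B_def using spd_sqrt[OF A] by auto
  have iB: "invertible B" by (rule spd_invertible[OF B(1)])
  \<comment> \<open>This product carries the mixed second moment, whence the trace of \<open>C\<close> in the cost.\<close>
  have RAR: "R ** A ** R = C"
  proof -
    have "R ** A ** R = (R ** matrix_inv R) ** C ** (matrix_inv R ** R)" by (simp only: A_def matrix_mul_assoc)
    then show ?thesis by (simp add: matrix_inv_left[OF iR] matrix_inv_right[OF iR])
  qed
  have ASA: "A ** S0 ** A = S1"
  proof -
    have "A ** S0 ** A = matrix_inv R ** (C ** (matrix_inv R ** R) ** (R ** matrix_inv R) ** C) ** matrix_inv R"
      by (simp only: A_def R(2)[symmetric] matrix_mul_assoc)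
    also have "\<dots> = matrix_inv R ** (C ** C) ** matrix_inv R"
      by (simp add: matrix_inv_left[OF iR] matrix_inv_right[OF iR])
    also have "\<dots> = (matrix_inv R ** R) ** S1 ** (R ** matrix_inv R)" by (simp only: C(2) matrix_mul_assoc)
    finally show ?thesis by (simp add: matrix_inv_left[OF iR] matrix_inv_right[OF iR])
  qed
  have T_map: "T \<in> transport_maps \<mu>0 \<mu>1"
    using congruence_transport_map[OF A S0, of q1 q2] by (simp add: T_def \<mu>0_def \<mu>1_def ASA)
  have KK: "K (K X) = T X" for X
  proof -
    have "K (K X) = (B ** B) ** X ** (B ** B)" by (simp only: K_def matrix_mul_assoc)
    then show ?thesis by (simp add: B(2) T_def)
  qed
  have KK': "K (K' X) = X" "K' (K X) = X" for X
  proof -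
    have "K (K' X) = (B ** matrix_inv B) ** X ** (matrix_inv B ** B)"
      "K' (K X) = (matrix_inv B ** B) ** X ** (B ** matrix_inv B)"
      by (simp_all only: K_def K'_def matrix_mul_assoc)
    then show "K (K' X) = X" "K' (K X) = X" by (simp_all add: matrix_inv_left[OF iB] matrix_inv_right[OF iB])
  qed
  have q2': "q2 > (real CARD('n) - 1) / 2"
  proof -
    have "real CARD('n) \<ge> 1" by (simp add: Suc_leI)
    then show ?thesis using q2 by simp
  qed
  have prob: "prob_space \<mu>0" "prob_space \<mu>1"
    unfolding \<mu>0_def \<mu>1_def by (intro prob_space_mat_beta_II S0 S1 q1 q2')+
  have sets: "sets \<mu>0 = sets (restrict_space borel spd)" "sets \<mu>1 = sets (restrict_space borel spd)"
    by (simp_all add: \<mu>0_def \<mu>1_def)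
  define al be where "al = diag_moment q1 q - offdiag_moment q1 q" and "be = offdiag_moment q1 q"
  have norm_moment: "has_bochner_integral (mat_beta_II q1 q2 S) (\<lambda>X. (norm X)\<^sup>2) (al * (norm S)\<^sup>2 + be * (trace S)\<^sup>2)"
    if S: "S \<in> spd" for S :: "'n::{finite,linorder} sqmat"
  proof -
    have "has_bochner_integral (mat_beta_II q1 q2 S) (\<lambda>X. trace (X ** mat 1 ** X ** mat 1)) (al * (norm S)\<^sup>2 + be * (trace S)\<^sup>2)"
      using trace_sandwich_moment_scaled[OF q1 q2 S spd_mat_1]
      by (simp add: spd_sqrt_square[OF S] norm_symmetric_matrix[OF spd_symmetric[OF S]] al_def be_def q_def)
    then show ?thesis
      by (rule has_bochner_integral_cong[THEN iffD1, rotated -1]) (simp_all add: norm_symmetric_matrix spd_symmetric)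
  qed
  note m0 = norm_moment[OF S0, folded \<mu>0_def] and m1 = norm_moment[OF S1, folded \<mu>1_def]
  have cross: "has_bochner_integral \<mu>0 (\<lambda>X. trace (X ** A ** X ** A)) (al * trace (S0 ** S1) + be * (trace C)\<^sup>2)"
  proof -
    have "trace (C ** C) = trace (R ** (S1 ** R))" by (simp only: C(2) matrix_mul_assoc)
    also have "\<dots> = trace (S1 ** (R ** R))" by (subst trace_mul_sym) (simp only: matrix_mul_assoc)
    also have "\<dots> = trace (S0 ** S1)" unfolding R(2) by (rule trace_mul_sym)
    finally show ?thesis
      using trace_sandwich_moment_scaled[OF q1 q2 S0 A]
      by (simp add: R_def[symmetric] RAR al_def be_def q_def \<mu>0_def)
  qed
  have int: "integrable \<mu>0 (\<lambda>X. (norm X)\<^sup>2)" "integrable \<mu>1 (\<lambda>X. (norm X)\<^sup>2)"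
    using m0 m1 by (auto simp: has_bochner_integral_iff)
  have tB: "transpose B = B" "transpose (matrix_inv B) = matrix_inv B"
    using B(1) spd_matrix_inv[OF B(1)] by (simp_all add: spd_symmetric)
  have lin: "linear K" "linear K'" unfolding K_def K'_def by (rule congruence_linear)+
  have adj: "K X \<bullet> Y = X \<bullet> K Y" "K' X \<bullet> Y = X \<bullet> K' Y" for X Y
    unfolding K_def K'_def by (rule congruence_self_adjoint[OF tB(1)], rule congruence_self_adjoint[OF tB(2)])
  have T_eq: "(\<lambda>X. K (K X)) = T" by (simp add: KK fun_eq_iff)
  note ot = prob sets int lin(1) adj(1) lin(2) adj(2) KK' T_map[folded T_eq]
  let ?c = "\<lambda>X Y :: 'n::{finite,linorder} sqmat. ennreal ((norm (X - Y))\<^sup>2)"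
  let ?v = "al * (norm (S0 - S1))\<^sup>2 + be * ((trace S0)\<^sup>2 + (trace S1)\<^sup>2 - 2 * (trace C)\<^sup>2)"
  have cost: "kantorovich ?c \<mu>0 \<mu>1 = ennreal ?v"
    and cost_nonneg: "0 \<le> ?v"
  proof -
    have push: "has_bochner_integral \<mu>0 (\<lambda>X. (norm (T X))\<^sup>2) (al * (norm S1)\<^sup>2 + be * (trace S1)\<^sup>2)"
    proof -
      note T = transport_mapsD[OF T_map]
      have "(\<lambda>X. (norm X)\<^sup>2) \<in> borel_measurable \<mu>1"
        using m1 by (auto dest: has_bochner_integral_iff[THEN iffD1])
      from integrable_distr_eq[OF T(1) this] integral_distr[OF T(1) this] m1 show ?thesis
        unfolding T(2) by (simp add: has_bochner_integral_iff)
    qed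
    have expand: "(norm (X - T X))\<^sup>2 = (norm X)\<^sup>2 + (norm (T X))\<^sup>2 - 2 * trace (X ** A ** X ** A)" if "X \<in> spd" for X
    proof -
      have "X \<bullet> T X = trace (X ** A ** X ** A)"
        by (simp add: inner_matrix T_def spd_symmetric[OF that] matrix_mul_assoc)
      then show ?thesis by (simp add: power2_norm_eq_inner inner_diff inner_commute algebra_simps)
    qed
    have "S0 \<bullet> S1 = trace (S0 ** S1)" by (simp add: inner_matrix spd_symmetric[OF S0])
    then have n: "(norm (S0 - S1))\<^sup>2 = (norm S0)\<^sup>2 + (norm S1)\<^sup>2 - 2 * trace (S0 ** S1)"
      by (simp add: power2_norm_eq_inner inner_diff inner_commute algebra_simps)
    have v: "(al * (norm S0)\<^sup>2 + be * (trace S0)\<^sup>2) + (al * (norm S1)\<^sup>2 + be * (trace S1)\<^sup>2)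
        - 2 * (al * trace (S0 ** S1) + be * (trace C)\<^sup>2) = ?v"
      unfolding n by (simp add: algebra_simps)
    have "has_bochner_integral \<mu>0 (\<lambda>X. (norm X)\<^sup>2 + (norm (T X))\<^sup>2 - 2 * trace (X ** A ** X ** A)) ?v"
      unfolding v[symmetric]
      by (intro has_bochner_integral_diff has_bochner_integral_add has_bochner_integral_mult_right m0 push cross)
    then have bi: "has_bochner_integral \<mu>0 (\<lambda>X. (norm (X - T X))\<^sup>2) ?v"
      by (rule has_bochner_integral_cong[THEN iffD1, rotated -1]) (simp_all add: expand \<mu>0_def)
    have "0 \<le> (\<integral>X. (norm (X - T X))\<^sup>2 \<partial>\<mu>0)" by (rule integral_nonneg_AE) simp
    then show "0 \<le> ?v" unfolding has_bochner_integral_integral_eq[OF bi] .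
    have "(\<integral>\<^sup>+X. ?c X (T X) \<partial>\<mu>0) = ennreal ?v"
      using bi nn_integral_eq_integral[of \<mu>0 "\<lambda>X. (norm (X - T X))\<^sup>2"] by (simp add: has_bochner_integral_iff)
    then show "kantorovich ?c \<mu>0 \<mu>1 = ennreal ?v"
      using kantorovich_eq_map_cost[OF ot] by (simp add: KK)
  qed
  have cost_formula: "enn2ereal (kantorovich ?c \<mu>0 \<mu>1) = ereal (
            2 * q1 * (2 * q1 * q - 2 * q1 + q + 1) / (q * (q - 1) * (q - 3))
              * (norm (S0 - S1))\<^sup>2
          + 2 * q1 * (2 * q1 + q - 1) / (q * (q - 1) * (q - 3))
              * ((trace S0)\<^sup>2 + (trace S1)\<^sup>2 - 2 * (trace C)\<^sup>2))"
    unfolding cost enn2ereal_ennreal[OF cost_nonneg]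
    unfolding al_def be_def q_def moment_weights[OF q1 q2] unfolding offdiag_moment_def ..
  have map: "optimal_map ?c \<mu>0 \<mu>1 T" "\<forall>T'. optimal_map ?c \<mu>0 \<mu>1 T' \<longrightarrow> (AE X in \<mu>0. T' X = T X)"
    using optimal_map_self_adjoint[OF ot] optimal_map_unique[OF ot] unfolding KK by blast+
  have plan: "optimal_plan ?c \<mu>0 \<mu>1 (distr \<mu>0 (\<mu>0 \<Otimes>\<^sub>M \<mu>1) (\<lambda>X. (X, T X)))"
    "\<forall>P'. optimal_plan ?c \<mu>0 \<mu>1 P' \<longrightarrow> P' = distr \<mu>0 (\<mu>0 \<Otimes>\<^sub>M \<mu>1) (\<lambda>X. (X, T X))"
    using optimal_graph[OF ot] optimal_plan_unique[OF ot] unfolding KK by blast+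
  have monge: "monge ?c \<mu>0 \<mu>1 = kantorovich ?c \<mu>0 \<mu>1" by (rule monge_eq[OF ot])
  show ?thesis
    unfolding Let_def R_def[symmetric] C_def[symmetric] A_def[symmetric]
      q_def[symmetric] \<mu>0_def[symmetric] \<mu>1_def[symmetric]
    using map plan cost_formula monge unfolding T_def by (intro conjI)
qed

end
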